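(* Let $\mu:[0,1]\to\mathcal M_+$ be an absolutely continuous curve, and let $\nabla\psi_t$ and $h_t$ satisfy the continuity equation $$\dot\mu_t+\nabla\cdot(\hat\mu_t*\nabla\psi_t)=h_t\,p\qquad\text{for a.e. }t\in[0,1].$$ Then the following two assertions are equivalent: (i) $(\mu_t)_{t\in[0,1]}$ is a constant-speed geodesic for $\mathcal W^{a,b}_p$. (ii) For all $\zeta\in C^1_c((0,1);\mathbb R)$, $$\int_0^1h_t\,\dot\zeta(t)\,dt=\frac{b^2}{2a^2}\int_0^1\Big[\sum_{x,y\in\mathcal X}\nabla\psi_t(x,y)^2\,\partial_1\theta(\mu_t(x),\mu_t(y))\,K(x,y)\,\varpi(x)\,p(x)\Big]\zeta(t)\,dt,$$ and for all $\zeta\in C^1_c((0,1);\mathbb R)$ and all $x,y\in\mathcal X$ with $K(x,y)\neq0$, $$\int_0^1\nabla\psi_t(x,y)\,\dot\zeta(t)\,dt=\frac12\int_0^1\Big(\sum_{z\in\mathcal X}\nabla\psi_t(z,y)^2K(y,z)\,\partial_1\theta(\mu_t(y),\mu_t(z))-\sum_{z\in\mathcal X}\nabla\psi_t(z,x)^2K(x,z)\,\partial_1\theta(\mu_t(x),\mu_t(z))\Big)\zeta(t)\,dt.$$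
   Context: Setting. $\mathcal X$ is a finite set, $K:\mathcal X\times\mathcal X\to[0,\infty)$ an irreducible Markov kernel ($\sum_y K(x,y)=1$) with unique invariant probability $\varpi$ ($\varpi(x)=\sum_y\varpi(y)K(y,x)$, $\sum_y\varpi(y)=1$), assumed reversible: $K(x,y)\varpi(x)=K(y,x)\varpi(y)$. $\mathcal M$ is the set of $\mu:\mathcal X\to[0,\infty)$ and $\mathcal M_+$ the set of $\mu:\mathcal X\to(0,\infty)$. Fix $a,b>0$ and $p\in\mathcal M_+$ with $\sum_x p(x)\varpi(x)=1$. Notation. $\nabla\psi(x,y)=\psi(y)-\psi(x)$ for $\psi\in\mathbb R^{\mathcal X}$; $(\nabla\cdot\Psi)(x)=\frac12\sum_y(\Psi(x,y)-\Psi(y,x))K(x,y)$ for $\Psi\in\mathbb R^{\mathcal X\times\mathcal X}$; $*$ is the entrywise product. Logarithmic mean: $\theta(u,v)=\int_0^1u^\xi v^{1-\xi}\,d\xi$ for $u,v\ge0$, i.e. $\theta(u,u)=u$, $\theta(u,v)=\frac{u-v}{\log u-\log v}$ for $u\ne v$ positive, and $\theta(u,v)=0$ if $u=0$ or $v=0$; $\partial_1\theta$ is the partial derivative in the first argument on $(0,\infty)^2$. $\hat\mu(x,y)=\theta(\mu(x),\mu(y))$. For $\mu\in\mathcal M_+$ and $\rho\in\mathbb R^{\mathcal X}$ the equation $\rho+\nabla\cdot(\hat\mu*\nabla\psi)=h\,p$ has a unique solution $(\nabla\psi,h)$, so $(\nabla\psi_t,h_t)$ in the claim is determined by $\mu_t,\dot\mu_t$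 for a.e. $t$ and is measurable in $t$. The identities in (ii) are understood to include that the integrals appearing in them are well defined (integrable integrands). Metric. $\mathcal W^{a,b}_p(\mu_0,\mu_1)\ge0$ and $\mathcal W^{a,b}_p(\mu_0,\mu_1)^2$ is the infimum of $a^2\int_0^1h_t^2\,dt+b^2\int_0^1\frac12\sum_{x,y}(\psi_t(y)-\psi_t(x))^2\hat\mu_t(x,y)K(x,y)\varpi(x)\,dt$ over all triples $(\mu_t,\psi_t,h_t)_{t\in[0,1]}$ with $t\mapsto\mu_t\in\mathcal M$ absolutely continuous on $[0,1]$ with the given endpoints $\mu_0,\mu_1$, $\psi:[0,1]\to\mathbb R^{\mathcal X}$ and $h:[0,1]\to\mathbb R$ measurable, and $\dot\mu_t(x)+\sum_y(\psi_t(y)-\psi_t(x))\hat\mu_t(x,y)K(x,y)=h_tp(x)$ for a.e. $t$ and all $x$. It is known that $\mathcal W^{a,b}_p$ is a metric on $\mathcal M$. A constant-speed geodesic is a curve $(\mu_t)_{t\in[0,1]}$ in $\mathcal M$ with $\mathcal W^{a,b}_p(\mu_s,\mu_t)=|t-s|\,\mathcal W^{a,b}_p(\mu_0,\mu_1)$ for all $s,t\in[0,1]$. *)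

theory Defs
  imports "HOL-Analysis.Analysis"
begin

section \<open>Kernels, densities, discrete calculus\<close>

definition markov_kernel :: "('x::finite \<Rightarrow> 'x \<Rightarrow> real) \<Rightarrow> bool" where
  "markov_kernel K \<longleftrightarrow> (\<forall>x y. 0 \<le> K x y) \<and> (\<forall>x. (\<Sum>y\<in>UNIV. K x y) = 1)"

definition irreducible_kernel :: "('x::finite \<Rightarrow> 'x \<Rightarrow> real) \<Rightarrow> bool" where
  "irreducible_kernel K \<longleftrightarrow> (\<forall>x y. (x, y) \<in> {(x, y). 0 < K x y}\<^sup>*)"

definition invariant_probability ::
    "('x::finite \<Rightarrow> 'x \<Rightarrow> real) \<Rightarrow> ('x \<Rightarrow> real) \<Rightarrow> bool" where
  "invariant_probability K \<pi> \<longleftrightarrow>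
     (\<forall>x. 0 \<le> \<pi> x) \<and> (\<Sum>y\<in>UNIV. \<pi> y) = 1 \<and> (\<forall>x. \<pi> x = (\<Sum>y\<in>UNIV. \<pi> y * K y x))"

definition reversible_kernel ::
    "('x::finite \<Rightarrow> 'x \<Rightarrow> real) \<Rightarrow> ('x \<Rightarrow> real) \<Rightarrow> bool" where
  "reversible_kernel K \<pi> \<longleftrightarrow> (\<forall>x y. K x y * \<pi> x = K y x * \<pi> y)"

definition nonneg_densities :: "('x::finite \<Rightarrow> real) set" where
  "nonneg_densities = {\<mu>. \<forall>x. 0 \<le> \<mu> x}"

definition pos_densities :: "('x::finite \<Rightarrow> real) set" where
  "pos_densities = {\<mu>. \<forall>x. 0 < \<mu> x}"

definition grad :: "('x::finite \<Rightarrow> real) \<Rightarrow> 'x \<Rightarrow> 'x \<Rightarrow> real" where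
  "grad \<psi> x y = \<psi> y - \<psi> x"

definition div_K ::
    "('x::finite \<Rightarrow> 'x \<Rightarrow> real) \<Rightarrow> ('x \<Rightarrow> 'x \<Rightarrow> real) \<Rightarrow> 'x \<Rightarrow> real" where
  "div_K K \<Psi> x = 1 / 2 * (\<Sum>y\<in>UNIV. (\<Psi> x y - \<Psi> y x) * K x y)"

section \<open>Logarithmic mean\<close>

text \<open>For real exponents \<^term>\<open>0 powr a = (0::real)\<close> (also for \<^term>\<open>a = 0\<close>), so this
  vanishes whenever one of the arguments is zero.\<close>

definition log_mean :: "real \<Rightarrow> real \<Rightarrow> real" where
  "log_mean u v = integral {0..1} (\<lambda>\<xi>. u powr \<xi> * v powr (1 - \<xi>))"

definition d1_log_mean :: "real \<Rightarrow> real \<Rightarrow> real" where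
  "d1_log_mean u v = deriv (\<lambda>w. log_mean w v) u"

definition edge_mean :: "('x::finite \<Rightarrow> real) \<Rightarrow> 'x \<Rightarrow> 'x \<Rightarrow> real" where
  "edge_mean \<mu> x y = log_mean (\<mu> x) (\<mu> y)"

lemma log_mean_zero [simp]: "log_mean 0 v = 0" "log_mean u 0 = 0"
  by (simp_all add: log_mean_def)

lemma log_mean_self: "0 \<le> u \<Longrightarrow> log_mean u u = u"
proof (cases "u = 0")
  case False
  assume "0 \<le> u"
  with False have "(\<lambda>\<xi>. u powr \<xi> * u powr (1 - \<xi>)) = (\<lambda>\<xi>. u)"
    by (auto simp flip: powr_add)
  then show ?thesis by (simp add: log_mean_def)
qed simp

lemma log_mean_pos:
  assumes "0 < u" "0 < v" "u \<noteq> v"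
  shows "log_mean u v = (u - v) / (ln u - ln v)"
proof -
  have ne: "ln u - ln v \<noteq> 0" using assms by simp
  define F where "F = (\<lambda>\<xi>. u powr \<xi> * v powr (1 - \<xi>) / (ln u - ln v))"
  have "((\<lambda>\<xi>. u powr \<xi> * v powr (1 - \<xi>)) has_integral F 1 - F 0) {0..1}"
  proof (rule fundamental_theorem_of_calculus)
    fix x :: real
    have F_eq: "F = (\<lambda>\<xi>. exp (\<xi> * ln u) * exp ((1 - \<xi>) * ln v) / (ln u - ln v))"
      using assms by (simp add: F_def powr_def)
    have "(F has_real_derivative
        (u powr x * ln u * v powr (1 - x) - u powr x * (v powr (1 - x) * ln v)) / (ln u - ln v))
        (at x within {0..1})"
      unfolding F_eq using assms
      by (intro DERIV_cdivide) (auto intro!: derivative_eq_intros simp: powr_def algebra_simps)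
    moreover have "(u powr x * ln u * v powr (1 - x) - u powr x * (v powr (1 - x) * ln v))
        / (ln u - ln v) = u powr x * v powr (1 - x)"
      using ne by (simp add: field_simps)
    ultimately show "(F has_vector_derivative u powr x * v powr (1 - x)) (at x within {0..1})"
      by (simp add: has_real_derivative_iff_has_vector_derivative)
  qed simp
  moreover have "F 1 - F 0 = (u - v) / (ln u - ln v)"
    using assms by (simp add: F_def diff_divide_distrib)
  ultimately show ?thesis
    unfolding log_mean_def by (metis integral_unique)
qed

section \<open>The distance and its geodesics\<close>

definition abs_continuous_on_interval :: "real \<Rightarrow> real \<Rightarrow> (real \<Rightarrow> real) \<Rightarrow> bool" where
  "abs_continuous_on_interval c d f \<longleftrightarrow>
     (\<forall>\<epsilon>>0. \<exists>\<delta>>0. \<forall>I :: (real \<times> real) set.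
        finite I \<and> (\<forall>(s, t)\<in>I. c \<le> s \<and> s < t \<and> t \<le> d) \<and>
        pairwise (\<lambda>(s, t) (s', t'). {s<..<t} \<inter> {s'<..<t'} = {}) I \<and>
        (\<Sum>(s, t)\<in>I. t - s) < \<delta>
        \<longrightarrow> (\<Sum>(s, t)\<in>I. \<bar>f t - f s\<bar>) < \<epsilon>)"

definition abs_continuous_curve :: "(real \<Rightarrow> 'x::finite \<Rightarrow> real) \<Rightarrow> bool" where
  "abs_continuous_curve \<mu> \<longleftrightarrow> (\<forall>x. abs_continuous_on_interval 0 1 (\<lambda>t. \<mu> t x))"

text \<open>Curves are total functions on the reals of which only the values on \<open>[0,1]\<close> matter;
  hence derivatives are taken within \<open>[0,1]\<close>.\<close>

definition admissible ::
    "('x::finite \<Rightarrow> 'x \<Rightarrow> real) \<Rightarrow> ('x \<Rightarrow> real) \<Rightarrow> ('x \<Rightarrow> real) \<Rightarrow> ('x \<Rightarrow> real) \<Rightarrow>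
     (real \<Rightarrow> 'x \<Rightarrow> real) \<Rightarrow> (real \<Rightarrow> 'x \<Rightarrow> real) \<Rightarrow> (real \<Rightarrow> real) \<Rightarrow> bool" where
  "admissible K p \<mu>0 \<mu>1 \<mu> \<psi> h \<longleftrightarrow>
     (\<forall>t\<in>{0..1}. \<mu> t \<in> nonneg_densities) \<and> abs_continuous_curve \<mu> \<and>
     \<mu> 0 = \<mu>0 \<and> \<mu> 1 = \<mu>1 \<and>
     (\<forall>x. (\<lambda>t. \<psi> t x) \<in> borel_measurable (lebesgue_on {0..1})) \<and>
     h \<in> borel_measurable (lebesgue_on {0..1}) \<and>
     (AE t in lebesgue_on {0..1}. \<forall>x. \<exists>\<mu>'.
        ((\<lambda>s. \<mu> s x) has_real_derivative \<mu>') (at t within {0..1}) \<and>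
        \<mu>' + (\<Sum>y\<in>UNIV. (\<psi> t y - \<psi> t x) * edge_mean (\<mu> t) x y * K x y) = h t * p x)"

definition action ::
    "('x::finite \<Rightarrow> 'x \<Rightarrow> real) \<Rightarrow> ('x \<Rightarrow> real) \<Rightarrow> real \<Rightarrow> real \<Rightarrow>
     (real \<Rightarrow> 'x \<Rightarrow> real) \<Rightarrow> (real \<Rightarrow> 'x \<Rightarrow> real) \<Rightarrow> (real \<Rightarrow> real) \<Rightarrow> ennreal" where
  "action K \<pi> a b \<mu> \<psi> h =
     ennreal (a\<^sup>2) * (\<integral>\<^sup>+ t. ennreal ((h t)\<^sup>2) \<partial>lebesgue_on {0..1}) +
     ennreal (b\<^sup>2) * (\<integral>\<^sup>+ t. ennreal (1 / 2 * (\<Sum>x\<in>UNIV. \<Sum>y\<in>UNIV.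
        (\<psi> t y - \<psi> t x)\<^sup>2 * edge_mean (\<mu> t) x y * K x y * \<pi> x)) \<partial>lebesgue_on {0..1})"

text \<open>The infimum is formed in the extended nonnegative reals, so competitors of infinite action
  are harmless. Between two nonnegative densities it is finite, so the conversion to a real
  number loses nothing.\<close>

definition transport_dist ::
    "('x::finite \<Rightarrow> 'x \<Rightarrow> real) \<Rightarrow> ('x \<Rightarrow> real) \<Rightarrow> ('x \<Rightarrow> real) \<Rightarrow> real \<Rightarrow> real \<Rightarrow>
     ('x \<Rightarrow> real) \<Rightarrow> ('x \<Rightarrow> real) \<Rightarrow> real" where
  "transport_dist K \<pi> p a b \<mu>0 \<mu>1 =
     sqrt (enn2real (INF (\<mu>, \<psi>, h) \<in> {(\<mu>, \<psi>, h). admissible K p \<mu>0 \<mu>1 \<mu> \<psi> h}.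
       action K \<pi> a b \<mu> \<psi> h))"

definition constant_speed_geodesic ::
    "(('x::finite \<Rightarrow> real) \<Rightarrow> ('x \<Rightarrow> real) \<Rightarrow> real) \<Rightarrow> (real \<Rightarrow> 'x \<Rightarrow> real) \<Rightarrow> bool" where
  "constant_speed_geodesic W \<mu> \<longleftrightarrow>
     (\<forall>t\<in>{0..1}. \<mu> t \<in> nonneg_densities) \<and>
     (\<forall>s\<in>{0..1}. \<forall>t\<in>{0..1}. W (\<mu> s) (\<mu> t) = \<bar>t - s\<bar> * W (\<mu> 0) (\<mu> 1))"

section \<open>Test functions\<close>

text \<open>Elements of \<open>C\<^sup>1\<^sub>c((0,1))\<close>, extended by zero to the real line.\<close>

definition C1c_unit_interval :: "(real \<Rightarrow> real) set" where
  "C1c_unit_interval = {\<zeta>. \<zeta> C1_differentiable_on UNIV \<and>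
     compact (closure {t. \<zeta> t \<noteq> 0}) \<and> closure {t. \<zeta> t \<noteq> 0} \<subseteq> {0<..<1}}"

end

theory Submission
  imports Defs
begin

text \<open>
  Why the theorem holds. Write \<open>\<langle>f, g\<rangle>\<close> for the inner product weighted by \<open>\<pi>\<close>. A pair
  \<open>(\<nabla>\<psi>, h)\<close> is the same thing as one function \<open>\<phi>\<close> on the state space, fixed by
  \<open>\<nabla>\<phi> = b\<^sup>2 \<nabla>\<psi>\<close> and \<open>\<langle>\<phi>, p\<rangle> = a\<^sup>2 h\<close> (\<open>potential\<close>). In terms of \<open>\<phi>\<close> the continuity
  equation says \<open>\<mu>' = vel \<mu> \<phi>\<close>, where \<open>vel \<mu>\<close> is linear and positive definite, the action density
  is \<open>energy \<mu> \<phi> = \<langle>\<phi>, vel \<mu> \<phi>\<rangle>\<close>, and the two equations of (ii) together say, tested against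
  \<open>C\<^sup>1\<^sub>c\<close> functions, that \<open>\<phi>' = - force \<mu> \<phi>\<close> (\<open>weak_hamiltonian_iff\<close>). So the theorem states that a
  curve of positive densities is a geodesic exactly if it solves Hamilton's equations.

  Everything rests on concavity and homogeneity of the logarithmic mean, which lies below its tangent
  planes: \<open>\<theta>(u,v) \<le> \<partial>\<^sub>1\<theta>(u\<^sub>0,v\<^sub>0) u + \<partial>\<^sub>1\<theta>(v\<^sub>0,u\<^sub>0) v\<close>. Together with Young's inequality it
  gives, for every competitor with density \<open>n\<close> and velocity \<open>n'\<close>, every \<open>\<phi>\<close> and every positive \<open>m\<close>,
  \<open>cost \<ge> 2\<langle>\<phi>, n'\<rangle> - 2\<langle>force m \<phi>, n\<rangle> - \<langle>\<phi>, p\<rangle>\<^sup>2 / a\<^sup>2\<close> (\<open>cost_ge_dual\<close>). If moreover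
  \<open>\<phi>' \<le> - force m \<phi>\<close> along a time-dependent \<open>\<phi>\<close>, the first two terms dominate the total derivative
  \<open>2\<langle>\<phi>, n\<rangle>'\<close>, and integration bounds the action of all competitors at once (\<open>action_ge_dual\<close>).

  From (ii) to (i): the weak equations are upgraded to classical ones by du Bois-Reymond's lemma. The
  energy is then conserved, which in turn bounds \<open>\<phi>\<close> up to the ends of the time interval
  (\<open>hamiltonian_if_weak\<close>). For a classical solution the dual bound is attained on every subinterval,
  hence the curve is a geodesic of constant speed (\<open>geodesic_if_hamiltonian\<close>): critical points are
  minimisers, because the problem is convex in density and momentum.

  From (i) to (ii): the dual bound with a short affine \<open>\<phi>\<close> shows that the energy is almost everywhere
  at most the squared metric speed (\<open>energy_le_metric_speed\<close>), so the given curve has minimal action and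
  \<open>\<phi>\<close> is bounded. Perturbing one component of the curve by a small multiple of a test function cannot
  lower the action, and the same tangent-plane inequality turns this into the weak equations
  (\<open>weak_if_geodesic\<close>).
\<close>

section \<open>The logarithmic mean\<close>

lemma has_integral_flip01:
  fixes f :: "real \<Rightarrow> real"
  assumes "(f has_integral i) {0..1}"
  shows "((\<lambda>x. f (1 - x)) has_integral i) {0..1}"
proof -
  have "(f has_integral i) (cbox 0 1)" using assms by simp
  from has_integral_affinity[OF this, of "-1" 1]
  show ?thesis
    by (simp add: has_integral_restrict image_comp o_def)
qed

text \<open>The derivative of the integrand of \<open>log_mean\<close> in its first argument, integrated. It is the slope of
  the tangent plane below, and thereby seen to be \<open>d1_log_mean\<close>.\<close>

definition d1_mean :: "real \<Rightarrow> real \<Rightarrow> real" where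
  "d1_mean u v = integral {0..1} (\<lambda>\<xi>. \<xi> * (u powr (\<xi> - 1) * v powr (1 - \<xi>)))"

lemma continuous_on_d1_mean:
  "continuous_on ({0<..} \<times> {0<..}) (\<lambda>z. d1_mean (fst z) (snd z))"
proof -
  have "continuous_on ({0<..} \<times> {0<..})
     (\<lambda>z::real\<times>real. integral (cbox 0 1) (\<lambda>\<xi>. \<xi> * (fst z powr (\<xi> - 1) * snd z powr (1 - \<xi>))))"
    by (rule integral_continuous_on_param) (auto simp: case_prod_beta intro!: continuous_intros)
  then show ?thesis by (simp add: d1_mean_def)
qed

lemma d1_mean_has_integral:
  assumes "0 < u" "0 < v"
  shows "((\<lambda>\<xi>. \<xi> * (u powr (\<xi> - 1) * v powr (1 - \<xi>))) has_integral d1_mean u v) {0..1}"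
  unfolding d1_mean_def
  by (intro integrable_integral integrable_continuous_real continuous_intros) (use assms in auto)

lemma d1_mean_nonneg: "0 < u \<Longrightarrow> 0 < v \<Longrightarrow> 0 \<le> d1_mean u v"
  using d1_mean_has_integral by (rule has_integral_nonneg) auto

lemma log_mean_has_integral:
  assumes "0 \<le> u" "0 \<le> v"
  shows "((\<lambda>\<xi>. u powr \<xi> * v powr (1 - \<xi>)) has_integral log_mean u v) {0..1}"
proof (cases "u = 0 \<or> v = 0")
  case True
  then show ?thesis by auto
next
  case False
  then show ?thesis
    unfolding log_mean_def using assms
    by (intro integrable_integral integrable_continuous_real continuous_intros) auto
qed

lemma log_mean_commute: "log_mean u v = log_mean v u" if "0 \<le> u" "0 \<le> v"
  using has_integral_flip01[OF log_mean_has_integral[OF that]] log_mean_has_integral[OF that(2,1)]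
  by (auto simp: mult.commute dest: has_integral_unique)

lemma log_mean_nonneg: "0 \<le> log_mean u v" if "0 \<le> u" "0 \<le> v"
  using log_mean_has_integral[OF that] by (rule has_integral_nonneg) auto

lemma log_mean_positive:
  assumes "0 < u" "0 < v"
  shows "0 < log_mean u v"
proof (cases "u = v")
  case True
  then show ?thesis using assms by (simp add: log_mean_self)
next
  case False
  then show ?thesis using assms
    by (auto simp: log_mean_pos zero_less_divide_iff)
qed

lemma powr_mean_split:
  fixes u0 v0 :: real
  assumes "0 < u0" "0 < v0"
  shows "(u0 powr \<xi> * v0 powr (1 - \<xi>)) * (\<xi> * (u / u0) + (1 - \<xi>) * (v / v0))
          = \<xi> * (u0 powr (\<xi> - 1) * v0 powr (1 - \<xi>)) * u + (1 - \<xi>) * (v0 powr (- \<xi>) * u0 powr \<xi>) * v"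
proof -
  have 1: "u0 powr (\<xi> - 1) = u0 powr \<xi> / u0"
    using assms by (simp add: powr_diff)
  have 2: "v0 powr (- \<xi>) = v0 powr (1 - \<xi>) / v0"
    using assms by (simp add: powr_diff powr_minus divide_inverse)
  show ?thesis
    unfolding 1 2 by (simp add: algebra_simps)
qed

text \<open>Concavity of the logarithmic mean in the form of a global tangent plane. The integrand is a weighted
  geometric mean, so Young's inequality applies for each \<open>\<xi>\<close>; by homogeneity the tangent plane passes
  through the origin. The arguments on the left may vanish, which is what allows competitors with
  zeros.\<close>

lemma log_mean_le_tangent:
  assumes "0 < u0" "0 < v0" "0 \<le> u" "0 \<le> v"
  shows "log_mean u v \<le> d1_mean u0 v0 * u + d1_mean v0 u0 * v"
proof -
  have I1: "((\<lambda>\<xi>. \<xi> * (u0 powr (\<xi> - 1) * v0 powr (1 - \<xi>)) * u) has_integral d1_mean u0 v0 * u) {0..1}"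
    using d1_mean_has_integral[OF assms(1,2)] by (rule has_integral_mult_left)
  have "((\<lambda>\<xi>. (1 - \<xi>) * (v0 powr ((1 - \<xi>) - 1) * u0 powr (1 - (1 - \<xi>)))) has_integral d1_mean v0 u0) {0..1}"
    using has_integral_flip01[OF d1_mean_has_integral[OF assms(2,1)]] by simp
  then have I2: "((\<lambda>\<xi>. (1 - \<xi>) * (v0 powr (- \<xi>) * u0 powr \<xi>) * v) has_integral d1_mean v0 u0 * v) {0..1}"
    by (auto dest!: has_integral_mult_left[where c = v])
  show ?thesis
  proof (rule has_integral_le[OF log_mean_has_integral[OF assms(3,4)] has_integral_add[OF I1 I2]])
    fix \<xi> :: real assume \<xi>: "\<xi> \<in> {0..1}"
    have R0: "0 \<le> \<xi> * (u0 powr (\<xi> - 1) * v0 powr (1 - \<xi>)) * u + (1 - \<xi>) * (v0 powr (- \<xi>) * u0 powr \<xi>) * v"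
      using assms \<xi> by (intro add_nonneg_nonneg mult_nonneg_nonneg) auto
    show "u powr \<xi> * v powr (1 - \<xi>) \<le>
      \<xi> * (u0 powr (\<xi> - 1) * v0 powr (1 - \<xi>)) * u + (1 - \<xi>) * (v0 powr (- \<xi>) * u0 powr \<xi>) * v"
    proof (cases "u = 0 \<or> v = 0")
      case True
      then show ?thesis using R0 by auto
    next
      case False
      then have uv: "0 < u" "0 < v" using assms by auto
      have "(u / u0) powr \<xi> * (v / v0) powr (1 - \<xi>) \<le> \<xi> * (u / u0) + (1 - \<xi>) * (v / v0)"
        by (rule Youngs_inequality_0) (use assms uv \<xi> in auto)
      then have "(u0 powr \<xi> * v0 powr (1 - \<xi>)) * ((u / u0) powr \<xi> * (v / v0) powr (1 - \<xi>))
          \<le> (u0 powr \<xi> * v0 powr (1 - \<xi>)) * (\<xi> * (u / u0) + (1 - \<xi>) * (v / v0))"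
        by (rule mult_left_mono) auto
      moreover have "(u0 powr \<xi> * v0 powr (1 - \<xi>)) * ((u / u0) powr \<xi> * (v / v0) powr (1 - \<xi>))
          = u powr \<xi> * v powr (1 - \<xi>)"
        using assms uv by (simp add: powr_divide)
      moreover have "(u0 powr \<xi> * v0 powr (1 - \<xi>)) * (\<xi> * (u / u0) + (1 - \<xi>) * (v / v0))
          = \<xi> * (u0 powr (\<xi> - 1) * v0 powr (1 - \<xi>)) * u + (1 - \<xi>) * (v0 powr (- \<xi>) * u0 powr \<xi>) * v"
        by (rule powr_mean_split[OF assms(1,2)])
      ultimately show ?thesis by simp
    qed
  qed
qed

text \<open>Euler's identity for a homogeneous function of degree one: equality in the tangent-plane inequality.\<close>

lemma log_mean_euler:
  assumes "0 < u" "0 < v"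
  shows "log_mean u v = d1_mean u v * u + d1_mean v u * v"
proof -
  have I1: "((\<lambda>\<xi>. \<xi> * (u powr (\<xi> - 1) * v powr (1 - \<xi>)) * u) has_integral d1_mean u v * u) {0..1}"
    using d1_mean_has_integral[OF assms(1,2)] by (rule has_integral_mult_left)
  have "((\<lambda>\<xi>. (1 - \<xi>) * (v powr ((1 - \<xi>) - 1) * u powr (1 - (1 - \<xi>)))) has_integral d1_mean v u) {0..1}"
    using has_integral_flip01[OF d1_mean_has_integral[OF assms(2,1)]] by simp
  then have I2: "((\<lambda>\<xi>. (1 - \<xi>) * (v powr (- \<xi>) * u powr \<xi>) * v) has_integral d1_mean v u * v) {0..1}"
    by (auto dest!: has_integral_mult_left[where c = v])
  have eq: "\<xi> * (u powr (\<xi> - 1) * v powr (1 - \<xi>)) * u + (1 - \<xi>) * (v powr (- \<xi>) * u powr \<xi>) * v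
     = u powr \<xi> * v powr (1 - \<xi>)" for \<xi>
    using powr_mean_split[OF assms, of \<xi> u v] assms by simp
  show ?thesis
    using has_integral_add[OF I1 I2] log_mean_has_integral[of u v] assms
    unfolding eq by (auto dest: has_integral_unique)
qed

lemma d1_mean_tendsto:
  assumes "(f \<longlongrightarrow> u) F" "(g \<longlongrightarrow> v) F" "0 < u" "0 < v"
  shows "((\<lambda>s. d1_mean (f s) (g s)) \<longlongrightarrow> d1_mean u v) F"
proof -
  have "open ({0::real<..} \<times> {0::real<..})" by (intro open_Times) auto
  then have "isCont (\<lambda>z. d1_mean (fst z) (snd z)) (u, v)"
    using continuous_on_d1_mean assms by (simp add: continuous_on_eq_continuous_at)
  from isCont_tendsto_compose[OF this tendsto_Pair[OF assms(1,2)]]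
  show ?thesis by simp
qed

lemma continuous_on_d1_mean' [continuous_intros]:
  assumes "continuous_on A f" "continuous_on A g" "\<And>s. s \<in> A \<Longrightarrow> 0 < f s" "\<And>s. s \<in> A \<Longrightarrow> 0 < g s"
  shows "continuous_on A (\<lambda>s. d1_mean (f s) (g s))"
  using assms unfolding continuous_on_def by (auto intro!: d1_mean_tendsto)

lemma continuous_on_log_mean' [continuous_intros]:
  assumes "continuous_on A f" "continuous_on A g" "\<And>s. s \<in> A \<Longrightarrow> 0 < f s" "\<And>s. s \<in> A \<Longrightarrow> 0 < g s"
  shows "continuous_on A (\<lambda>s. log_mean (f s) (g s))"
proof -
  have "continuous_on A (\<lambda>s. d1_mean (f s) (g s) * f s + d1_mean (g s) (f s) * g s)"
    using assms by (intro continuous_intros)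
  then show ?thesis
    using assms by (subst continuous_on_cong[OF refl log_mean_euler]) auto
qed

lemma measurable_log_mean [measurable (raw)]:
  assumes [measurable]: "f \<in> borel_measurable M" "g \<in> borel_measurable M"
    and "\<And>s. s \<in> space M \<Longrightarrow> 0 \<le> f s" "\<And>s. s \<in> space M \<Longrightarrow> 0 \<le> g s"
  shows "(\<lambda>s. log_mean (f s) (g s)) \<in> borel_measurable M"
proof -
  have "(\<lambda>s. if f s = 0 \<or> g s = 0 then 0 else if f s = g s then f s else (f s - g s) / (ln (f s) - ln (g s)))
      \<in> borel_measurable M"
    by measurable
  moreover have "log_mean (f s) (g s) =
     (if f s = 0 \<or> g s = 0 then 0 else if f s = g s then f s else (f s - g s) / (ln (f s) - ln (g s)))"
    if "s \<in> space M" for s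
    using assms(3,4)[OF that] by (auto simp: log_mean_self log_mean_pos)
  ultimately show ?thesis by (simp cong: measurable_cong)
qed

text \<open>The tangent planes at the two endpoints bound an increment of \<open>\<theta>\<close> from both sides, and their
  slopes are continuous; this squeezes the difference quotient.\<close>

lemma log_mean_has_real_derivative:
  assumes f: "(f has_real_derivative f') (at t within A)"
    and g: "(g has_real_derivative g') (at t within A)"
    and pos: "0 < f t" "0 < g t"
  shows "((\<lambda>s. log_mean (f s) (g s)) has_real_derivative
           d1_mean (f t) (g t) * f' + d1_mean (g t) (f t) * g') (at t within A)"
proof -
  let ?F = "at t within A"
  have lf: "(f \<longlongrightarrow> f t) ?F" and lg: "(g \<longlongrightarrow> g t) ?F"
    using DERIV_continuous[OF f] DERIV_continuous[OF g] by (auto simp: continuous_within)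
  have ev: "eventually (\<lambda>s. 0 < f s) ?F" "eventually (\<lambda>s. 0 < g s) ?F"
    using order_tendstoD(1)[OF lf pos(1)] order_tendstoD(1)[OF lg pos(2)] by auto
  have qf: "((\<lambda>s. (f s - f t) / (s - t)) \<longlongrightarrow> f') ?F"
    and qg: "((\<lambda>s. (g s - g t) / (s - t)) \<longlongrightarrow> g') ?F"
    using f g by (auto simp: has_field_derivative_iff)
  define q where "q s = (log_mean (f s) (g s) - log_mean (f t) (g t)) / (s - t)" for s
  define A1 where "A1 s = d1_mean (f t) (g t) * ((f s - f t) / (s - t)) + d1_mean (g t) (f t) * ((g s - g t) / (s - t))" for s
  define A2 where "A2 s = d1_mean (f s) (g s) * ((f s - f t) / (s - t)) + d1_mean (g s) (f s) * ((g s - g t) / (s - t))" for s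
  let ?L = "d1_mean (f t) (g t) * f' + d1_mean (g t) (f t) * g'"
  have "(A1 \<longlongrightarrow> ?L) ?F" unfolding A1_def by (intro tendsto_intros qf qg)
  moreover have "(A2 \<longlongrightarrow> ?L) ?F" unfolding A2_def
    by (intro tendsto_intros qf qg d1_mean_tendsto lf lg pos)
  ultimately have lim: "((\<lambda>s. min (A1 s) (A2 s)) \<longlongrightarrow> min ?L ?L) ?F" "((\<lambda>s. max (A1 s) (A2 s)) \<longlongrightarrow> max ?L ?L) ?F"
    by (simp_all only: tendsto_min tendsto_max)
  have sq: "min (A1 s) (A2 s) \<le> q s \<and> q s \<le> max (A1 s) (A2 s)" if s: "0 < f s" "0 < g s" "s \<noteq> t" for s
  proof -
    let ?a = "d1_mean (f t) (g t) * (f s - f t) + d1_mean (g t) (f t) * (g s - g t)"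
    let ?b = "d1_mean (f s) (g s) * (f s - f t) + d1_mean (g s) (f s) * (g s - g t)"
    let ?d = "log_mean (f s) (g s) - log_mean (f t) (g t)"
    have u: "?d \<le> ?a"
      using log_mean_le_tangent[of "f t" "g t" "f s" "g s"] log_mean_euler[of "f t" "g t"] s pos
      by (simp add: algebra_simps)
    have l: "?b \<le> ?d"
      using log_mean_le_tangent[of "f s" "g s" "f t" "g t"] log_mean_euler[of "f s" "g s"] s pos
      by (simp add: algebra_simps)
    have A: "A1 s = ?a / (s - t)" "A2 s = ?b / (s - t)"
      by (simp_all add: A1_def A2_def add_divide_distrib)
    show ?thesis
    proof (cases "s > t")
      case True
      then have "A2 s \<le> q s" "q s \<le> A1 s"
        using u l unfolding A q_def by (auto intro!: divide_right_mono)
      then show ?thesis by auto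
    next
      case False
      then have "A1 s \<le> q s" "q s \<le> A2 s"
        using u l s(3) unfolding A q_def by (auto intro!: divide_right_mono_neg)
      then show ?thesis by auto
    qed
  qed
  have nt: "eventually (\<lambda>s. s \<noteq> t) ?F" by (simp add: eventually_at_filter)
  have "(q \<longlongrightarrow> ?L) ?F"
  proof (rule tendsto_sandwich)
    show "eventually (\<lambda>s. min (A1 s) (A2 s) \<le> q s) ?F" "eventually (\<lambda>s. q s \<le> max (A1 s) (A2 s)) ?F"
      using ev nt by (eventually_elim; use sq in blast)+
    show "((\<lambda>s. min (A1 s) (A2 s)) \<longlongrightarrow> ?L) ?F" "((\<lambda>s. max (A1 s) (A2 s)) \<longlongrightarrow> ?L) ?F"
      using lim by auto
  qed
  then show ?thesis by (simp add: has_field_derivative_iff q_def[abs_def])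
qed

lemma d1_log_mean_eq: "0 < u \<Longrightarrow> 0 < v \<Longrightarrow> d1_log_mean u v = d1_mean u v"
  unfolding d1_log_mean_def
  using log_mean_has_real_derivative[of "\<lambda>w. w" 1 u UNIV "\<lambda>_. v" 0]
  by (auto intro: DERIV_imp_deriv)

section \<open>Absolutely continuous functions\<close>

definition short_family :: "real \<Rightarrow> real \<Rightarrow> real \<Rightarrow> (real \<times> real) set \<Rightarrow> bool" where
  "short_family c d \<delta> I \<longleftrightarrow> finite I \<and> (\<forall>(s, t)\<in>I. c \<le> s \<and> s < t \<and> t \<le> d) \<and>
     pairwise (\<lambda>(s, t) (s', t'). {s<..<t} \<inter> {s'<..<t'} = {}) I \<and> (\<Sum>(s, t)\<in>I. t - s) < \<delta>"

lemma abs_continuous_on_interval_iff: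
  "abs_continuous_on_interval c d f \<longleftrightarrow>
     (\<forall>\<epsilon>>0. \<exists>\<delta>>0. \<forall>I. short_family c d \<delta> I \<longrightarrow> (\<Sum>(s, t)\<in>I. \<bar>f t - f s\<bar>) < \<epsilon>)"
  unfolding abs_continuous_on_interval_def short_family_def ..

lemma short_familyD:
  assumes "short_family c d \<delta> I"
  shows "finite I" "(\<Sum>(s, t)\<in>I. t - s) < \<delta>"
    and "(s, t) \<in> I \<Longrightarrow> s \<in> {c..d}" "(s, t) \<in> I \<Longrightarrow> t \<in> {c..d}" "(s, t) \<in> I \<Longrightarrow> s < t"
proof -
  have *: "\<forall>(s, t)\<in>I. c \<le> s \<and> s < t \<and> t \<le> d" "finite I" "(\<Sum>(s, t)\<in>I. t - s) < \<delta>"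
    using assms unfolding short_family_def by simp_all
  then show "finite I" "(\<Sum>(s, t)\<in>I. t - s) < \<delta>"
    and "(s, t) \<in> I \<Longrightarrow> s \<in> {c..d}" "(s, t) \<in> I \<Longrightarrow> t \<in> {c..d}" "(s, t) \<in> I \<Longrightarrow> s < t"
    by auto
qed

lemma short_family_mono: "short_family c d \<delta> I \<Longrightarrow> \<delta> \<le> \<delta>' \<Longrightarrow> short_family c d \<delta>' I"
  unfolding short_family_def by auto

lemma abs_continuous_on_interval_lipschitz:
  assumes "\<And>s t. s \<in> {c..d} \<Longrightarrow> t \<in> {c..d} \<Longrightarrow> \<bar>f t - f s\<bar> \<le> L * \<bar>t - s\<bar>"
  shows "abs_continuous_on_interval c d f"
  unfolding abs_continuous_on_interval_iff
proof (intro allI impI)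
  fix \<epsilon> :: real assume "0 < \<epsilon>"
  show "\<exists>\<delta>>0. \<forall>I. short_family c d \<delta> I \<longrightarrow> (\<Sum>(s, t)\<in>I. \<bar>f t - f s\<bar>) < \<epsilon>"
  proof (intro exI conjI allI impI)
    show "0 < \<epsilon> / (\<bar>L\<bar> + 1)" using \<open>0 < \<epsilon>\<close> by auto
    fix I :: "(real \<times> real) set"
    assume I: "short_family c d (\<epsilon> / (\<bar>L\<bar> + 1)) I"
    have "(\<Sum>(s, t)\<in>I. \<bar>f t - f s\<bar>) \<le> (\<Sum>(s, t)\<in>I. (\<bar>L\<bar> + 1) * (t - s))"
    proof (rule sum_mono, clarify)
      fix s t assume "(s, t) \<in> I"
      then have st: "s \<in> {c..d}" "t \<in> {c..d}" "s < t" using short_familyD[OF I] by auto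
      have "\<bar>f t - f s\<bar> \<le> L * \<bar>t - s\<bar>" using assms st by blast
      also have "\<dots> \<le> (\<bar>L\<bar> + 1) * \<bar>t - s\<bar>" by (rule mult_right_mono) auto
      finally show "\<bar>f t - f s\<bar> \<le> (\<bar>L\<bar> + 1) * (t - s)" using st by simp
    qed
    also have "\<dots> = (\<bar>L\<bar> + 1) * (\<Sum>(s, t)\<in>I. t - s)"
      by (simp add: sum_distrib_left case_prod_beta)
    also have "\<dots> < \<epsilon>" using short_familyD(2)[OF I] by (simp add: field_simps)
    finally show "(\<Sum>(s, t)\<in>I. \<bar>f t - f s\<bar>) < \<epsilon>" .
  qed
qed

text \<open>One estimate that covers sums and products of absolutely continuous functions.\<close>

lemma abs_continuous_on_interval_combine:
  assumes f: "abs_continuous_on_interval c d f" and g: "abs_continuous_on_interval c d g"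
    and h: "\<And>s t. s \<in> {c..d} \<Longrightarrow> t \<in> {c..d} \<Longrightarrow> \<bar>h t - h s\<bar> \<le> B * (\<bar>f t - f s\<bar> + \<bar>g t - g s\<bar>)"
  shows "abs_continuous_on_interval c d h"
  unfolding abs_continuous_on_interval_iff
proof (intro allI impI)
  fix \<epsilon> :: real assume e: "0 < \<epsilon>"
  define e' where "e' = \<epsilon> / (2 * (\<bar>B\<bar> + 1))"
  have "0 < e'" using e by (auto simp: e'_def)
  then obtain d1 d2 where d: "0 < d1" "0 < d2"
    and 1: "\<And>I. short_family c d d1 I \<Longrightarrow> (\<Sum>(s, t)\<in>I. \<bar>f t - f s\<bar>) < e'"
    and 2: "\<And>I. short_family c d d2 I \<Longrightarrow> (\<Sum>(s, t)\<in>I. \<bar>g t - g s\<bar>) < e'"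
    using f g unfolding abs_continuous_on_interval_iff by metis
  show "\<exists>\<delta>>0. \<forall>I. short_family c d \<delta> I \<longrightarrow> (\<Sum>(s, t)\<in>I. \<bar>h t - h s\<bar>) < \<epsilon>"
  proof (intro exI conjI allI impI)
    show "0 < min d1 d2" using d by simp
    fix I assume I: "short_family c d (min d1 d2) I"
    then have s12: "(\<Sum>(s, t)\<in>I. \<bar>f t - f s\<bar>) < e'" "(\<Sum>(s, t)\<in>I. \<bar>g t - g s\<bar>) < e'"
      by (auto intro!: 1 2 intro: short_family_mono)
    have "(\<Sum>(s, t)\<in>I. \<bar>h t - h s\<bar>) \<le> (\<Sum>(s, t)\<in>I. (\<bar>B\<bar> + 1) * (\<bar>f t - f s\<bar> + \<bar>g t - g s\<bar>))"
    proof (rule sum_mono, clarify)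
      fix s t assume "(s, t) \<in> I"
      then have "s \<in> {c..d}" "t \<in> {c..d}" "s < t" using short_familyD[OF I] by auto
      then have "\<bar>h t - h s\<bar> \<le> B * (\<bar>f t - f s\<bar> + \<bar>g t - g s\<bar>)" using h by blast
      also have "\<dots> \<le> (\<bar>B\<bar> + 1) * (\<bar>f t - f s\<bar> + \<bar>g t - g s\<bar>)" by (rule mult_right_mono) auto
      finally show "\<bar>h t - h s\<bar> \<le> (\<bar>B\<bar> + 1) * (\<bar>f t - f s\<bar> + \<bar>g t - g s\<bar>)" .
    qed
    also have "\<dots> = (\<bar>B\<bar> + 1) * ((\<Sum>(s, t)\<in>I. \<bar>f t - f s\<bar>) + (\<Sum>(s, t)\<in>I. \<bar>g t - g s\<bar>))"
      by (simp add: sum_distrib_left case_prod_beta sum.distrib distrib_left)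
    also have "\<dots> < (\<bar>B\<bar> + 1) * (e' + e')"
      using s12 by (intro mult_strict_left_mono add_strict_mono) auto
    also have "\<dots> = \<epsilon>"
    proof -
      have "\<bar>B\<bar> + 1 \<noteq> 0" by linarith
      then have "2 * ((\<bar>B\<bar> + 1) * e') = \<epsilon>" unfolding e'_def by (simp del: distrib_left_numeral)
      then show ?thesis by (simp add: algebra_simps)
    qed
    finally show "(\<Sum>(s, t)\<in>I. \<bar>h t - h s\<bar>) < \<epsilon>" .
  qed
qed

lemma abs_continuous_on_interval_imp_continuous_on:
  assumes "abs_continuous_on_interval c d f"
  shows "continuous_on {c..d} f"
  unfolding continuous_on_iff dist_real_def
proof (intro ballI allI impI)
  fix x \<epsilon> :: real assume x: "x \<in> {c..d}" and "0 < \<epsilon>"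
  then obtain \<delta> where \<delta>: "0 < \<delta>" and
    *: "\<And>I. short_family c d \<delta> I \<Longrightarrow> (\<Sum>(s, t)\<in>I. \<bar>f t - f s\<bar>) < \<epsilon>"
    using assms unfolding abs_continuous_on_interval_iff by metis
  have "\<bar>f y - f x\<bar> < \<epsilon>" if y: "y \<in> {c..d}" "\<bar>y - x\<bar> < \<delta>" for y
  proof (cases x y rule: linorder_cases)
    case less
    then show ?thesis
      using *[of "{(x, y)}"] x y by (auto simp: short_family_def pairwise_def)
  next
    case greater
    then show ?thesis
      using *[of "{(y, x)}"] x y by (auto simp: short_family_def pairwise_def abs_minus_commute)
  qed (use \<open>0 < \<epsilon>\<close> in auto)
  then show "\<exists>d'>0. \<forall>x'\<in>{c..d}. \<bar>x' - x\<bar> < d' \<longrightarrow> \<bar>f x' - f x\<bar> < \<epsilon>"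
    using \<delta> by blast
qed

lemma continuous_on_Icc_bounded:
  fixes f :: "real \<Rightarrow> real"
  assumes "continuous_on {c..d} f"
  obtains B where "0 \<le> B" "\<And>t. t \<in> {c..d} \<Longrightarrow> \<bar>f t\<bar> \<le> B"
proof -
  have "bounded (f ` {c..d})"
    using assms by (intro compact_imp_bounded compact_continuous_image) auto
  then obtain B where B: "\<forall>t\<in>{c..d}. \<bar>f t\<bar> \<le> B" unfolding bounded_iff by auto
  show thesis
  proof (rule that)
    show "0 \<le> max 0 B" by simp
    show "\<bar>f t\<bar> \<le> max 0 B" if "t \<in> {c..d}" for t using B that by (simp add: max.coboundedI2)
  qed
qed

lemma abs_continuous_on_interval_add:
  assumes "abs_continuous_on_interval c d f" "abs_continuous_on_interval c d g"
  shows "abs_continuous_on_interval c d (\<lambda>t. f t + g t)"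
  by (rule abs_continuous_on_interval_combine[OF assms, where B = 1]) auto

lemma abs_continuous_on_interval_sum:
  assumes "\<And>x. x \<in> A \<Longrightarrow> abs_continuous_on_interval c d (\<lambda>t. f t x)"
  shows "abs_continuous_on_interval c d (\<lambda>t. \<Sum>x\<in>A. f t x)"
  using assms
proof (induction A rule: infinite_finite_induct)
  case (insert x F)
  then show ?case by (auto intro!: abs_continuous_on_interval_add)
qed (auto intro: abs_continuous_on_interval_lipschitz[where L = 0])

lemma abs_continuous_on_interval_mult:
  assumes f: "abs_continuous_on_interval c d f" and g: "abs_continuous_on_interval c d g"
  shows "abs_continuous_on_interval c d (\<lambda>t. f t * g t)"
proof -
  obtain B1 B2 where B: "\<And>t. t \<in> {c..d} \<Longrightarrow> \<bar>f t\<bar> \<le> B1" "\<And>t. t \<in> {c..d} \<Longrightarrow> \<bar>g t\<bar> \<le> B2"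
    using f g by (metis abs_continuous_on_interval_imp_continuous_on continuous_on_Icc_bounded)
  show ?thesis
  proof (rule abs_continuous_on_interval_combine[OF f g, where B = "max B1 B2"])
    fix s t assume st: "s \<in> {c..d}" "t \<in> {c..d}"
    have "\<bar>f t * g t - f s * g s\<bar> = \<bar>(f t - f s) * g t + f s * (g t - g s)\<bar>" by (simp add: algebra_simps)
    also have "\<dots> \<le> \<bar>f t - f s\<bar> * \<bar>g t\<bar> + \<bar>f s\<bar> * \<bar>g t - g s\<bar>"
      by (metis abs_mult abs_triangle_ineq)
    also have "\<dots> \<le> \<bar>f t - f s\<bar> * max B1 B2 + max B1 B2 * \<bar>g t - g s\<bar>"
      using B[OF st(1)] B[OF st(2)] by (intro add_mono mult_mono) auto
    finally show "\<bar>f t * g t - f s * g s\<bar> \<le> max B1 B2 * (\<bar>f t - f s\<bar> + \<bar>g t - g s\<bar>)"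
      by (simp add: algebra_simps)
  qed
qed

lemma abs_continuous_on_interval_subinterval:
  assumes "abs_continuous_on_interval c d f" "c \<le> l" "r \<le> d"
  shows "abs_continuous_on_interval l r f"
proof -
  have "short_family c d \<delta> I" if "short_family l r \<delta> I" for \<delta> I
    using that assms(2,3) unfolding short_family_def by fastforce
  then show ?thesis
    using assms(1) unfolding abs_continuous_on_interval_iff by meson
qed

lemma lipschitz_of_bounded_derivative:
  fixes f :: "real \<Rightarrow> real"
  assumes "\<And>t. t \<in> {c..d} \<Longrightarrow> (f has_real_derivative f' t) (at t within {c..d})"
    and "\<And>t. t \<in> {c..d} \<Longrightarrow> \<bar>f' t\<bar> \<le> B"
    and "s \<in> {c..d}" "t \<in> {c..d}"
  shows "\<bar>f t - f s\<bar> \<le> B * \<bar>t - s\<bar>"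
  using field_differentiable_bound[of "{c..d}" f f' B s t] assms by (simp add: norm_minus_commute abs_minus_commute)

lemma abs_continuous_on_interval_C1:
  fixes f :: "real \<Rightarrow> real"
  assumes "\<And>t. t \<in> {c..d} \<Longrightarrow> (f has_real_derivative f' t) (at t within {c..d})"
    and "continuous_on {c..d} f'"
  shows "abs_continuous_on_interval c d f"
proof -
  obtain B where "\<And>t. t \<in> {c..d} \<Longrightarrow> \<bar>f' t\<bar> \<le> B"
    using assms(2) by (metis continuous_on_Icc_bounded)
  then show ?thesis
    by (intro abs_continuous_on_interval_lipschitz[where L = B] lipschitz_of_bounded_derivative[of c d f f']) (use assms in auto)
qed

text \<open>The fundamental theorem of calculus for absolutely continuous functions. The gauge integral delivers
  integrability of the derivative along with its value. Tags outside the exceptional null set are handled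
  by the derivative as usual. Tags inside it are forced into an open set of small measure, over which
  absolute continuity makes the increments of \<open>f\<close> small.\<close>

lemma abs_continuous_has_integral:
  fixes f g :: "real \<Rightarrow> real"
  assumes cd: "c \<le> d" and ac: "abs_continuous_on_interval c d f" and neg: "negligible N"
    and der: "\<And>t. t \<in> {c..d} - N \<Longrightarrow> (f has_real_derivative g t) (at t within {c..d})"
  shows "(g has_integral f d - f c) {c..d}"
proof (cases "c = d")
  case True
  then show ?thesis by (simp add: has_integral_refl)
next
  case False
  with cd have "c < d" by simp
  define g0 where "g0 t = (if t \<in> N then 0 else g t)" for t
  have "(g0 has_integral f d - f c) (cbox c d)"
    unfolding has_integral_factor_content
  proof (intro allI impI)
    fix e :: real assume e: "0 < e"
    have "0 < e / 2 * (d - c)" using e \<open>c < d\<close> by auto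
    then obtain \<delta> where \<delta>: "0 < \<delta>"
      and ac\<delta>: "\<And>I. short_family c d \<delta> I \<Longrightarrow> (\<Sum>(s, t)\<in>I. \<bar>f t - f s\<bar>) < e / 2 * (d - c)"
      using ac[unfolded abs_continuous_on_interval_iff, rule_format, of "e / 2 * (d - c)"] by auto
    have Nn: "N \<in> null_sets lebesgue" using neg by (simp add: negligible_iff_null_sets)
    obtain U where U: "open U" "N \<subseteq> U" "emeasure lebesgue (U - N) < ennreal \<delta>"
      by (rule sets_lebesgue_outer_open[OF null_setsD2[OF Nn] \<delta>])
    have "U - N \<in> sets lebesgue"
      using U(1) Nn by (intro sets.Diff) auto
    from emeasure_Un_null_set[OF this Nn] have emU: "emeasure lebesgue U < ennreal \<delta>"
      using U by (simp add: Un_absorb2)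
    have "\<exists>D>0. \<forall>y\<in>{c..d}. \<bar>y - t\<bar> < D \<longrightarrow> \<bar>f y - f t - (y - t) * g t\<bar> \<le> e / 2 * \<bar>y - t\<bar>"
      if "t \<in> {c..d} - N" for t
    proof -
      have "(f has_derivative (\<lambda>x. g t * x)) (at t within {c..d})"
        using der[OF that] by (simp add: has_field_derivative_def)
      then show ?thesis
        using e unfolding has_derivative_within_alt by (auto simp: mult.commute elim!: allE[of _ "e/2"])
    qed
    moreover have "\<exists>D>0. ball t D \<subseteq> U" if "t \<in> N" for t
      using U that by (meson open_contains_ball subsetD)
    ultimately have "\<exists>D>0. (t \<in> N \<longrightarrow> ball t D \<subseteq> U) \<and>
        (t \<in> {c..d} - N \<longrightarrow> (\<forall>y\<in>{c..d}. \<bar>y - t\<bar> < D \<longrightarrow> \<bar>f y - f t - (y - t) * g t\<bar> \<le> e / 2 * \<bar>y - t\<bar>))" for t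
      by (cases "t \<in> N"; cases "t \<in> {c..d}") (auto intro: exI[of _ 1])
    then obtain D where D: "\<And>t. 0 < D t" "\<And>t. t \<in> N \<Longrightarrow> ball t (D t) \<subseteq> U"
      "\<And>t y. t \<in> {c..d} - N \<Longrightarrow> y \<in> {c..d} \<Longrightarrow> \<bar>y - t\<bar> < D t \<Longrightarrow> \<bar>f y - f t - (y - t) * g t\<bar> \<le> e / 2 * \<bar>y - t\<bar>"
      by metis
    show "\<exists>\<gamma>. gauge \<gamma> \<and> (\<forall>p. p tagged_division_of cbox c d \<and> \<gamma> fine p \<longrightarrow>
        norm ((\<Sum>(x, k)\<in>p. measure lborel k *\<^sub>R g0 x) - (f d - f c)) \<le> e * measure lborel (cbox c d))"
    proof (intro exI[of _ "\<lambda>t. ball t (D t)"] conjI allI impI)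
      show "gauge (\<lambda>t. ball t (D t))" using D(1) gauge_ball_dependent by blast
      fix p assume "p tagged_division_of cbox c d \<and> (\<lambda>t. ball t (D t)) fine p"
      then have p: "p tagged_division_of {c..d}" and fine: "(\<lambda>t. ball t (D t)) fine p" by auto
      have fp: "finite p" using p by blast
      have K: "\<exists>u v. K = {u..v} \<and> u \<le> v \<and> x \<in> {u..v} \<and> c \<le> u \<and> v \<le> d \<and> {u..v} \<subseteq> ball x (D x)"
        if xK: "(x, K) \<in> p" for x K
      proof -
        obtain u v where K: "K = cbox u v" using p xK by blast
        moreover have "x \<in> K" "K \<subseteq> {c..d}" using p xK by blast+
        moreover have "K \<subseteq> ball x (D x)" using fine xK by blast
        ultimately show ?thesis by (intro exI[of _ u] exI[of _ v]) auto
      qed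
      have len: "d - c = (\<Sum>(x, K)\<in>p. Sup K - Inf K)"
        using additive_tagged_division_1[OF cd p, of "\<lambda>x. x"] by simp
      have fdc: "f d - f c = (\<Sum>(x, K)\<in>p. f (Sup K) - f (Inf K))"
        using additive_tagged_division_1[OF cd p, of f] by simp
      \<comment> \<open>The pieces tagged in the null set; degenerate ones contribute nothing and would spoil injectivity of \<open>J\<close>.\<close>
      define q where "q = {(x, K). (x, K) \<in> p \<and> x \<in> N \<and> Inf K < Sup K}"
      have qp: "q \<subseteq> p" by (auto simp: q_def)
      define J where "J = (\<lambda>(x :: real, K). (Inf K :: real, Sup K :: real))"
      have pdisj: "interior K1 \<inter> interior K2 = {}" if "(x1, K1) \<in> p" "(x2, K2) \<in> p" "(x1, K1) \<noteq> (x2, K2)" for x1 x2 K1 K2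
        using p that by blast
      have intK: "interior K = {Inf K<..<Sup K}" if "(x, K) \<in> p" for x K
        using K[OF that] by auto
      have injJ: "inj_on J q"
      proof (rule inj_onI, clarify)
        fix x1 K1 x2 K2 assume a: "(x1, K1) \<in> q" "(x2, K2) \<in> q" "J (x1, K1) = J (x2, K2)"
        then have "interior K1 = interior K2" "interior K1 \<noteq> {}"
          using intK by (auto simp: q_def J_def)
        then show "x1 = x2 \<and> K1 = K2"
          using pdisj[of x1 K1 x2 K2] a by (auto simp: q_def)
      qed
      have disjJ: "{s<..<t} \<inter> {s'<..<t'} = {}" if "(s, t) \<in> J ` q" "(s', t') \<in> J ` q" "(s, t) \<noteq> (s', t')" for s t s' t'
      proof -
        obtain x1 K1 x2 K2 where k: "(x1, K1) \<in> q" "(x2, K2) \<in> q" "(s, t) = (Inf K1, Sup K1)" "(s', t') = (Inf K2, Sup K2)"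
          using \<open>(s, t) \<in> J ` q\<close> \<open>(s', t') \<in> J ` q\<close> by (auto simp: J_def)
        then have "(x1, K1) \<noteq> (x2, K2)" using that by auto
        then show ?thesis using pdisj[of x1 K1 x2 K2] k intK[of x1 K1] intK[of x2 K2] by (auto simp: q_def)
      qed
      have "short_family c d \<delta> (J ` q)"
        unfolding short_family_def
      proof (intro conjI)
        show fJ: "finite (J ` q)" using fp qp finite_subset by blast
        show ord: "\<forall>(s, t)\<in>J ` q. c \<le> s \<and> s < t \<and> t \<le> d"
          using K by (fastforce simp: J_def q_def)
        show "pairwise (\<lambda>(s, t) (s', t'). {s<..<t} \<inter> {s'<..<t'} = {}) (J ` q)"
          unfolding pairwise_def using disjJ by blast
        have sub: "(\<Union>(s, t)\<in>J ` q. {s<..<t}) \<subseteq> U"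
        proof
          fix z assume "z \<in> (\<Union>(s, t)\<in>J ` q. {s<..<t})"
          then obtain x k where xk: "(x, k) \<in> q" and z: "z \<in> {Inf k<..<Sup k}" by (auto simp: J_def)
          then have "(x, k) \<in> p" "x \<in> N" by (auto simp: q_def)
          then have "ball x (D x) \<subseteq> U" using D(2) by blast
          moreover obtain u v where "k = {u..v}" "u \<le> v" "{u..v} \<subseteq> ball x (D x)"
            using K[OF \<open>(x, k) \<in> p\<close>] by blast
          moreover then have "z \<in> {u..v}" using z by auto
          ultimately show "z \<in> U" by blast
        qed
        have "(\<Sum>(s, t)\<in>J ` q. t - s) = (\<Sum>i\<in>J ` q. measure lebesgue {fst i<..<snd i})"
          using ord by (intro sum.cong) auto
        also have "\<dots> = measure lebesgue (\<Union>i\<in>J ` q. {fst i<..<snd i})"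
        proof (rule measure_finite_Union[symmetric, OF fJ])
          show "disjoint_family_on (\<lambda>i. {fst i<..<snd i}) (J ` q)"
            using disjJ unfolding disjoint_family_on_def by (metis prod.collapse)
          show "emeasure lebesgue {fst i<..<snd i} \<noteq> \<infinity>" if "i \<in> J ` q" for i
            using ord that by auto
        qed auto
        also have "ennreal (measure lebesgue (\<Union>i\<in>J ` q. {fst i<..<snd i})) \<le> emeasure lebesgue U"
        proof -
          have "ennreal (measure lebesgue (\<Union>i\<in>J ` q. {fst i<..<snd i})) \<le> emeasure lebesgue (\<Union>i\<in>J ` q. {fst i<..<snd i})"
            by (simp add: measure_def ennreal_enn2real_if)
          also have "\<dots> \<le> emeasure lebesgue U"
            using sub U(1) by (intro emeasure_mono) (auto simp: case_prod_beta)
          finally show ?thesis .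
        qed
        finally have "ennreal (\<Sum>(s, t)\<in>J ` q. t - s) \<le> emeasure lebesgue U" .
        then have "ennreal (\<Sum>(s, t)\<in>J ` q. t - s) < ennreal \<delta>" using emU by (rule le_less_trans)
        then show "(\<Sum>(s, t)\<in>J ` q. t - s) < \<delta>" using \<delta>
          by (metis ennreal_leI linorder_not_le)
      qed
      from ac\<delta>[OF this] have sN: "(\<Sum>(x, K)\<in>q. \<bar>f (Sup K) - f (Inf K)\<bar>) < e / 2 * (d - c)"
        by (subst (asm) sum.reindex[OF injJ]) (simp add: J_def case_prod_beta)
      have "\<bar>(\<Sum>(x, K)\<in>p. measure lborel K *\<^sub>R g0 x) - (f d - f c)\<bar>
          = \<bar>\<Sum>z\<in>p. (case z of (x, K) \<Rightarrow> measure lborel K * g0 x - (f (Sup K) - f (Inf K)))\<bar>"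
        unfolding fdc by (simp add: case_prod_beta sum_subtractf)
      also have "\<dots> \<le> (\<Sum>z\<in>p. (case z of (x, K) \<Rightarrow> e / 2 * (Sup K - Inf K)) + (if z \<in> q then (case z of (x, K) \<Rightarrow> \<bar>f (Sup K) - f (Inf K)\<bar>) else 0))"
      proof (rule order_trans[OF sum_abs sum_mono], clarify)
        fix x k assume xk: "(x, k) \<in> p"
        obtain u v where uv: "k = {u..v}" "u \<le> v" "x \<in> {u..v}" "c \<le> u" "v \<le> d" "{u..v} \<subseteq> ball x (D x)"
          using K[OF xk] by blast
        have SI: "Sup k = v" "Inf k = u" "measure lborel k = v - u" using uv by auto
        show "\<bar>measure lborel k * g0 x - (f (Sup k) - f (Inf k))\<bar> \<le> e / 2 * (Sup k - Inf k) + (if (x, k) \<in> q then \<bar>f (Sup k) - f (Inf k)\<bar> else 0)"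
        proof (cases "x \<in> N")
          case True
          then have "(x, k) \<in> q \<longleftrightarrow> u < v" using xk SI by (auto simp: q_def)
          moreover have "0 \<le> e / 2 * (v - u)" using e uv by simp
          ultimately show ?thesis using True uv(2) unfolding SI
            by (cases "u = v") (auto simp: g0_def)
        next
          case False
          then have "(x, k) \<notin> q" by (simp add: q_def)
          have x: "x \<in> {c..d} - N" using False uv by auto
          have "u \<in> {u..v}" "v \<in> {u..v}" using uv by auto
          then have "\<bar>u - x\<bar> < D x" "\<bar>v - x\<bar> < D x" using uv(6) by (force simp: dist_real_def)+
          then have "\<bar>f u - f x - (u - x) * g x\<bar> \<le> e / 2 * \<bar>u - x\<bar>" "\<bar>f v - f x - (v - x) * g x\<bar> \<le> e / 2 * \<bar>v - x\<bar>"
            using D(3)[OF x, of u] D(3)[OF x, of v] uv by auto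
          moreover have "e / 2 * \<bar>u - x\<bar> + e / 2 * \<bar>v - x\<bar> = e / 2 * (v - u)"
          proof -
            have "\<bar>u - x\<bar> + \<bar>v - x\<bar> = v - u" using uv by simp
            then show ?thesis by (metis distrib_left)
          qed
          moreover have "(v - u) * g x - (f v - f u) = (f u - f x - (u - x) * g x) - (f v - f x - (v - x) * g x)"
            by (simp add: algebra_simps)
          ultimately have "\<bar>(v - u) * g x - (f v - f u)\<bar> \<le> e / 2 * (v - u)" by linarith
          then show ?thesis using \<open>(x, k) \<notin> q\<close> False unfolding SI g0_def by (simp only: if_False add_0_right)
        qed
      qed
      also have "\<dots> = e / 2 * (d - c) + (\<Sum>(x, K)\<in>q. \<bar>f (Sup K) - f (Inf K)\<bar>)"
      proof -
        have "(\<Sum>z\<in>p. if z \<in> q then (case z of (x, K) \<Rightarrow> \<bar>f (Sup K) - f (Inf K)\<bar>) else 0)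
            = (\<Sum>(x, K)\<in>q. \<bar>f (Sup K) - f (Inf K)\<bar>)"
          using sum.inter_restrict[OF fp, of "\<lambda>(x, K). \<bar>f (Sup K) - f (Inf K)\<bar>" q] qp
          by (simp add: Int_absorb1)
        then show ?thesis
          unfolding len by (simp add: sum.distrib sum_distrib_left case_prod_beta)
      qed
      also have "\<dots> \<le> e * (d - c)" using sN by (simp add: field_simps)
      finally show "norm ((\<Sum>(x, K)\<in>p. measure lborel K *\<^sub>R g0 x) - (f d - f c)) \<le> e * measure lborel (cbox c d)"
        using cd by simp
    qed
  qed
  then have "(g0 has_integral f d - f c) {c..d}" by simp
  then show ?thesis
    by (rule has_integral_spike[OF neg, rotated]) (auto simp: g0_def)
qed

section \<open>The lemma of du Bois-Reymond\<close>

lemma absolutely_integrable_mult_continuous: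
  fixes v z :: "real \<Rightarrow> real"
  assumes "v absolutely_integrable_on {c..d}" "continuous_on {c..d} z"
  shows "(\<lambda>t. v t * z t) absolutely_integrable_on {c..d}"
proof -
  have "(\<lambda>t. z t * v t) absolutely_integrable_on {c..d}"
  proof (rule absolutely_integrable_bounded_measurable_product_real[OF _ _ _ assms(1)])
    show "z \<in> borel_measurable (lebesgue_on {c..d})"
      using assms(2) by (rule continuous_imp_measurable_on_sets_lebesgue) auto
    show "bounded (z ` {c..d})"
      using assms(2) by (intro compact_imp_bounded compact_continuous_image) auto
  qed auto
  then show ?thesis by (simp add: mult.commute)
qed

text \<open>Integration by parts when one of the primitives is merely absolutely continuous. The defect
  \<open>V z - \<integral>(v z + V w)\<close> changes over a short interval by at most \<open>e\<close> times the integral of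
  \<open>|v| + |w|\<close>; Bolzano's bisection principle adds these estimates up, and \<open>e\<close> is arbitrary.\<close>

lemma integral_by_parts_primitives:
  fixes v w :: "real \<Rightarrow> real"
  assumes cd: "c \<le> d" and v: "v absolutely_integrable_on {c..d}" and w: "continuous_on {c..d} w"
  defines "V \<equiv> \<lambda>t. integral {c..t} v" and "z \<equiv> \<lambda>t. integral {c..t} w"
  shows "integral {c..d} (\<lambda>t. v t * z t) = V d * z d - integral {c..d} (\<lambda>t. V t * w t)"
proof -
  have vi: "v integrable_on {c..d}" and wi: "w integrable_on {c..d}"
    using v w by (auto intro: integrable_continuous_real set_lebesgue_integral_eq_integral(1))
  have cV: "continuous_on {c..d} V" and cz: "continuous_on {c..d} z"
    unfolding V_def z_def using vi wi by (auto intro: indefinite_integral_continuous_1)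
  have vz: "(\<lambda>t. v t * z t) integrable_on {c..d}"
    using absolutely_integrable_mult_continuous[OF v cz] by (rule set_lebesgue_integral_eq_integral(1))
  have Vw: "(\<lambda>t. V t * w t) integrable_on {c..d}"
    by (intro integrable_continuous_real continuous_intros cV w)
  define k where "k t = v t * z t + V t * w t" for t
  have ki: "k integrable_on {c..d}" unfolding k_def by (intro integrable_add vz Vw)
  define m where "m t = \<bar>v t\<bar> + \<bar>w t\<bar>" for t
  have mi: "m integrable_on {c..d}"
  proof -
    have "(\<lambda>t. \<bar>v t\<bar>) integrable_on {c..d}" using v by (simp add: absolutely_integrable_on_def)
    moreover have "(\<lambda>t. \<bar>w t\<bar>) integrable_on {c..d}"
      by (intro integrable_continuous_real continuous_intros w)
    ultimately show ?thesis unfolding m_def by (rule integrable_add)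
  qed
  define G where "G t = V t * z t - integral {c..t} k" for t
  define M where "M t = integral {c..t} m" for t
  have split: "integral {c..t} f - integral {c..s} f = integral {s..t} f"
    if "f integrable_on {c..d}" "c \<le> s" "s \<le> t" "t \<le> d" for f :: "real \<Rightarrow> real" and s t
  proof -
    have f: "f integrable_on {c..t}" using that by (auto intro: integrable_subinterval_real)
    show ?thesis using Henstock_Kurzweil_Integration.integral_combine[OF that(2,3) f] by simp
  qed
  have main: "\<bar>G d - G c\<bar> \<le> e * (M d - M c)" if e: "0 < e" for e
  proof -
    have "uniformly_continuous_on {c..d} V" "uniformly_continuous_on {c..d} z"
      using cV cz by (auto intro: compact_uniformly_continuous)
    then obtain d1 d2 where d12: "0 < d1" "0 < d2"
      "\<And>s t. s \<in> {c..d} \<Longrightarrow> t \<in> {c..d} \<Longrightarrow> \<bar>t - s\<bar> < d1 \<Longrightarrow> \<bar>V t - V s\<bar> < e"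
      "\<And>s t. s \<in> {c..d} \<Longrightarrow> t \<in> {c..d} \<Longrightarrow> \<bar>t - s\<bar> < d2 \<Longrightarrow> \<bar>z t - z s\<bar> < e"
      using e unfolding uniformly_continuous_on_def dist_real_def by metis
    define P where "P s t \<longleftrightarrow> (c \<le> s \<and> s \<le> t \<and> t \<le> d \<longrightarrow> \<bar>G t - G s\<bar> \<le> e * (M t - M s))" for s t
    have "P c d"
    proof (induction rule: Bolzano[OF cd, case_names tr loc])
      case (tr r s t)
      then have "c \<le> r \<and> t \<le> d \<Longrightarrow> \<bar>G s - G r\<bar> \<le> e * (M s - M r) \<and> \<bar>G t - G s\<bar> \<le> e * (M t - M s)"
        unfolding P_def by auto
      moreover have "e * (M t - M r) = e * (M s - M r) + e * (M t - M s)" by (simp add: algebra_simps)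
      ultimately show ?case unfolding P_def by auto
    next
      case (loc x)
      have "P s t" if st: "s \<le> x \<and> x \<le> t \<and> t - s < min d1 d2" for s t
        unfolding P_def
      proof
        assume *: "c \<le> s \<and> s \<le> t \<and> t \<le> d"
        have sub: "f integrable_on {s..t}" if "f integrable_on {c..d}" for f :: "real \<Rightarrow> real"
          using that * by (auto intro: integrable_subinterval_real)
        have "G t - G s = (V t - V s) * z t + V s * (z t - z s) - (integral {c..t} k - integral {c..s} k)"
          by (simp add: G_def algebra_simps)
        also have "\<dots> = integral {s..t} v * z t + V s * integral {s..t} w - integral {s..t} k"
          using split[of v s t] split[of w s t] split[of k s t] vi wi ki * by (simp add: V_def z_def)
        also have "\<dots> = integral {s..t} (\<lambda>r. v r * z t + V s * w r - k r)"
          using sub[OF vi] sub[OF wi] sub[OF ki]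
          by (simp add: integral_diff integral_add integrable_add integrable_on_mult_left integrable_on_mult_right)
        finally have "G t - G s = integral {s..t} (\<lambda>r. v r * z t + V s * w r - k r)" .
        also have "norm \<dots> \<le> integral {s..t} (\<lambda>r. e * m r)"
        proof (rule integral_norm_bound_integral)
          show "(\<lambda>r. v r * z t + V s * w r - k r) integrable_on {s..t}"
            using sub[OF vi] sub[OF wi] sub[OF ki]
            by (intro integrable_diff integrable_add integrable_on_mult_left integrable_on_mult_right)
          show "(\<lambda>r. e * m r) integrable_on {s..t}" using sub[OF mi] by (rule integrable_on_mult_right)
          fix r assume r: "r \<in> {s..t}"
          have 1: "\<bar>z t - z r\<bar> \<le> e" "\<bar>V s - V r\<bar> \<le> e"
            using d12(3)[of r s] d12(4)[of r t] r st * by fastforce+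
          have "v r * z t + V s * w r - k r = v r * (z t - z r) + (V s - V r) * w r"
            by (simp add: k_def algebra_simps)
          also have "\<bar>\<dots>\<bar> \<le> \<bar>v r\<bar> * \<bar>z t - z r\<bar> + \<bar>V s - V r\<bar> * \<bar>w r\<bar>"
            by (metis abs_mult abs_triangle_ineq)
          also have "\<dots> \<le> \<bar>v r\<bar> * e + e * \<bar>w r\<bar>"
            using 1 by (intro add_mono mult_mono) auto
          finally show "norm (v r * z t + V s * w r - k r) \<le> e * m r" by (simp add: m_def algebra_simps)
        qed
        also have "integral {s..t} (\<lambda>r. e * m r) = e * (M t - M s)"
          using split[of m s t] mi * by (simp add: M_def)
        finally show "\<bar>G t - G s\<bar> \<le> e * (M t - M s)" by simp
      qed
      then show ?case using d12 by (intro exI[of _ "min d1 d2"]) auto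
    qed
    then show ?thesis using cd by (simp add: P_def)
  qed
  have "\<bar>G d - G c\<bar> \<le> 0"
  proof (rule ccontr)
    assume "\<not> \<bar>G d - G c\<bar> \<le> 0"
    then have pos: "0 < \<bar>G d - G c\<bar>" by simp
    then have "0 < M d - M c" using main[of 1] by simp
    then show False using main[of "\<bar>G d - G c\<bar> / (2 * (M d - M c))"] pos by (simp add: field_simps)
  qed
  then have "G d = G c" by simp
  moreover have "G c = 0" by (simp add: G_def V_def)
  moreover have "integral {c..d} k = integral {c..d} (\<lambda>t. v t * z t) + integral {c..d} (\<lambda>t. V t * w t)"
    unfolding k_def using vz Vw by (rule integral_add)
  moreover have "V c * z c = 0" by (simp add: V_def)
  ultimately show ?thesis by (simp add: G_def)
qed

text \<open>Integration by parts turns the hypothesis into \<open>\<integral> F w = 0\<close> for \<open>F = u + V\<close> and all continuous \<open>w\<close>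
  of mean zero, so \<open>\<integral> F w = C \<integral> w\<close> for all continuous \<open>w\<close> that vanish outside the interval. Letting
  \<open>w\<close> increase to indicators of subintervals, the averages of \<open>F\<close> over all subintervals equal \<open>C\<close>, and
  so does \<open>F\<close> at each of its Lebesgue points.\<close>

lemma du_bois_reymond:
  fixes u v :: "real \<Rightarrow> real"
  assumes lr: "l < r" and u: "u absolutely_integrable_on {l..r}" and v: "v absolutely_integrable_on {l..r}"
    and weak: "\<And>w. continuous_on UNIV w \<Longrightarrow> (\<And>t. t \<notin> {l<..<r} \<Longrightarrow> w t = 0) \<Longrightarrow> integral {l..r} w = 0 \<Longrightarrow>
      integral {l..r} (\<lambda>t. u t * w t) = integral {l..r} (\<lambda>t. v t * integral {l..t} w)"
  obtains C N where "negligible N" "\<And>t. t \<in> {l..r} - N \<Longrightarrow> u t = C - integral {l..t} v"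
proof -
  define V where "V t = integral {l..t} v" for t
  have vi: "v integrable_on {l..r}" and ui: "u integrable_on {l..r}"
    using u v by (auto intro: set_lebesgue_integral_eq_integral(1))
  have cV: "continuous_on {l..r} V"
    unfolding V_def using vi by (rule indefinite_integral_continuous_1)
  define F where "F t = u t + V t" for t
  have Fa: "F absolutely_integrable_on {l..r}"
    unfolding F_def by (intro set_integral_add u absolutely_integrable_continuous_real cV)
  have Fi: "F integrable_on {l..r}"
    using Fa by (rule set_lebesgue_integral_eq_integral(1))
  have Fw: "(\<lambda>t. F t * w t) integrable_on {l..r}" if "continuous_on {l..r} w" for w
    using absolutely_integrable_mult_continuous[OF Fa that] by (rule set_lebesgue_integral_eq_integral(1))
  have zero: "integral {l..r} (\<lambda>t. F t * w t) = 0"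
    if w: "continuous_on UNIV w" "\<And>t. t \<notin> {l<..<r} \<Longrightarrow> w t = 0" "integral {l..r} w = 0" for w
  proof -
    have w': "continuous_on {l..r} w" using w(1) continuous_on_subset by blast
    have uw: "(\<lambda>t. u t * w t) integrable_on {l..r}"
      using absolutely_integrable_mult_continuous[OF u w'] by (rule set_lebesgue_integral_eq_integral(1))
    have Vw: "(\<lambda>t. V t * w t) integrable_on {l..r}"
      by (intro integrable_continuous_real continuous_intros cV w')
    have "integral {l..r} (\<lambda>t. F t * w t) = integral {l..r} (\<lambda>t. u t * w t) + integral {l..r} (\<lambda>t. V t * w t)"
      using integral_add[OF uw Vw] by (simp add: F_def distrib_right)
    also have "integral {l..r} (\<lambda>t. u t * w t) = integral {l..r} (\<lambda>t. v t * integral {l..t} w)"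
      by (rule weak) (use w in auto)
    also have "\<dots> = - integral {l..r} (\<lambda>t. V t * w t)"
      using integral_by_parts_primitives[OF less_imp_le[OF lr] v w'] w(3) by (simp add: V_def)
    finally show ?thesis by simp
  qed
  define w0 where "w0 t = max 0 (min (t - l) (r - t))" for t
  have w0: "continuous_on A w0" for A unfolding w0_def by (intro continuous_intros)
  have w0s: "w0 t = 0" if "t \<notin> {l<..<r}" for t using that by (auto simp: w0_def)
  define m where "m = integral {l..r} w0"
  have m: "0 < m"
  proof -
    have "0 \<le> m" unfolding m_def by (rule integral_nonneg) (auto simp: w0_def intro!: integrable_continuous_real w0[unfolded w0_def])
    moreover have "m \<noteq> 0"
    proof
      assume "m = 0"
      then have "\<forall>t\<in>{l..r}. w0 t = 0"
        unfolding m_def by (subst (asm) integral_eq_0_iff[OF w0 lr]) (simp_all add: w0_def)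
      then have "w0 ((l + r) / 2) = 0" using lr by simp
      moreover have "l < (l + r) / 2" "(l + r) / 2 < r" using lr by simp_all
      then have "0 < w0 ((l + r) / 2)" by (simp add: w0_def less_max_iff_disj del: less_divide_eq_numeral1 divide_less_eq_numeral1)
      ultimately show False by simp
    qed
    ultimately show ?thesis by simp
  qed
  define C where "C = integral {l..r} (\<lambda>t. F t * w0 t) / m"
  have const: "integral {l..r} (\<lambda>t. F t * w t) = C * integral {l..r} w"
    if w: "continuous_on UNIV w" "\<And>t. t \<notin> {l<..<r} \<Longrightarrow> w t = 0" for w
  proof -
    define c where "c = integral {l..r} w / m"
    have w': "continuous_on {l..r} w" using w(1) continuous_on_subset by blast
    have 1: "integral {l..r} (\<lambda>t. w t - c * w0 t) = 0"
      using m by (subst integral_diff) (auto intro!: integrable_continuous_real continuous_intros w' w0 simp: c_def m_def)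
    have "integral {l..r} (\<lambda>t. F t * (w t - c * w0 t)) = 0"
      by (rule zero) (use w w0s 1 in \<open>auto intro!: continuous_intros w0\<close>)
    moreover have "integral {l..r} (\<lambda>t. F t * (w t - c * w0 t))
        = integral {l..r} (\<lambda>t. F t * w t) - c * integral {l..r} (\<lambda>t. F t * w0 t)"
      using integral_diff[OF Fw[OF w'] integrable_on_mult_right[OF Fw[OF w0], of c]]
      by (simp add: algebra_simps)
    ultimately show ?thesis by (simp add: C_def c_def)
  qed
  have ivl: "integral {s..t} F = C * (t - s)" if st: "l \<le> s" "s < t" "t \<le> r" for s t
  proof -
    \<comment> \<open>Continuous functions increasing to the indicator of the open interval.\<close>
    define w where "w n x = min 1 (real n * max 0 (min (x - s) (t - x)))" for n x
    have cw: "continuous_on A (w n)" for n A unfolding w_def by (intro continuous_intros)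
    have ws: "w n x = 0" if "x \<notin> {s<..<t}" for n x using that by (auto simp: w_def)
    have w01: "0 \<le> w n x" "w n x \<le> 1" for n x by (auto simp: w_def)
    have wl: "(\<lambda>n. w n x) \<longlonglongrightarrow> (if x \<in> {s<..<t} then 1 else 0)" for x
    proof (cases "x \<in> {s<..<t}")
      case True
      define y where "y = max 0 (min (x - s) (t - x))"
      have "0 < y" using True by (auto simp: y_def)
      obtain n0 where n0: "1 < real n0 * y" using reals_Archimedean3[OF \<open>0 < y\<close>] by blast
      have "eventually (\<lambda>n. w n x = 1) sequentially"
        using eventually_ge_at_top[of n0]
      proof eventually_elim
        case (elim n)
        have "real n0 * y \<le> real n * y" using elim \<open>0 < y\<close> by (intro mult_right_mono) auto
        then show ?case using n0 by (simp add: w_def flip: y_def)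
      qed
      then show ?thesis using True by (auto intro: tendsto_eventually)
    next
      case False
      then have "w n x = 0" for n by (rule ws)
      then show ?thesis using False by auto
    qed
    have 1: "(\<lambda>n. integral {l..r} (\<lambda>x. F x * w n x)) \<longlonglongrightarrow> integral {l..r} (\<lambda>x. F x * (if x \<in> {s<..<t} then 1 else 0))"
    proof (rule dominated_convergence(2))
      show "(\<lambda>x. F x * w n x) integrable_on {l..r}" for n using Fw cw by blast
      show "(\<lambda>x. \<bar>F x\<bar>) integrable_on {l..r}" using Fa by (simp add: absolutely_integrable_on_def)
      show "norm (F x * w n x) \<le> \<bar>F x\<bar>" for n x
        using w01[of n x] by (simp add: abs_mult mult_left_le)
      show "(\<lambda>n. F x * w n x) \<longlonglongrightarrow> F x * (if x \<in> {s<..<t} then 1 else 0)" for x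
        by (intro tendsto_intros wl)
    qed
    have 2: "(\<lambda>n. integral {l..r} (w n)) \<longlonglongrightarrow> integral {l..r} (\<lambda>x. if x \<in> {s<..<t} then 1 else 0)"
    proof (rule dominated_convergence(2))
      show "w n integrable_on {l..r}" for n by (intro integrable_continuous_real cw)
      show "(\<lambda>x. 1::real) integrable_on {l..r}" by (rule integrable_const_ivl)
      show "norm (w n x) \<le> 1" for n x using w01[of n x] by simp
    qed (rule wl)
    have "integral {l..r} (\<lambda>x. F x * w n x) = C * integral {l..r} (w n)" for n
      by (rule const) (use cw ws st in auto)
    then have "(\<lambda>n. integral {l..r} (\<lambda>x. F x * w n x)) \<longlonglongrightarrow> C * integral {l..r} (\<lambda>x. if x \<in> {s<..<t} then 1 else 0)"
      using tendsto_mult_left[OF 2, of C] by simp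
    from LIMSEQ_unique[OF 1 this]
    have "integral {l..r} (\<lambda>x. if x \<in> {s<..<t} then F x else 0) = C * integral {l..r} (\<lambda>x. if x \<in> {s<..<t} then 1 else 0)"
      by (simp add: if_distrib cong: if_cong)
    moreover have "integral {l..r} (\<lambda>x. if x \<in> {s<..<t} then f x else 0) = integral {s..t} f" for f :: "real \<Rightarrow> real"
    proof -
      have "{s<..<t} \<inter> {l..r} = {s<..<t}" using st by auto
      then have "integral {l..r} (\<lambda>x. if x \<in> {s<..<t} then f x else 0) = integral {s<..<t} f"
        using integral_restrict_Int[of "{l..r}" "{s<..<t}" f] by (simp add: Int_commute)
      then show ?thesis by (simp add: integral_open_interval_real)
    qed
    ultimately show ?thesis using st by simp
  qed
  define F0 where "F0 t = (if t \<in> {l..r} then F t else 0)" for t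
  have "F0 integrable_on UNIV" unfolding F0_def using Fi by (simp only: integrable_restrict_UNIV)
  then have "F0 integrable_on cbox x y" for x y
    by (rule integrable_on_subcbox) auto
  then obtain N where N: "negligible N"
    "\<And>x e. x \<notin> N \<Longrightarrow> 0 < e \<Longrightarrow> \<exists>d>0. \<forall>h. 0 < h \<and> h < d \<longrightarrow>
        norm (integral (cbox x (x + h *\<^sub>R One)) F0 /\<^sub>R h ^ DIM(real) - F0 x) < e"
    using integrable_ccontinuous_explicit[of F0] by metis
  show thesis
  proof (rule that[of "insert r N" C])
    show "negligible (insert r N)" using N by simp
    fix x assume x: "x \<in> {l..r} - insert r N"
    have "\<bar>C - F x\<bar> < e" if "0 < e" for e
    proof -
      obtain d where d: "0 < d" "\<And>h. 0 < h \<Longrightarrow> h < d \<Longrightarrow> \<bar>integral {x..x + h} F0 / h - F0 x\<bar> < e"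
        using N(2)[of x e] x \<open>0 < e\<close> by (auto simp: divide_inverse mult.commute)
      \<comment> \<open>Averages are taken to the right of \<open>x\<close>, hence \<open>r\<close> itself is put into the null set.\<close>
      define h where "h = min (d / 2) (r - x)"
      have h: "0 < h" "h < d" "x + h \<le> r" using d x by (auto simp: h_def)
      have "integral {x..x + h} F0 = integral {x..x + h} F"
        by (rule integral_cong) (use h x in \<open>auto simp: F0_def\<close>)
      also have "\<dots> = C * h" using ivl[of x "x + h"] h x by simp
      finally show ?thesis using d(2)[OF h(1,2)] h x by (simp add: F0_def)
    qed
    then have "C = F x"
      by (metis abs_le_zero_iff eq_iff_diff_eq_0 linorder_not_le less_irrefl)
    then show "u x = C - integral {l..x} v" by (simp add: F_def V_def)
  qed
qed

section \<open>Functions on the unit interval\<close>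

lemma AE_lebesgue_on_negligible:
  assumes "AE t in lebesgue_on S. P t" "S \<in> sets lebesgue"
  obtains N where "negligible N" "\<And>t. t \<in> S - N \<Longrightarrow> P t"
proof -
  have "AE t in lebesgue. t \<in> S \<longrightarrow> P t"
    using assms by (simp add: AE_restrict_space_iff)
  then obtain N where "N \<in> null_sets lebesgue" "{t \<in> space lebesgue. \<not> (t \<in> S \<longrightarrow> P t)} \<subseteq> N"
    unfolding eventually_ae_filter by blast
  then show thesis by (intro that[of N]) (auto simp: negligible_iff_null_sets)
qed

lemma negligible_AE_lebesgue_on:
  assumes "negligible N" "\<And>t. t \<in> S - N \<Longrightarrow> P t" "S \<in> sets lebesgue"
  shows "AE t in lebesgue_on S. P t"
proof -
  have "AE t in lebesgue. t \<notin> N"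
    using assms(1) by (intro AE_not_in) (simp add: negligible_iff_null_sets)
  then have "AE t in lebesgue. t \<in> S \<longrightarrow> P t" by eventually_elim (use assms(2) in auto)
  then show ?thesis using assms(3) by (simp add: AE_restrict_space_iff)
qed

abbreviation "I01 \<equiv> lebesgue_on {0..1::real}"

lemma continuous_imp_measurable_I01:
  fixes f :: "real \<Rightarrow> real"
  shows "continuous_on {0..1} f \<Longrightarrow> f \<in> borel_measurable I01"
  by (rule continuous_imp_measurable_on_sets_lebesgue) auto

lemma measurable_I01_cong_negligible:
  fixes f g :: "real \<Rightarrow> real"
  assumes "f \<in> borel_measurable I01" "negligible N" "\<And>t. t \<in> {0..1} - N \<Longrightarrow> f t = g t"
  shows "g \<in> borel_measurable I01"
proof -
  have S: "{0..1::real} \<in> sets lebesgue" by simp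
  have "(\<lambda>t. if t \<in> {0..1} then f t else 0) \<in> borel_measurable lebesgue"
    using assms(1) borel_measurable_if[OF S, of f] by simp
  moreover have "AE t in lebesgue. t \<notin> N"
    using assms(2) by (intro AE_not_in) (simp add: negligible_iff_null_sets)
  then have "AE t in lebesgue. (if t \<in> {0..1} then f t else 0) = (if t \<in> {0..1} then g t else 0)"
    by eventually_elim (use assms(3) in auto)
  ultimately have "(\<lambda>t. if t \<in> {0..1} then g t else 0) \<in> borel_measurable lebesgue"
    by (rule borel_measurable_AE)
  then show ?thesis using borel_measurable_if[OF S, of g] by simp
qed

lemma integrable_I01_bounded:
  fixes f :: "real \<Rightarrow> real"
  assumes "f \<in> borel_measurable I01" "negligible N" "\<And>t. t \<in> {0..1} - N \<Longrightarrow> \<bar>f t\<bar> \<le> B"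
  shows "integrable I01 f"
proof (rule finite_measure.integrable_const_bound)
  show "finite_measure I01" by (rule finite_measureI) (simp add: emeasure_restrict_space)
  show "AE t in I01. norm (f t) \<le> B"
    by (rule negligible_AE_lebesgue_on[OF assms(2)]) (use assms(3) in auto)
qed (rule assms(1))

lemma nn_integral_I01_le:
  assumes "AE t in I01. f t \<le> B"
  shows "(\<integral>\<^sup>+ t. ennreal (f t) \<partial>I01) \<le> ennreal B"
proof -
  have "(\<integral>\<^sup>+ t. ennreal (f t) \<partial>I01) \<le> (\<integral>\<^sup>+ t. ennreal B \<partial>I01)"
    using assms by (intro nn_integral_mono_AE) (auto elim!: eventually_mono intro: ennreal_leI)
  also have "\<dots> = ennreal B" by (simp add: emeasure_restrict_space)
  finally show ?thesis .
qed

lemma at_within_I01_nontrivial: "at s within {0..1} \<noteq> bot" if "s \<in> {0..1::real}"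
  using that by (simp add: trivial_limit_within islimpt_Icc)

section \<open>Test functions\<close>

lemma integral_continuous_pos:
  fixes f :: "real \<Rightarrow> real"
  assumes "continuous_on {c..d} f" "\<And>t. t \<in> {c..d} \<Longrightarrow> 0 \<le> f t" "z \<in> {c..d}" "0 < f z" "c < d"
  shows "0 < integral {c..d} f"
proof -
  have "0 \<le> integral {c..d} f"
    using assms by (intro integral_nonneg integrable_continuous_real) auto
  moreover have "integral {c..d} f \<noteq> 0"
    using integral_eq_0_iff[OF assms(1,5,2)] assms(3,4) by force
  ultimately show ?thesis by simp
qed

lemma integral_superinterval:
  fixes f :: "real \<Rightarrow> real"
  assumes "\<And>t. t \<notin> {l..r} \<Longrightarrow> f t = 0" "{l..r} \<subseteq> S"
  shows "integral S f = integral {l..r} f"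
proof (rule integral_spike_set)
  have "{x \<in> S - {l..r}. f x \<noteq> 0} = {}" using assms(1) by auto
  then show "negligible {x \<in> S - {l..r}. f x \<noteq> 0}" by (simp only: negligible_empty)
  have "{x \<in> {l..r} - S. f x \<noteq> 0} = {}" using assms(2) by auto
  then show "negligible {x \<in> {l..r} - S. f x \<noteq> 0}" by (simp only: negligible_empty)
qed

text \<open>Continuous functions of mean zero that vanish near the ends are derivatives of test functions, which
  is how test functions enter du Bois-Reymond's lemma.\<close>

lemma primitive_in_C1c:
  fixes w :: "real \<Rightarrow> real"
  assumes w: "continuous_on UNIV w" and supp': "\<forall>t. t \<notin> {l<..<r} \<longrightarrow> w t = 0"
    and lr: "0 < l" "l < r" "r < 1" and int0: "integral {l..r} w = 0"
  defines "\<zeta> \<equiv> \<lambda>t. integral {0..t} w"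
  shows "\<zeta> \<in> C1c_unit_interval" and "deriv \<zeta> = w"
    and "\<And>t. t \<in> {l..r} \<Longrightarrow> \<zeta> t = integral {l..t} w" and "\<And>t. t \<notin> {l<..<r} \<Longrightarrow> \<zeta> t = 0"
proof -
  have supp: "w t = 0" if "t \<notin> {l<..<r}" for t using supp' that by blast
  have wi: "w integrable_on {c..d}" for c d
    by (intro integrable_continuous_real continuous_on_subset[OF w]) auto
  have left: "\<zeta> t = 0" if "t \<le> l" for t
    unfolding \<zeta>_def using supp that by (intro integral_unique has_integral_is_0) auto
  have mid: "\<zeta> t = integral {l..t} w" if "l \<le> t" for t
    using Henstock_Kurzweil_Integration.integral_combine[of 0 l t w] lr that wi left[of l] by (simp add: \<zeta>_def)
  show "\<zeta> t = integral {l..t} w" if "t \<in> {l..r}" for t using mid that by simp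
  have right: "\<zeta> t = 0" if "r \<le> t" for t
  proof -
    have "integral {r..t} w = 0" using supp by (intro integral_unique has_integral_is_0) auto
    then show ?thesis
      using Henstock_Kurzweil_Integration.integral_combine[of l r t w] lr that wi int0 mid[of t] by simp
  qed
  show out: "\<zeta> t = 0" if "t \<notin> {l<..<r}" for t using left right that by force
  have der: "(\<zeta> has_real_derivative w t) (at t)" for t
  proof (cases "0 < t")
    case True
    have "(\<zeta> has_real_derivative w t) (at t within {0..t + 1})"
      unfolding \<zeta>_def by (rule integral_has_real_derivative[OF continuous_on_subset[OF w]]) (use True in simp_all)
    moreover have "at t within {0..t + 1} = at t"
      by (rule at_within_interior) (use True in simp)
    ultimately show ?thesis by simp
  next
    case False
    then have "t \<in> {..<l}" using lr by simp
    have "(\<zeta> has_real_derivative 0) (at t)"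
      by (rule has_field_derivative_transform_within_open[of "\<lambda>_. 0" _ _ "{..<l}"])
        (use \<open>t \<in> {..<l}\<close> left in auto)
    then show ?thesis using supp[of t] lr False by simp
  qed
  then show dw: "deriv \<zeta> = w" by (intro ext DERIV_imp_deriv)
  have sub: "closure {t. \<zeta> t \<noteq> 0} \<subseteq> {l..r}"
  proof (rule closure_minimal)
    show "{t. \<zeta> t \<noteq> 0} \<subseteq> {l..r}"
    proof
      fix t assume "t \<in> {t. \<zeta> t \<noteq> 0}"
      then have "t \<in> {l<..<r}" using out[of t] by blast
      then show "t \<in> {l..r}" by simp
    qed
  qed simp
  have "compact (closure {t. \<zeta> t \<noteq> 0})"
    unfolding compact_eq_bounded_closed using bounded_subset[OF bounded_closed_interval sub] by simp
  moreover have "{l..r} \<subseteq> {0<..<1}" using lr by auto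
  then have "closure {t. \<zeta> t \<noteq> 0} \<subseteq> {0<..<1}" using sub by (rule order_trans[rotated])
  moreover have "\<zeta> C1_differentiable_on UNIV"
    unfolding C1_differentiable_on_def using der w by (auto simp: has_real_derivative_iff_has_vector_derivative)
  ultimately show "\<zeta> \<in> C1c_unit_interval" by (simp add: C1c_unit_interval_def)
qed

lemma C1c_unit_intervalD:
  assumes "\<zeta> \<in> C1c_unit_interval"
  shows "(\<zeta> has_real_derivative deriv \<zeta> t) (at t)" "continuous_on S \<zeta>" "continuous_on S (deriv \<zeta>)"
    and "t \<notin> {0<..<1} \<Longrightarrow> \<zeta> t = 0"
proof -
  obtain D where D: "\<And>t. (\<zeta> has_real_derivative D t) (at t)" "continuous_on UNIV D"
    using assms unfolding C1c_unit_interval_def C1_differentiable_on_def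
    by (auto simp: has_real_derivative_iff_has_vector_derivative)
  have "deriv \<zeta> = D" using D(1) by (intro ext DERIV_imp_deriv)
  then show d: "(\<zeta> has_real_derivative deriv \<zeta> t) (at t)" for t using D by simp
  show "continuous_on S (deriv \<zeta>)" using \<open>deriv \<zeta> = D\<close> D(2) continuous_on_subset by blast
  show "continuous_on S \<zeta>"
    using d by (intro DERIV_continuous_on[of _ _ "deriv \<zeta>"]) (rule has_field_derivative_at_within)
  show "\<zeta> t = 0" if "t \<notin> {0<..<1}"
    using assms that closure_subset[of "{t. \<zeta> t \<noteq> 0}"] unfolding C1c_unit_interval_def by blast
qed

lemma uminus_C1c:
  assumes "\<zeta> \<in> C1c_unit_interval"
  shows "(\<lambda>t. - \<zeta> t) \<in> C1c_unit_interval" "deriv (\<lambda>t. - \<zeta> t) t = - deriv \<zeta> t"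
proof -
  have d: "((\<lambda>t. - \<zeta> t) has_real_derivative - deriv \<zeta> t) (at t)" for t
    by (rule DERIV_minus[OF C1c_unit_intervalD(1)[OF assms]])
  then show "deriv (\<lambda>t. - \<zeta> t) t = - deriv \<zeta> t" by (rule DERIV_imp_deriv)
  have "continuous_on UNIV (\<lambda>t. - deriv \<zeta> t)"
    by (intro continuous_on_minus C1c_unit_intervalD(3)[OF assms])
  then have "(\<lambda>t. - \<zeta> t) C1_differentiable_on UNIV"
    using d unfolding C1_differentiable_on_def has_real_derivative_iff_has_vector_derivative
    by (intro exI[of _ "\<lambda>t. - deriv \<zeta> t"] conjI ballI)
  then show "(\<lambda>t. - \<zeta> t) \<in> C1c_unit_interval"
    using assms by (simp add: C1c_unit_interval_def)
qed

text \<open>Integrability of \<open>f \<zeta>'\<close> and \<open>s \<zeta>\<close> for all test functions says that \<open>f\<close> and \<open>s\<close> are integrable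
  over compact subintervals: divide by \<open>\<zeta>'\<close> and \<open>\<zeta>\<close> for a \<open>\<zeta>\<close> that is positive and strictly increasing
  there.\<close>

lemma increasing_test_function:
  assumes lr: "0 < l" "l < r" "r < 1"
  obtains \<zeta> where "\<zeta> \<in> C1c_unit_interval" "\<And>t. t \<in> {l..r} \<Longrightarrow> 0 < \<zeta> t" "\<And>t. t \<in> {l..r} \<Longrightarrow> 0 < deriv \<zeta> t"
proof -
  define \<alpha> \<gamma> \<beta> where "\<alpha> = l / 2" and "\<gamma> = (1 + r) / 2" and "\<beta> = (1 + \<gamma>) / 2"
  have ord: "0 < \<alpha>" "\<alpha> < l" "r < \<gamma>" "\<gamma> < \<beta>" "\<beta> < 1"
    using lr by (auto simp: \<alpha>_def \<gamma>_def \<beta>_def)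
  define tent where "tent s t x = max 0 (min (x - s) (t - x))" for s t x :: real
  have tc: "continuous_on A (tent s t)" for A s t unfolding tent_def by (intro continuous_intros)
  have tpos: "0 < tent s t x" if "s < x" "x < t" for s t x using that by (simp add: tent_def less_max_iff_disj)
  have t0: "tent s t x = 0" if "x \<notin> {s<..<t}" for s t x using that by (auto simp: tent_def)
  have tnn: "0 \<le> tent s t x" for s t x by (simp add: tent_def)
  define m1 m2 where "m1 = integral {\<alpha>..\<beta>} (tent \<alpha> \<gamma>)" and "m2 = integral {\<alpha>..\<beta>} (tent \<gamma> \<beta>)"
  have m2: "0 < m2"
    unfolding m2_def
    by (rule integral_continuous_pos[where z = "(\<gamma> + \<beta>) / 2"]) (use ord lr in \<open>auto intro!: tc tnn tpos\<close>)
  \<comment> \<open>Positive on \<open>(\<alpha>, \<gamma>)\<close>, which contains \<open>[l, r]\<close>; the second tent restores mean zero beyond \<open>\<gamma>\<close>.\<close>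
  define w where "w x = tent \<alpha> \<gamma> x - m1 / m2 * tent \<gamma> \<beta> x" for x
  have wc: "continuous_on A w" for A unfolding w_def by (intro continuous_intros tc)
  have w0: "\<forall>t. t \<notin> {\<alpha><..<\<beta>} \<longrightarrow> w t = 0"
    using t0[of _ \<alpha> \<gamma>] t0[of _ \<gamma> \<beta>] ord lr by (auto simp: w_def)
  have wi: "integral {\<alpha>..\<beta>} w = 0"
    unfolding w_def using m2
    by (subst integral_diff) (auto intro!: integrable_continuous_real continuous_intros tc simp: m1_def m2_def)
  have \<alpha>\<beta>: "\<alpha> < \<beta>" using ord lr by linarith
  note prim = primitive_in_C1c[OF wc w0 ord(1) \<alpha>\<beta> ord(5) wi]
  show thesis
  proof (rule that[OF prim(1)])
    fix t assume t: "t \<in> {l..r}"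
    have w1: "w x = tent \<alpha> \<gamma> x" if "x \<le> \<gamma>" for x using t0[of x \<gamma> \<beta>] that by (simp add: w_def)
    show "0 < deriv (\<lambda>t. integral {0..t} w) t"
      unfolding prim(2) using w1[of t] tpos[of \<alpha> t \<gamma>] t ord by simp
    have "0 < integral {\<alpha>..t} w"
    proof (rule integral_continuous_pos[where z = "(\<alpha> + l) / 2"])
      show "0 \<le> w x" if "x \<in> {\<alpha>..t}" for x using w1[of x] tnn that t ord by simp
      have "(\<alpha> + l) / 2 < l" "\<alpha> < (\<alpha> + l) / 2" using ord by simp_all
      then show "0 < w ((\<alpha> + l) / 2)" "(\<alpha> + l) / 2 \<in> {\<alpha>..t}"
        using w1[of "(\<alpha> + l) / 2"] tpos[of \<alpha> "(\<alpha> + l) / 2" \<gamma>] t ord by simp_all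
    qed (use wc t ord in auto)
    then show "0 < integral {0..t} w" using prim(3)[of t] t ord by simp
  qed
qed

lemma integrable_lebesgue_on_iff:
  fixes f :: "real \<Rightarrow> real"
  shows "S \<in> sets lebesgue \<Longrightarrow> integrable (lebesgue_on S) f \<longleftrightarrow> f absolutely_integrable_on S"
  by (simp add: set_integrable_def integrable_restrict_space)

lemma absolutely_integrable_div_continuous:
  fixes f g :: "real \<Rightarrow> real"
  assumes "(\<lambda>t. f t * g t) absolutely_integrable_on {l..r}" "continuous_on {l..r} g" "\<And>t. t \<in> {l..r} \<Longrightarrow> 0 < g t"
  shows "f absolutely_integrable_on {l..r}"
proof -
  have "continuous_on {l..r} (\<lambda>t. 1 / g t)"
  proof (intro continuous_intros assms(2) ballI)
    fix t assume "t \<in> {l..r}"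
    from assms(3)[OF this] show "g t \<noteq> 0" by simp
  qed
  from absolutely_integrable_mult_continuous[OF assms(1) this]
  have "(\<lambda>t. f t * g t * (1 / g t)) absolutely_integrable_on {l..r}" .
  then show ?thesis
    by (rule set_integrable_cong[THEN iffD1, rotated -1]) (use assms(3) in force)+
qed

text \<open>Test functions with compact support see only compact subintervals of \<open>(0,1)\<close>. Constants obtained on
  them agree, since all the intervals used here contain \<open>[1/3, 2/3]\<close>.\<close>

lemma constant_on_exhaustion:
  fixes f :: "real \<Rightarrow> real"
  assumes "\<And>l r. 0 < l \<Longrightarrow> l < r \<Longrightarrow> r < 1 \<Longrightarrow> \<exists>c N. negligible N \<and> (\<forall>t\<in>{l..r} - N. f t = c)"
  shows "\<exists>c N. negligible N \<and> (\<forall>t\<in>{0..1} - N. f t = c)"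
proof -
  define L R where "L n = 1 / (real n + 3)" and "R n = 1 - 1 / (real n + 3)" for n :: nat
  have LR: "0 < L n" "L n < R n" "R n < 1" "{1/3..2/3} \<subseteq> {L n..R n}" for n
  proof -
    have "1 / (real n + 3) \<le> 1 / 3" by (rule divide_left_mono) auto
    moreover have "0 < 1 / (real n + 3)" by simp
    ultimately show "0 < L n" "L n < R n" "R n < 1" "{1/3..2/3} \<subseteq> {L n..R n}"
      unfolding L_def R_def by (simp_all only: subset_iff atLeastAtMost_iff, linarith+)
  qed
  obtain c N where cN: "\<And>n. negligible (N n)" "\<And>n t. t \<in> {L n..R n} - N n \<Longrightarrow> f t = c n"
    using assms[OF LR(1-3)] by metis
  have "c n = c 0" for n
  proof -
    have "\<not> {1/3..2/3::real} \<subseteq> N n \<union> N 0"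
    proof
      assume "{1/3..2/3::real} \<subseteq> N n \<union> N 0"
      then have "negligible {1/3..2/3::real}"
        by (rule negligible_subset[OF negligible_Un[OF cN(1) cN(1)]])
      then have "box (1/3::real) (2/3) = {}" using negligible_interval(1)[of "1/3::real" "2/3"] by (simp only: cbox_interval)
      moreover have "1/2 \<in> box (1/3::real) (2/3)" unfolding box_real by simp
      ultimately show False by blast
    qed
    then obtain t where t: "t \<in> {1/3..2/3}" "t \<notin> N n" "t \<notin> N 0" by blast
    then have "t \<in> {L n..R n} - N n" "t \<in> {L 0..R 0} - N 0"
      using subsetD[OF LR(4)[of n] t(1)] subsetD[OF LR(4)[of 0] t(1)] by simp_all
    from cN(2)[OF this(1)] cN(2)[OF this(2)] show ?thesis by simp
  qed
  note c = this
  show ?thesis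
  proof (intro exI conjI ballI)
    show "negligible (\<Union> (range N) \<union> {0, 1})"
      using cN(1) by (intro negligible_Un negligible_Union_nat) auto
    fix t :: real assume t: "t \<in> {0..1} - (\<Union> (range N) \<union> {0, 1})"
    then have "0 < min t (1 - t)" by auto
    then obtain n where n: "inverse (real (Suc n)) < min t (1 - t)" using reals_Archimedean by blast
    have "1 / (real n + 3) \<le> inverse (real (Suc n))" by (simp add: field_simps)
    then have "1 / (real n + 3) \<le> t" "1 / (real n + 3) \<le> 1 - t" using n by auto
    then have "t \<in> {L n..R n} - N n" using t by (auto simp: L_def R_def)
    then show "f t = c 0" using cN(2) c by simp
  qed
qed

text \<open>The equation \<open>f' = - s\<close> tested against a single \<open>\<zeta>\<close>, including the integrability of both
  sides. With \<open>\<zeta>\<close> fixed, the pairs \<open>(f, s)\<close> form a vector space, and both equations of (ii) are linear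
  combinations of one such statement per state.\<close>

definition weak_decay :: "(real \<Rightarrow> real) \<Rightarrow> (real \<Rightarrow> real) \<Rightarrow> (real \<Rightarrow> real) \<Rightarrow> bool" where
  "weak_decay \<zeta> f s \<longleftrightarrow> integrable I01 (\<lambda>t. f t * deriv \<zeta> t) \<and> integrable I01 (\<lambda>t. s t * \<zeta> t) \<and>
     (LINT t|I01. f t * deriv \<zeta> t) = (LINT t|I01. s t * \<zeta> t)"

lemma weak_decay_add:
  "weak_decay \<zeta> f s \<Longrightarrow> weak_decay \<zeta> f' s' \<Longrightarrow> weak_decay \<zeta> (\<lambda>t. f t + f' t) (\<lambda>t. s t + s' t)"
  by (simp add: weak_decay_def distrib_right)

lemma weak_decay_cmult:
  "weak_decay \<zeta> f s \<Longrightarrow> weak_decay \<zeta> (\<lambda>t. c * f t) (\<lambda>t. c * s t)"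
  by (simp add: weak_decay_def mult.assoc)

lemma weak_decay_sum:
  "(\<And>x. x \<in> A \<Longrightarrow> weak_decay \<zeta> (\<lambda>t. f t x) (\<lambda>t. s t x)) \<Longrightarrow>
   weak_decay \<zeta> (\<lambda>t. \<Sum>x\<in>A. f t x) (\<lambda>t. \<Sum>x\<in>A. s t x)"
  by (simp add: weak_decay_def sum_distrib_right)

lemma weak_decay_cong:
  assumes "\<And>t. t \<in> {0..1} \<Longrightarrow> f t = f' t" "\<And>t. t \<in> {0..1} \<Longrightarrow> s t = s' t"
  shows "weak_decay \<zeta> f s \<longleftrightarrow> weak_decay \<zeta> f' s'"
proof -
  have "integrable I01 (\<lambda>t. f t * deriv \<zeta> t) \<longleftrightarrow> integrable I01 (\<lambda>t. f' t * deriv \<zeta> t)"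
    "integrable I01 (\<lambda>t. s t * \<zeta> t) \<longleftrightarrow> integrable I01 (\<lambda>t. s' t * \<zeta> t)"
    using assms by (intro Bochner_Integration.integrable_cong refl; simp)+
  moreover have "(LINT t|I01. f t * deriv \<zeta> t) = (LINT t|I01. f' t * deriv \<zeta> t)"
    "(LINT t|I01. s t * \<zeta> t) = (LINT t|I01. s' t * \<zeta> t)"
    using assms by (intro Bochner_Integration.integral_cong refl; simp)+
  ultimately show ?thesis by (simp add: weak_decay_def)
qed

lemma weak_decay_scaled_iff:
  assumes "c \<noteq> 0"
  shows "weak_decay \<zeta> f (\<lambda>t. c * s t) \<longleftrightarrow> integrable I01 (\<lambda>t. f t * deriv \<zeta> t) \<and> integrable I01 (\<lambda>t. s t * \<zeta> t) \<and>
     (LINT t|I01. f t * deriv \<zeta> t) = c * (LINT t|I01. s t * \<zeta> t)"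
  using assms by (simp add: weak_decay_def mult.assoc)

section \<open>Energy and duality at a fixed time\<close>

text \<open>Discrete integration by parts.\<close>

lemma sum_by_parts_symmetric:
  fixes W :: "'a::finite \<Rightarrow> 'a \<Rightarrow> real"
  assumes "\<And>x y. W x y = W y x"
  shows "(\<Sum>x\<in>UNIV. \<Sum>y\<in>UNIV. f x * (g y - g x) * W x y)
    = - (\<Sum>x\<in>UNIV. \<Sum>y\<in>UNIV. (f y - f x) * (g y - g x) * W x y) / 2"
proof -
  let ?S = "\<Sum>x\<in>UNIV. \<Sum>y\<in>UNIV. f x * (g y - g x) * W x y"
  have "?S = (\<Sum>x\<in>UNIV. \<Sum>y\<in>UNIV. f y * (g x - g y) * W y x)"
    by (rule sum.swap)
  also have "\<dots> = (\<Sum>x\<in>UNIV. \<Sum>y\<in>UNIV. f y * (g x - g y) * W x y)"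
    by (simp only: assms)
  finally have "?S + ?S = (\<Sum>x\<in>UNIV. \<Sum>y\<in>UNIV. f x * (g y - g x) * W x y) + (\<Sum>x\<in>UNIV. \<Sum>y\<in>UNIV. f y * (g x - g y) * W x y)"
    by simp
  also have "\<dots> = - (\<Sum>x\<in>UNIV. \<Sum>y\<in>UNIV. (f y - f x) * (g y - g x) * W x y)"
    by (simp add: sum_negf[symmetric] sum.distrib[symmetric] algebra_simps)
  finally show ?thesis by simp
qed

locale reversible_chain =
  fixes K :: "'x::finite \<Rightarrow> 'x \<Rightarrow> real" and \<pi> p :: "'x \<Rightarrow> real" and a b :: real
  assumes kernel: "markov_kernel K" and irreducible: "irreducible_kernel K"
    and invariant: "invariant_probability K \<pi>" and reversible: "reversible_kernel K \<pi>"
    and a_pos: "0 < a" and b_pos: "0 < b"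
    and p_pos: "p \<in> pos_densities" and p_mass: "(\<Sum>x\<in>UNIV. p x * \<pi> x) = 1"
begin

lemma K_nonneg: "0 \<le> K x y"
  using kernel by (simp add: markov_kernel_def)

lemma detailed_balance: "K x y * \<pi> x = K y x * \<pi> y"
  using reversible unfolding reversible_kernel_def by blast

lemma \<pi>_nonneg: "0 \<le> \<pi> x"
  using invariant unfolding invariant_probability_def by blast

lemma \<pi>_mass: "(\<Sum>x\<in>UNIV. \<pi> x) = 1"
  using invariant unfolding invariant_probability_def by blast

lemma p\<pi>_mass: "(\<Sum>x\<in>UNIV. \<pi> x * p x) = 1"
  using p_mass by (simp add: mult.commute)

text \<open>Irreducibility, phrased as an induction principle along edges.\<close>

lemma connected_induct:
  assumes "P x" "\<And>y z. P y \<Longrightarrow> 0 < K y z \<Longrightarrow> P z"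
  shows "P y"
proof -
  have "(x, y) \<in> {(x, y). 0 < K x y}\<^sup>*"
    using irreducible by (simp add: irreducible_kernel_def)
  then show ?thesis
  proof (induction rule: rtrancl_induct)
    case base
    show ?case by (rule assms(1))
  next
    case (step y z)
    then show ?case using assms(2)[of y z] by simp
  qed
qed

lemma \<pi>_pos: "0 < \<pi> x"
proof -
  obtain z where z: "0 < \<pi> z"
  proof (rule ccontr)
    assume "\<not> thesis"
    then have "\<And>x. \<pi> x = 0" using that \<pi>_nonneg by (metis less_eq_real_def)
    then have "(\<Sum>x\<in>UNIV. \<pi> x) = 0" by simp
    then show False using \<pi>_mass by simp
  qed
  show ?thesis
  proof (rule connected_induct[where P = "\<lambda>x. 0 < \<pi> x", OF z])
    fix y z assume "0 < \<pi> y" "0 < K y z"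
    then have "0 < K y z * \<pi> y" by simp
    then have "0 < K z y * \<pi> z" by (simp only: detailed_balance[of y z])
    then show "0 < \<pi> z" using \<pi>_nonneg[of z] by (cases "\<pi> z = 0") auto
  qed
qed

text \<open>The inner product of \<open>L\<^sup>2(\<pi>)\<close>.\<close>

definition pairing :: "('x \<Rightarrow> real) \<Rightarrow> ('x \<Rightarrow> real) \<Rightarrow> real" where
  "pairing f g = (\<Sum>x\<in>UNIV. f x * g x * \<pi> x)"

definition source :: "('x \<Rightarrow> real) \<Rightarrow> real" where
  "source \<phi> = (pairing \<phi> p)\<^sup>2 / a\<^sup>2"

definition weight :: "('x \<Rightarrow> real) \<Rightarrow> 'x \<Rightarrow> 'x \<Rightarrow> real" where
  "weight n x y = edge_mean n x y * K x y * \<pi> x"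

text \<open>The velocity of the density that a potential \<open>\<phi>\<close> generates, with the optimal growth rate
  \<open>\<langle>\<phi>, p\<rangle> / a\<^sup>2\<close> and the optimal flux \<open>\<nabla>\<phi> / b\<^sup>2\<close> inserted in the continuity equation.\<close>

definition vel :: "('x \<Rightarrow> real) \<Rightarrow> ('x \<Rightarrow> real) \<Rightarrow> 'x \<Rightarrow> real" where
  "vel m \<phi> x = pairing \<phi> p / a\<^sup>2 * p x - (\<Sum>y\<in>UNIV. (\<phi> y - \<phi> x) * edge_mean m x y * K x y) / b\<^sup>2"

text \<open>Twice the Hamiltonian of the variational problem, and also the action density at the optimum.\<close>

definition energy :: "('x \<Rightarrow> real) \<Rightarrow> ('x \<Rightarrow> real) \<Rightarrow> real" where
  "energy n \<phi> = source \<phi> + (\<Sum>x\<in>UNIV. \<Sum>y\<in>UNIV. (\<phi> y - \<phi> x)\<^sup>2 * weight n x y) / (2 * b\<^sup>2)"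

text \<open>Half the partial gradient of \<open>energy\<close> in the density, with respect to \<open>pairing\<close>.\<close>

definition force :: "('x \<Rightarrow> real) \<Rightarrow> ('x \<Rightarrow> real) \<Rightarrow> 'x \<Rightarrow> real" where
  "force m \<phi> x = (\<Sum>y\<in>UNIV. (\<phi> y - \<phi> x)\<^sup>2 * d1_mean (m x) (m y) * K x y) / (2 * b\<^sup>2)"

text \<open>The action density, in the form in which \<open>action\<close> integrates it.\<close>

definition cost :: "('x \<Rightarrow> real) \<Rightarrow> ('x \<Rightarrow> real) \<Rightarrow> real \<Rightarrow> real" where
  "cost n \<eta> k = a\<^sup>2 * k\<^sup>2 + b\<^sup>2 * (1 / 2 * (\<Sum>x\<in>UNIV. \<Sum>y\<in>UNIV. (\<eta> y - \<eta> x)\<^sup>2 * edge_mean n x y * K x y * \<pi> x))"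

text \<open>The velocity that the continuity equation prescribes for given gradient data \<open>\<eta>\<close> and growth rate \<open>k\<close>.\<close>

definition flow :: "('x \<Rightarrow> real) \<Rightarrow> ('x \<Rightarrow> real) \<Rightarrow> real \<Rightarrow> 'x \<Rightarrow> real" where
  "flow n \<eta> k x = k * p x - (\<Sum>y\<in>UNIV. (\<eta> y - \<eta> x) * edge_mean n x y * K x y)"

lemma weight_sym: "weight n x y = weight n y x" if "n \<in> nonneg_densities"
proof -
  have "edge_mean n x y = edge_mean n y x"
    using that unfolding edge_mean_def by (intro log_mean_commute) (auto simp: nonneg_densities_def)
  then show ?thesis unfolding weight_def using detailed_balance[of x y] by simp
qed

lemma weight_nonneg: "0 \<le> weight n x y" if "n \<in> nonneg_densities"
  using that K_nonneg \<pi>_nonneg unfolding weight_def edge_mean_def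
  by (intro mult_nonneg_nonneg log_mean_nonneg) (auto simp: nonneg_densities_def)

lemma pos_densities_nonneg: "m \<in> pos_densities \<Longrightarrow> m \<in> nonneg_densities"
  by (auto simp: pos_densities_def nonneg_densities_def less_imp_le)

lemma weight_pos: "0 < weight m x y" if "m \<in> pos_densities" "0 < K x y"
  using that \<pi>_pos unfolding weight_def edge_mean_def
  by (intro mult_pos_pos log_mean_positive) (auto simp: pos_densities_def)

lemma pairing_scale_left: "pairing (\<lambda>x. c * f x) g = c * pairing f g"
  by (simp add: pairing_def sum_distrib_left mult.assoc)

lemma pairing_flow:
  assumes "n \<in> nonneg_densities"
  shows "pairing f (flow n \<eta> k) = k * pairing f p + (\<Sum>x\<in>UNIV. \<Sum>y\<in>UNIV. (f y - f x) * (\<eta> y - \<eta> x) * weight n x y) / 2"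
proof -
  have "pairing f (flow n \<eta> k) = k * pairing f p - (\<Sum>x\<in>UNIV. \<Sum>y\<in>UNIV. f x * (\<eta> y - \<eta> x) * weight n x y)"
    by (simp add: pairing_def flow_def weight_def algebra_simps sum_subtractf sum.distrib sum_distrib_left sum_distrib_right)
  also have "(\<Sum>x\<in>UNIV. \<Sum>y\<in>UNIV. f x * (\<eta> y - \<eta> x) * weight n x y)
      = - (\<Sum>x\<in>UNIV. \<Sum>y\<in>UNIV. (f y - f x) * (\<eta> y - \<eta> x) * weight n x y) / 2"
    using weight_sym[OF assms] by (rule sum_by_parts_symmetric)
  finally show ?thesis by simp
qed

lemma vel_eq_flow: "vel m \<phi> = flow m (\<lambda>x. \<phi> x / b\<^sup>2) (pairing \<phi> p / a\<^sup>2)"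
  by (rule ext) (simp add: vel_def flow_def sum_divide_distrib diff_divide_distrib[symmetric])

lemma pairing_vel:
  assumes "m \<in> nonneg_densities"
  shows "pairing f (vel m \<phi>) = pairing \<phi> p * pairing f p / a\<^sup>2 + (\<Sum>x\<in>UNIV. \<Sum>y\<in>UNIV. (f y - f x) * (\<phi> y - \<phi> x) * weight m x y) / (2 * b\<^sup>2)"
  unfolding vel_eq_flow pairing_flow[OF assms]
  by (simp add: diff_divide_distrib[symmetric] sum_divide_distrib mult.commute[of 2])

lemma pairing_vel_self: "m \<in> nonneg_densities \<Longrightarrow> pairing \<phi> (vel m \<phi>) = energy m \<phi>"
  by (simp add: pairing_vel energy_def source_def power2_eq_square)

lemma cost_optimal: "cost m (\<lambda>x. \<phi> x / b\<^sup>2) (pairing \<phi> p / a\<^sup>2) = energy m \<phi>"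
proof -
  have "(\<phi> y / b\<^sup>2 - \<phi> x / b\<^sup>2)\<^sup>2 * edge_mean m x y * K x y * \<pi> x = (\<phi> y - \<phi> x)\<^sup>2 * weight m x y / b ^ 4" for x y
    by (simp add: weight_def diff_divide_distrib[symmetric] power_divide flip: power_mult)
  then show ?thesis
    using a_pos b_pos unfolding cost_def energy_def source_def
    by (simp add: sum_divide_distrib[symmetric] power_divide power2_eq_square power4_eq_xxxx)
qed

text \<open>Young's inequality for each edge and for the growth term.\<close>

lemma cost_ge_energy_dual:
  assumes "n \<in> nonneg_densities"
  shows "2 * pairing \<phi> (flow n \<eta> k) - energy n \<phi> \<le> cost n \<eta> k"
proof -
  have 1: "2 * (k * pairing \<phi> p) \<le> a\<^sup>2 * k\<^sup>2 + source \<phi>"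
  proof -
    have "0 \<le> (a * k - pairing \<phi> p / a)\<^sup>2" by simp
    also have "\<dots> = a\<^sup>2 * k\<^sup>2 + source \<phi> - 2 * (k * pairing \<phi> p)"
      using a_pos by (simp add: source_def power2_diff power_mult_distrib power_divide)
    finally show ?thesis by simp
  qed
  have 2: "(\<phi> y - \<phi> x) * (\<eta> y - \<eta> x) * weight n x y \<le>
      b\<^sup>2 / 2 * ((\<eta> y - \<eta> x)\<^sup>2 * weight n x y) + (\<phi> y - \<phi> x)\<^sup>2 * weight n x y / (2 * b\<^sup>2)" for x y
  proof -
    have "0 \<le> (b * (\<eta> y - \<eta> x) - (\<phi> y - \<phi> x) / b)\<^sup>2 * weight n x y / 2"
      using weight_nonneg[OF assms] by simp
    also have "\<dots> = b\<^sup>2 / 2 * ((\<eta> y - \<eta> x)\<^sup>2 * weight n x y) + (\<phi> y - \<phi> x)\<^sup>2 * weight n x y / (2 * b\<^sup>2)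
         - (\<phi> y - \<phi> x) * (\<eta> y - \<eta> x) * weight n x y"
      using b_pos unfolding power2_diff power_mult_distrib power_divide
      by (simp add: algebra_simps add_divide_distrib diff_divide_distrib)
    finally show ?thesis by simp
  qed
  have "(\<Sum>x\<in>UNIV. \<Sum>y\<in>UNIV. (\<phi> y - \<phi> x) * (\<eta> y - \<eta> x) * weight n x y) \<le>
     (\<Sum>x\<in>UNIV. \<Sum>y\<in>UNIV. b\<^sup>2 / 2 * ((\<eta> y - \<eta> x)\<^sup>2 * weight n x y) + (\<phi> y - \<phi> x)\<^sup>2 * weight n x y / (2 * b\<^sup>2))"
    by (intro sum_mono 2)
  also have "\<dots> = b\<^sup>2 * (1 / 2 * (\<Sum>x\<in>UNIV. \<Sum>y\<in>UNIV. (\<eta> y - \<eta> x)\<^sup>2 * edge_mean n x y * K x y * \<pi> x))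
     + (\<Sum>x\<in>UNIV. \<Sum>y\<in>UNIV. (\<phi> y - \<phi> x)\<^sup>2 * weight n x y) / (2 * b\<^sup>2)"
    by (simp add: sum.distrib sum_distrib_left sum_divide_distrib weight_def mult.assoc)
  finally have 3: "(\<Sum>x\<in>UNIV. \<Sum>y\<in>UNIV. (\<phi> y - \<phi> x) * (\<eta> y - \<eta> x) * weight n x y) \<le> \<dots>" .
  have combine: "2 * (Y + X / 2) - (E + C) \<le> D + B" if "X \<le> B + C" "2 * Y \<le> D + E" for X Y B C D E :: real
  proof -
    have "2 * (Y + X / 2) = 2 * Y + X" by simp
    then show ?thesis using that by linarith
  qed
  show ?thesis unfolding pairing_flow[OF assms] cost_def energy_def by (rule combine[OF 3 1])
qed

text \<open>The Cauchy-Schwarz inequality for the positive form \<open>\<langle>f, vel m \<phi>\<rangle>\<close>, in additive form.\<close>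

lemma pairing_vel_le_energy:
  assumes "m \<in> nonneg_densities"
  shows "2 * pairing f (vel m \<phi>) \<le> energy m f + energy m \<phi>"
  using cost_ge_energy_dual[OF assms, of f "\<lambda>x. \<phi> x / b\<^sup>2" "pairing \<phi> p / a\<^sup>2"]
  unfolding vel_eq_flow cost_optimal by linarith

text \<open>By detailed balance the two endpoints of an edge contribute equally, so the force, which only sees
  derivatives in the first argument, pairs with \<open>n\<close> to the full linearisation of the weights.\<close>

lemma pairing_force:
  "2 * pairing (force m \<phi>) n = (\<Sum>x\<in>UNIV. \<Sum>y\<in>UNIV. (\<phi> y - \<phi> x)\<^sup>2 * ((d1_mean (m x) (m y) * n x + d1_mean (m y) (m x) * n y) * K x y * \<pi> x)) / (2 * b\<^sup>2)"
proof -
  let ?F = "\<lambda>x y. (\<phi> y - \<phi> x)\<^sup>2 * (d1_mean (m x) (m y) * n x * K x y * \<pi> x)"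
  have 0: "2 * pairing (force m \<phi>) n = ((\<Sum>x\<in>UNIV. \<Sum>y\<in>UNIV. ?F x y) + (\<Sum>x\<in>UNIV. \<Sum>y\<in>UNIV. ?F x y)) / (2 * b\<^sup>2)"
    by (simp add: pairing_def force_def sum_divide_distrib sum_distrib_right sum_distrib_left mult_ac)
  have "(\<Sum>x\<in>UNIV. \<Sum>y\<in>UNIV. ?F x y) = (\<Sum>x\<in>UNIV. \<Sum>y\<in>UNIV. ?F y x)"
    by (rule sum.swap)
  also have "\<dots> = (\<Sum>x\<in>UNIV. \<Sum>y\<in>UNIV. (\<phi> y - \<phi> x)\<^sup>2 * (d1_mean (m y) (m x) * n y * K x y * \<pi> x))"
  proof (intro sum.cong refl)
    fix x y
    have "d1_mean (m y) (m x) * n y * K y x * \<pi> y = d1_mean (m y) (m x) * n y * K x y * \<pi> x"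
      using detailed_balance[of x y] by (simp add: mult.assoc)
    then show "?F y x = (\<phi> y - \<phi> x)\<^sup>2 * (d1_mean (m y) (m x) * n y * K x y * \<pi> x)"
      by (simp add: power2_commute)
  qed
  finally have 1: "(\<Sum>x\<in>UNIV. \<Sum>y\<in>UNIV. ?F x y) = (\<Sum>x\<in>UNIV. \<Sum>y\<in>UNIV. (\<phi> y - \<phi> x)\<^sup>2 * (d1_mean (m y) (m x) * n y * K x y * \<pi> x))" .
  show ?thesis
    unfolding 0 by (subst (2) 1) (simp add: sum.distrib[symmetric] distrib_left[symmetric] distrib_right[symmetric])
qed

lemma energy_le_tangent:
  assumes m: "m \<in> pos_densities" and n: "n \<in> nonneg_densities"
  shows "energy n \<phi> \<le> source \<phi> + 2 * pairing (force m \<phi>) n"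
proof -
  have n0: "\<And>x. 0 \<le> n x" and m0: "\<And>x. 0 < m x" using m n by (auto simp: pos_densities_def nonneg_densities_def)
  have "(\<phi> y - \<phi> x)\<^sup>2 * weight n x y \<le> (\<phi> y - \<phi> x)\<^sup>2 * ((d1_mean (m x) (m y) * n x + d1_mean (m y) (m x) * n y) * K x y * \<pi> x)" for x y
    unfolding weight_def edge_mean_def
    by (intro mult_left_mono mult_right_mono log_mean_le_tangent K_nonneg \<pi>_nonneg m0 n0) auto
  then have "(\<Sum>x\<in>UNIV. \<Sum>y\<in>UNIV. (\<phi> y - \<phi> x)\<^sup>2 * weight n x y)
     \<le> (\<Sum>x\<in>UNIV. \<Sum>y\<in>UNIV. (\<phi> y - \<phi> x)\<^sup>2 * ((d1_mean (m x) (m y) * n x + d1_mean (m y) (m x) * n y) * K x y * \<pi> x))"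
    by (intro sum_mono)
  then show ?thesis
    unfolding energy_def pairing_force by (intro add_left_mono divide_right_mono) auto
qed

lemma energy_eq_tangent:
  assumes m: "m \<in> pos_densities"
  shows "energy m \<phi> = source \<phi> + 2 * pairing (force m \<phi>) m"
proof -
  have m0: "\<And>x. 0 < m x" using m by (auto simp: pos_densities_def)
  then show ?thesis
    unfolding energy_def pairing_force weight_def edge_mean_def
    by (simp add: log_mean_euler m0)
qed

text \<open>The inequality that drives both directions. Its right-hand side may be any competitor, while
  \<open>m\<close> and \<open>\<phi>\<close> are free; equality holds if \<open>n = m\<close> and the competitor is the one generated by \<open>\<phi>\<close>.\<close>

lemma cost_ge_dual:
  assumes "m \<in> pos_densities" "n \<in> nonneg_densities"
  shows "2 * pairing \<phi> (flow n \<eta> k) - 2 * pairing (force m \<phi>) n - source \<phi> \<le> cost n \<eta> k"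
  using cost_ge_energy_dual[OF assms(2), of \<phi> \<eta> k] energy_le_tangent[OF assms, of \<phi>] by linarith

lemma source_nonneg: "0 \<le> source \<phi>"
  by (simp add: source_def)

lemma energy_nonneg: "n \<in> nonneg_densities \<Longrightarrow> 0 \<le> energy n \<phi>"
  unfolding energy_def by (intro add_nonneg_nonneg source_nonneg divide_nonneg_nonneg sum_nonneg mult_nonneg_nonneg weight_nonneg) auto

lemma cost_weight: "cost n \<eta> k = a\<^sup>2 * k\<^sup>2 + b\<^sup>2 * (1 / 2 * (\<Sum>x\<in>UNIV. \<Sum>y\<in>UNIV. (\<eta> y - \<eta> x)\<^sup>2 * weight n x y))"
  by (simp add: cost_def weight_def mult.assoc)

lemma cost_nonneg: "n \<in> nonneg_densities \<Longrightarrow> 0 \<le> cost n \<eta> k"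
  unfolding cost_weight
  by (intro add_nonneg_nonneg mult_nonneg_nonneg sum_nonneg weight_nonneg) auto

text \<open>At zero energy the potential cannot vary along edges, so it is constant by irreducibility, and the source term
  excludes nonzero constants.\<close>

lemma energy_eq_0:
  assumes m: "m \<in> pos_densities" and e: "energy m \<phi> = 0"
  shows "\<phi> x = 0"
proof -
  let ?E = "\<Sum>x\<in>UNIV. \<Sum>y\<in>UNIV. (\<phi> y - \<phi> x)\<^sup>2 * weight m x y"
  have nn: "0 \<le> (\<phi> y - \<phi> x)\<^sup>2 * weight m x y" for x y
    using weight_nonneg[OF pos_densities_nonneg[OF m]] by simp
  then have "0 \<le> ?E" by (intro sum_nonneg) auto
  then have s0: "source \<phi> = 0" and E0: "?E = 0"
    using e source_nonneg[of \<phi>] b_pos unfolding energy_def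
    by (simp_all add: add_nonneg_eq_0_iff)
  have edge: "\<phi> y = \<phi> x" if "0 < K x y" for x y
  proof -
    have "(\<phi> y - \<phi> x)\<^sup>2 * weight m x y = 0"
      using E0 nn by (simp add: sum_nonneg_eq_0_iff sum_nonneg)
    then show ?thesis using weight_pos[OF m that] by simp
  qed
  have c: "\<phi> y = \<phi> x" for y
    by (rule connected_induct[where P = "\<lambda>y. \<phi> y = \<phi> x"]) (use edge in auto)
  have "pairing \<phi> p = (\<Sum>y\<in>UNIV. \<phi> x * (p y * \<pi> y))"
    unfolding pairing_def by (intro sum.cong refl) (metis c mult.assoc)
  also have "\<dots> = \<phi> x * (\<Sum>y\<in>UNIV. p y * \<pi> y)" by (rule sum_distrib_left[symmetric])
  finally have "pairing \<phi> p = \<phi> x" using p_mass by simp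
  then show ?thesis using s0 a_pos by (simp add: source_def)
qed

lemma source_scale: "source (\<lambda>x. c * \<phi> x) = c\<^sup>2 * source \<phi>"
proof -
  have "pairing (\<lambda>x. c * \<phi> x) p = c * pairing \<phi> p"
    by (simp add: pairing_def sum_distrib_left mult.assoc)
  then show ?thesis by (simp add: source_def power_mult_distrib)
qed

lemma force_scale: "force m (\<lambda>x. c * \<phi> x) x = c\<^sup>2 * force m \<phi> x"
  by (simp add: force_def sum_distrib_left right_diff_distrib[symmetric] power_mult_distrib mult.assoc)

lemma energy_scale: "energy m (\<lambda>x. c * \<phi> x) = c\<^sup>2 * energy m \<phi>"
  by (simp add: energy_def source_scale sum_distrib_left right_diff_distrib[symmetric] power_mult_distrib mult.assoc distrib_left)

lemma vel_scale: "vel m (\<lambda>x. c * \<phi> x) x = c * vel m \<phi> x"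
proof -
  have "pairing (\<lambda>x. c * \<phi> x) p = c * pairing \<phi> p"
    by (simp add: pairing_def sum_distrib_left mult.assoc)
  moreover have "(\<Sum>y\<in>UNIV. (c * \<phi> y - c * \<phi> x) * edge_mean m x y * K x y) = c * (\<Sum>y\<in>UNIV. (\<phi> y - \<phi> x) * edge_mean m x y * K x y)"
    by (simp add: sum_distrib_left right_diff_distrib[symmetric] mult.assoc)
  ultimately show ?thesis by (simp add: vel_def right_diff_distrib)
qed

section \<open>Recovering the potential from the velocity\<close>

definition vel_matrix :: "('x \<Rightarrow> real) \<Rightarrow> real ^ 'x ^ 'x" where
  "vel_matrix m = (\<chi> i j. p i * (p j * \<pi> j) / a\<^sup>2 - edge_mean m i j * K i j / b\<^sup>2
      + (if j = i then (\<Sum>y\<in>UNIV. edge_mean m i y * K i y) / b\<^sup>2 else 0))"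

lemma vel_matrix_mult: "(vel_matrix m *v (\<chi> j. \<phi> j)) $ i = vel m \<phi> i"
proof -
  have entry: "vel_matrix m $ i $ j * \<phi> j = p i * (p j * \<pi> j) / a\<^sup>2 * \<phi> j - edge_mean m i j * K i j / b\<^sup>2 * \<phi> j
      + (if j = i then (\<Sum>y\<in>UNIV. edge_mean m i y * K i y) / b\<^sup>2 * \<phi> j else 0)" for j
    by (cases "j = i") (simp_all add: vel_matrix_def algebra_simps)
  have "(vel_matrix m *v (\<chi> j. \<phi> j)) $ i =
      (\<Sum>j\<in>UNIV. p i * (p j * \<pi> j) / a\<^sup>2 * \<phi> j) - (\<Sum>j\<in>UNIV. edge_mean m i j * K i j / b\<^sup>2 * \<phi> j)
      + (\<Sum>j\<in>UNIV. (if j = i then (\<Sum>y\<in>UNIV. edge_mean m i y * K i y) / b\<^sup>2 * \<phi> j else 0))"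
    by (simp only: matrix_vector_mult_def vec_lambda_beta entry sum.distrib sum_subtractf)
  also have "(\<Sum>j\<in>UNIV. (if j = i then (\<Sum>y\<in>UNIV. edge_mean m i y * K i y) / b\<^sup>2 * \<phi> j else 0))
      = (\<Sum>y\<in>UNIV. edge_mean m i y * K i y) / b\<^sup>2 * \<phi> i"
    by simp
  also have "(\<Sum>j\<in>UNIV. p i * (p j * \<pi> j) / a\<^sup>2 * \<phi> j) = pairing \<phi> p / a\<^sup>2 * p i"
    by (simp add: pairing_def sum_distrib_right sum_distrib_left sum_divide_distrib mult_ac)
  also have "pairing \<phi> p / a\<^sup>2 * p i - (\<Sum>j\<in>UNIV. edge_mean m i j * K i j / b\<^sup>2 * \<phi> j) + (\<Sum>y\<in>UNIV. edge_mean m i y * K i y) / b\<^sup>2 * \<phi> i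
      = vel m \<phi> i"
  proof -
    have "(\<Sum>y\<in>UNIV. (\<phi> y - \<phi> i) * edge_mean m i y * K i y)
        = (\<Sum>y\<in>UNIV. edge_mean m i y * K i y * \<phi> y) - (\<Sum>y\<in>UNIV. edge_mean m i y * K i y) * \<phi> i"
      by (simp add: sum_distrib_right sum_distrib_left sum_subtractf algebra_simps)
    then show ?thesis
      by (simp add: vel_def diff_divide_distrib sum_divide_distrib[symmetric])
  qed
  finally show ?thesis .
qed

text \<open>The inverse of \<open>vel m\<close> by Cramer's rule. The explicit formula makes it continuous and measurable
  in both arguments.\<close>

definition sol :: "('x \<Rightarrow> real) \<Rightarrow> ('x \<Rightarrow> real) \<Rightarrow> 'x \<Rightarrow> real" where
  "sol m \<rho> k = det ((\<chi> i j. if j = k then \<rho> i else vel_matrix m $ i $ j) :: real ^ 'x ^ 'x) / det (vel_matrix m)"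

lemma det_vel_matrix_nonzero:
  assumes m: "m \<in> pos_densities"
  shows "det (vel_matrix m) \<noteq> 0"
proof -
  have "z = 0" if z: "vel_matrix m *v z = 0" for z
  proof -
    have "vel m (\<lambda>j. z $ j) i = 0" for i
      using vel_matrix_mult[of m "\<lambda>j. z $ j" i] z by simp
    then have "energy m (\<lambda>j. z $ j) = 0"
      using pairing_vel_self[OF pos_densities_nonneg[OF m], of "\<lambda>j. z $ j"] by (simp add: pairing_def)
    from energy_eq_0[OF m this] show "z = 0" by (simp add: vec_eq_iff)
  qed
  then have "\<exists>B. B ** vel_matrix m = mat 1"
    by (subst matrix_left_invertible_ker) blast
  then show ?thesis
    by (simp add: invertible_left_inverse[symmetric] invertible_det_nz)
qed

lemma vel_eq_iff_sol:
  assumes m: "m \<in> pos_densities"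
  shows "vel m \<phi> = \<rho> \<longleftrightarrow> \<phi> = sol m \<rho>"
proof -
  have "vel m \<phi> = \<rho> \<longleftrightarrow> vel_matrix m *v (\<chi> j. \<phi> j) = (\<chi> i. \<rho> i)"
    by (simp add: vec_eq_iff vel_matrix_mult fun_eq_iff)
  also have "\<dots> \<longleftrightarrow> (\<chi> j. \<phi> j) = (\<chi> k. det ((\<chi> i j. if j = k then (\<chi> i. \<rho> i) $ i else vel_matrix m $ i $ j) :: real ^ 'x ^ 'x) / det (vel_matrix m))"
    by (rule cramer[OF det_vel_matrix_nonzero[OF m]])
  also have "\<dots> \<longleftrightarrow> \<phi> = sol m \<rho>"
    by (simp add: vec_eq_iff fun_eq_iff sol_def cong: if_cong)
  finally show ?thesis .
qed

lemma vel_sol: "m \<in> pos_densities \<Longrightarrow> vel m (sol m \<rho>) = \<rho>"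
  by (simp add: vel_eq_iff_sol)

lemma tendsto_sol:
  assumes mpos: "m0 \<in> pos_densities"
    and m: "\<And>x. ((\<lambda>s. m s x) \<longlongrightarrow> m0 x) F" and \<rho>: "\<And>x. ((\<lambda>s. \<rho> s x) \<longlongrightarrow> \<rho>0 x) F"
  shows "((\<lambda>s. sol (m s) (\<rho> s) k) \<longlongrightarrow> sol m0 \<rho>0 k) F"
proof -
  have pos: "0 < m0 x" for x using mpos by (simp add: pos_densities_def)
  have edge: "((\<lambda>s. edge_mean (m s) x y) \<longlongrightarrow> edge_mean m0 x y) F" for x y
  proof -
    have "\<forall>\<^sub>F s in F. 0 < m s z" for z
      using order_tendstoD(1)[OF m pos] .
    then have "\<forall>\<^sub>F s in F. d1_mean (m s x) (m s y) * m s x + d1_mean (m s y) (m s x) * m s y = edge_mean (m s) x y"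
      using eventually_conj[of "\<lambda>s. 0 < m s x" F "\<lambda>s. 0 < m s y"]
      by (auto elim!: eventually_mono simp: edge_mean_def log_mean_euler)
    moreover have "((\<lambda>s. d1_mean (m s x) (m s y) * m s x + d1_mean (m s y) (m s x) * m s y) \<longlongrightarrow>
       d1_mean (m0 x) (m0 y) * m0 x + d1_mean (m0 y) (m0 x) * m0 y) F"
      by (intro tendsto_intros d1_mean_tendsto m pos)
    ultimately show ?thesis
      using tendsto_cong by (fastforce simp: edge_mean_def log_mean_euler pos)
  qed
  have A: "((\<lambda>s. vel_matrix (m s) $ i $ j) \<longlongrightarrow> vel_matrix m0 $ i $ j) F" for i j
    unfolding vel_matrix_def by (cases "j = i") (use a_pos b_pos in \<open>auto intro!: tendsto_intros edge\<close>)
  have B: "((\<lambda>s. if c then \<rho> s i else vel_matrix (m s) $ i $ j) \<longlongrightarrow> (if c then \<rho>0 i else vel_matrix m0 $ i $ j)) F" for c i j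
    using A \<rho> by (cases c) auto
  show ?thesis
    unfolding sol_def det_def
    using det_vel_matrix_nonzero[OF mpos]
    by (intro tendsto_divide tendsto_sum tendsto_mult tendsto_const tendsto_prod)
      (auto intro: A B \<rho> simp: det_def)
qed

lemma continuous_on_sol:
  assumes "\<And>s. s \<in> S \<Longrightarrow> m s \<in> pos_densities"
    and "\<And>x. continuous_on S (\<lambda>s. m s x)" "\<And>x. continuous_on S (\<lambda>s. \<rho> s x)"
  shows "continuous_on S (\<lambda>s. sol (m s) (\<rho> s) k)"
  using assms unfolding continuous_on_def by (auto intro!: tendsto_sol)

lemma measurable_sol:
  assumes "\<And>s. s \<in> space M \<Longrightarrow> m s \<in> nonneg_densities"
    and [measurable]: "\<And>x. (\<lambda>s. m s x) \<in> borel_measurable M" "\<And>x. (\<lambda>s. \<rho> s x) \<in> borel_measurable M"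
  shows "(\<lambda>s. sol (m s) (\<rho> s) k) \<in> borel_measurable M"
proof -
  have [measurable]: "(\<lambda>s. edge_mean (m s) x y) \<in> borel_measurable M" for x y
    unfolding edge_mean_def by (rule measurable_log_mean) (use assms in \<open>auto simp: nonneg_densities_def\<close>)
  have A [measurable]: "(\<lambda>s. vel_matrix (m s) $ i $ j) \<in> borel_measurable M" for i j
    unfolding vel_matrix_def by (cases "j = i") auto
  have B [measurable]: "(\<lambda>s. if c then \<rho> s i else vel_matrix (m s) $ i $ j) \<in> borel_measurable M" for c i j
    by (cases c) auto
  show ?thesis
    unfolding sol_def det_def by (auto intro!: borel_measurable_divide borel_measurable_sum borel_measurable_times borel_measurable_prod)
qed

text \<open>A continuous function on a compact set of densities and velocities. The domain is coded with vectors,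
  whose boxes are known to be compact.\<close>

lemma sol_bounded:
  assumes "0 < lo"
  obtains B where "\<And>m \<rho> k. (\<And>x. lo \<le> m x \<and> m x \<le> hi) \<Longrightarrow> (\<And>x. \<bar>\<rho> x\<bar> \<le> R) \<Longrightarrow> \<bar>sol m \<rho> k\<bar> \<le> B"
proof -
  let ?S = "cbox (\<chi> i::'x. lo) (\<chi> i. hi) \<times> cbox (\<chi> i::'x. - R) (\<chi> i. R)"
  have S: "z \<in> ?S \<longleftrightarrow> (\<forall>x. lo \<le> fst z $ x \<and> fst z $ x \<le> hi) \<and> (\<forall>x. \<bar>snd z $ x\<bar> \<le> R)" for z
    by (auto simp: mem_Times_iff mem_box_cart abs_le_iff) (metis minus_le_iff)+
  have "\<exists>B. \<forall>z\<in>?S. \<bar>sol (\<lambda>x. fst z $ x) (\<lambda>x. snd z $ x) k\<bar> \<le> B" for k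
  proof -
    have "continuous_on ?S (\<lambda>z. sol (\<lambda>x. fst z $ x) (\<lambda>x. snd z $ x) k)"
    proof (rule continuous_on_sol)
      show "(\<lambda>x. fst z $ x) \<in> pos_densities" if "z \<in> ?S" for z
        using that assms unfolding S pos_densities_def by (auto intro: less_le_trans)
    qed (intro continuous_intros)+
    then have "bounded ((\<lambda>z. sol (\<lambda>x. fst z $ x) (\<lambda>x. snd z $ x) k) ` ?S)"
      by (intro compact_imp_bounded compact_continuous_image compact_Times compact_cbox)
    then show ?thesis unfolding bounded_iff by auto
  qed
  then obtain B where B: "\<And>k z. z \<in> ?S \<Longrightarrow> \<bar>sol (\<lambda>x. fst z $ x) (\<lambda>x. snd z $ x) k\<bar> \<le> B k" by metis
  show thesis
  proof (rule that[of "Max (range B)"])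
    fix m \<rho> :: "'x \<Rightarrow> real" and k
    assume "\<And>x. lo \<le> m x \<and> m x \<le> hi" "\<And>x. \<bar>\<rho> x\<bar> \<le> R"
    then have "((\<chi> x. m x), (\<chi> x. \<rho> x)) \<in> ?S" unfolding S by simp
    from B[OF this, of k] have "\<bar>sol m \<rho> k\<bar> \<le> B k" by simp
    also have "B k \<le> Max (range B)" by (rule Max_ge) auto
    finally show "\<bar>sol m \<rho> k\<bar> \<le> Max (range B)" .
  qed
qed

section \<open>Continuity, measurability and bounds\<close>

lemma tendsto_force:
  assumes "m0 \<in> pos_densities" "\<And>x. ((\<lambda>s. m s x) \<longlongrightarrow> m0 x) F" "\<And>x. ((\<lambda>s. \<phi> s x) \<longlongrightarrow> \<phi>0 x) F"
  shows "((\<lambda>s. force (m s) (\<phi> s) x) \<longlongrightarrow> force m0 \<phi>0 x) F"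
  unfolding force_def using b_pos assms(1)
  by (intro tendsto_intros d1_mean_tendsto assms) (auto simp: pos_densities_def)

lemma continuous_on_force:
  assumes "\<And>s. s \<in> S \<Longrightarrow> m s \<in> pos_densities"
    and "\<And>x. continuous_on S (\<lambda>s. m s x)" "\<And>x. continuous_on S (\<lambda>s. \<phi> s x)"
  shows "continuous_on S (\<lambda>s. force (m s) (\<phi> s) x)"
  using assms unfolding continuous_on_def by (auto intro!: tendsto_force)

lemma continuous_on_edge_mean:
  assumes "\<And>s. s \<in> S \<Longrightarrow> m s \<in> pos_densities" and "\<And>x. continuous_on S (\<lambda>s. m s x)"
  shows "continuous_on S (\<lambda>s. edge_mean (m s) x y)"
  unfolding edge_mean_def by (rule continuous_on_log_mean') (use assms in \<open>auto simp: pos_densities_def\<close>)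

lemma continuous_on_vel:
  assumes "\<And>s. s \<in> S \<Longrightarrow> m s \<in> pos_densities"
    and "\<And>x. continuous_on S (\<lambda>s. m s x)" "\<And>x. continuous_on S (\<lambda>s. \<phi> s x)"
  shows "continuous_on S (\<lambda>s. vel (m s) (\<phi> s) x)"
  unfolding vel_def pairing_def using a_pos b_pos
  by (intro continuous_intros continuous_on_edge_mean assms) auto

lemma continuous_on_source:
  assumes "\<And>x. continuous_on S (\<lambda>s. \<phi> s x)"
  shows "continuous_on S (\<lambda>s. source (\<phi> s))"
  unfolding source_def pairing_def using a_pos by (intro continuous_intros assms) auto

lemma continuous_on_energy:
  assumes "\<And>s. s \<in> S \<Longrightarrow> m s \<in> pos_densities"
    and "\<And>x. continuous_on S (\<lambda>s. m s x)" "\<And>x. continuous_on S (\<lambda>s. \<phi> s x)"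
  shows "continuous_on S (\<lambda>s. energy (m s) (\<phi> s))"
  unfolding energy_def weight_def using b_pos
  by (intro continuous_intros continuous_on_source continuous_on_edge_mean assms) auto

lemma measurable_cost:
  assumes "\<And>s. s \<in> space M \<Longrightarrow> n s \<in> nonneg_densities"
    and [measurable]: "\<And>x. (\<lambda>s. n s x) \<in> borel_measurable M" "\<And>x. (\<lambda>s. \<eta> s x) \<in> borel_measurable M" "k \<in> borel_measurable M"
  shows "(\<lambda>s. cost (n s) (\<eta> s) (k s)) \<in> borel_measurable M"
proof -
  have [measurable]: "(\<lambda>s. edge_mean (n s) x y) \<in> borel_measurable M" for x y
    unfolding edge_mean_def by (rule measurable_log_mean) (use assms in \<open>auto simp: nonneg_densities_def\<close>)
  show ?thesis unfolding cost_def by measurable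
qed

lemma measurable_vel:
  assumes pos: "\<And>t. t \<in> {0..1} \<Longrightarrow> m t \<in> pos_densities" and cont: "\<And>x. continuous_on {0..1} (\<lambda>t. m t x)"
    and [measurable]: "\<And>x. (\<lambda>t. \<phi> t x) \<in> borel_measurable I01"
  shows "(\<lambda>t. vel (m t) (\<phi> t) x) \<in> borel_measurable I01"
proof -
  have [measurable]: "(\<lambda>t. edge_mean (m t) x y) \<in> borel_measurable I01" for y
    by (intro continuous_imp_measurable_I01 continuous_on_edge_mean pos cont)
  show ?thesis unfolding vel_def pairing_def by measurable
qed

lemma measurable_force:
  assumes pos: "\<And>t. t \<in> {0..1} \<Longrightarrow> m t \<in> pos_densities" and cont: "\<And>x. continuous_on {0..1} (\<lambda>t. m t x)"
    and [measurable]: "\<And>x. (\<lambda>t. \<phi> t x) \<in> borel_measurable I01"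
  shows "(\<lambda>t. force (m t) (\<phi> t) x) \<in> borel_measurable I01"
proof -
  have [measurable]: "(\<lambda>t. d1_mean (m t x) (m t y)) \<in> borel_measurable I01" for y
    using pos by (intro continuous_imp_measurable_I01 continuous_on_d1_mean' cont) (auto simp: pos_densities_def)
  show ?thesis unfolding force_def by measurable
qed

lemma curve_range:
  fixes \<mu> :: "real \<Rightarrow> 'x \<Rightarrow> real"
  assumes pos: "\<And>t. t \<in> {0..1} \<Longrightarrow> \<mu> t \<in> pos_densities" and cont: "\<And>x. continuous_on {0..1} (\<lambda>t. \<mu> t x)"
  obtains lo hi where "0 < lo" "\<And>t x. t \<in> {0..1} \<Longrightarrow> lo \<le> \<mu> t x \<and> \<mu> t x \<le> hi"
proof -
  have "\<exists>t0\<in>{0..1::real}. \<forall>t\<in>{0..1}. \<mu> t0 x \<le> \<mu> t x" for x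
    using cont by (intro continuous_attains_inf) auto
  then obtain t0 where t0: "\<And>x. t0 x \<in> {0..1}" "\<And>x t. t \<in> {0..1} \<Longrightarrow> \<mu> (t0 x) x \<le> \<mu> t x" by metis
  have "\<exists>t1\<in>{0..1::real}. \<forall>t\<in>{0..1}. \<mu> t x \<le> \<mu> t1 x" for x
    using cont by (intro continuous_attains_sup) auto
  then obtain t1 where t1: "\<And>x t. t \<in> {0..1} \<Longrightarrow> \<mu> t x \<le> \<mu> (t1 x) x" by metis
  show thesis
  proof (rule that)
    have "0 < \<mu> (t0 x) x" for x using pos[OF t0(1)] by (simp add: pos_densities_def)
    then show "0 < Min (range (\<lambda>x. \<mu> (t0 x) x))" by (subst Min_gr_iff) auto
    fix t x assume t: "t \<in> {0..1::real}"
    have "Min (range (\<lambda>x. \<mu> (t0 x) x)) \<le> \<mu> (t0 x) x" by (rule Min_le) auto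
    moreover have "\<mu> (t1 x) x \<le> Max (range (\<lambda>x. \<mu> (t1 x) x))" by (rule Max_ge) auto
    ultimately show "Min (range (\<lambda>x. \<mu> (t0 x) x)) \<le> \<mu> t x \<and> \<mu> t x \<le> Max (range (\<lambda>x. \<mu> (t1 x) x))"
      using t0(2)[OF t, of x] t1[OF t, of x] by linarith
  qed
qed

text \<open>Bounded energy bounds each component of the velocity, by pairing it with a unit vector, and then the
  potential, because the inverse of \<open>vel\<close> is bounded over a compact range of positive densities.\<close>

lemma potential_bounded:
  fixes \<mu> :: "real \<Rightarrow> 'x \<Rightarrow> real"
  assumes pos: "\<And>t. t \<in> {0..1} \<Longrightarrow> \<mu> t \<in> pos_densities" and cont: "\<And>x. continuous_on {0..1} (\<lambda>t. \<mu> t x)"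
  obtains R B where "\<And>t \<phi> x. t \<in> {0..1} \<Longrightarrow> energy (\<mu> t) \<phi> \<le> E \<Longrightarrow> \<bar>vel (\<mu> t) \<phi> x\<bar> \<le> R"
    and "\<And>t \<phi> x. t \<in> {0..1} \<Longrightarrow> energy (\<mu> t) \<phi> \<le> E \<Longrightarrow> \<bar>\<phi> x\<bar> \<le> B"
proof -
  obtain lo hi where lo: "0 < lo" and range: "\<And>t x. t \<in> {0..1} \<Longrightarrow> lo \<le> \<mu> t x \<and> \<mu> t x \<le> hi"
    using curve_range[OF pos cont] by blast
  define unit where "unit x = (\<lambda>y. if y = x then 1 else 0 :: real)" for x :: 'x
  have "\<exists>A. \<forall>t\<in>{0..1}. energy (\<mu> t) (unit x) \<le> A" for x
  proof -
    have ce: "continuous_on {0..1} (\<lambda>t. energy (\<mu> t) (unit x))"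
      by (rule continuous_on_energy[OF pos cont continuous_on_const])
    obtain A where A: "\<And>t. t \<in> {0..1} \<Longrightarrow> \<bar>energy (\<mu> t) (unit x)\<bar> \<le> A"
      by (rule continuous_on_Icc_bounded[OF ce], rule that)
    show ?thesis by (intro exI[of _ A] ballI abs_le_D1[OF A])
  qed
  then obtain A where A: "\<And>x t. t \<in> {0..1} \<Longrightarrow> energy (\<mu> t) (unit x) \<le> A x" by metis
  define R where "R = Max (range (\<lambda>x. (A x + E) / (2 * \<pi> x)))"
  have v: "\<bar>vel (\<mu> t) \<phi> x\<bar> \<le> R" if t: "t \<in> {0..1}" and e: "energy (\<mu> t) \<phi> \<le> E" for t \<phi> x
  proof -
    have nn: "\<mu> t \<in> nonneg_densities" by (rule pos_densities_nonneg[OF pos[OF t]])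
    have u: "pairing (unit x) g = g x * \<pi> x" for g
      unfolding pairing_def unit_def by (simp add: if_distrib if_distribR cong: if_cong)
    have 1: "2 * (vel (\<mu> t) \<phi> x * \<pi> x) \<le> A x + E"
      using pairing_vel_le_energy[OF nn, of "unit x" \<phi>] A[OF t, of x] e unfolding u by linarith
    have 2: "- (2 * (vel (\<mu> t) \<phi> x * \<pi> x)) \<le> A x + E"
      using pairing_vel_le_energy[OF nn, of "\<lambda>y. - 1 * unit x y" \<phi>] A[OF t, of x] e
      unfolding pairing_scale_left energy_scale u by simp
    have "\<bar>vel (\<mu> t) \<phi> x\<bar> * (2 * \<pi> x) = \<bar>2 * (vel (\<mu> t) \<phi> x * \<pi> x)\<bar>"
      using \<pi>_pos[of x] by (simp add: abs_mult)
    also have "\<dots> \<le> A x + E" using 1 2 by linarith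
    finally have "\<bar>vel (\<mu> t) \<phi> x\<bar> \<le> (A x + E) / (2 * \<pi> x)"
      using \<pi>_pos[of x] by (simp add: pos_le_divide_eq)
    also have "\<dots> \<le> R" unfolding R_def by (rule Max_ge) auto
    finally show ?thesis .
  qed
  obtain B where B: "\<And>m \<rho> k. (\<And>x. lo \<le> m x \<and> m x \<le> hi) \<Longrightarrow> (\<And>x. \<bar>\<rho> x\<bar> \<le> R) \<Longrightarrow> \<bar>sol m \<rho> k\<bar> \<le> B"
    using sol_bounded[OF lo] by blast
  show thesis
  proof (rule that[OF v])
    fix t \<phi> x assume t: "t \<in> {0..1::real}" and e: "energy (\<mu> t) \<phi> \<le> E"
    have "\<phi> = sol (\<mu> t) (vel (\<mu> t) \<phi>)" using vel_eq_iff_sol[OF pos[OF t]] by blast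
    moreover have "\<bar>sol (\<mu> t) (vel (\<mu> t) \<phi>) x\<bar> \<le> B" by (rule B) (use range[OF t] v[OF t e] in auto)
    ultimately show "\<bar>\<phi> x\<bar> \<le> B" by simp
  qed auto
qed

lemma force_bounded:
  assumes lo: "0 < lo"
  obtains M where "\<And>m \<phi> x. (\<And>y. lo \<le> m y \<and> m y \<le> hi) \<Longrightarrow> (\<And>y. \<bar>\<phi> y\<bar> \<le> B) \<Longrightarrow> \<bar>force m \<phi> x\<bar> \<le> M"
proof -
  have "compact ((\<lambda>z. d1_mean (fst z) (snd z)) ` ({lo..hi} \<times> {lo..hi}))"
    by (intro compact_continuous_image continuous_on_subset[OF continuous_on_d1_mean] compact_Times compact_Icc)
      (use lo in auto)
  from compact_imp_bounded[OF this] obtain D where D: "\<forall>z\<in>{lo..hi} \<times> {lo..hi}. \<bar>d1_mean (fst z) (snd z)\<bar> \<le> D"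
    unfolding bounded_iff by auto
  show thesis
  proof (rule that[of "(2 * B)\<^sup>2 * D / (2 * b\<^sup>2)"])
    fix m \<phi> :: "'x \<Rightarrow> real" and x
    assume m: "\<And>y. lo \<le> m y \<and> m y \<le> hi" and \<phi>: "\<And>y. \<bar>\<phi> y\<bar> \<le> B"
    have d: "0 \<le> d1_mean (m x) (m y)" "d1_mean (m x) (m y) \<le> D" for y
    proof -
      show "0 \<le> d1_mean (m x) (m y)"
        using lo m[of x] m[of y] by (intro d1_mean_nonneg) linarith+
      show "d1_mean (m x) (m y) \<le> D" using bspec[OF D, of "(m x, m y)"] m by simp
    qed
    have sq: "(\<phi> y - \<phi> x)\<^sup>2 \<le> (2 * B)\<^sup>2" for y
      using \<phi>[of x] \<phi>[of y] by (intro abs_le_square_iff[THEN iffD1]) linarith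
    have "0 \<le> force m \<phi> x"
      unfolding force_def by (intro divide_nonneg_nonneg sum_nonneg mult_nonneg_nonneg d K_nonneg) auto
    moreover have "force m \<phi> x \<le> (\<Sum>y\<in>UNIV. (2 * B)\<^sup>2 * D * K x y) / (2 * b\<^sup>2)"
      unfolding force_def by (intro divide_right_mono sum_mono mult_right_mono mult_mono sq d K_nonneg) auto
    moreover have "(\<Sum>y\<in>UNIV. (2 * B)\<^sup>2 * D * K x y) = (2 * B)\<^sup>2 * D"
      using kernel unfolding sum_distrib_left[symmetric] by (simp add: markov_kernel_def)
    ultimately show "\<bar>force m \<phi> x\<bar> \<le> (2 * B)\<^sup>2 * D / (2 * b\<^sup>2)" by simp
  qed
qed

section \<open>The transport distance and its dual bound\<close>

abbreviation "W \<equiv> transport_dist K \<pi> p a b"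

lemma admissibleD:
  assumes "admissible K p \<nu>0 \<nu>1 \<nu> \<eta> k"
  shows "t \<in> {0..1} \<Longrightarrow> \<nu> t \<in> nonneg_densities"
    and "abs_continuous_on_interval 0 1 (\<lambda>t. \<nu> t x)" "continuous_on {0..1} (\<lambda>t. \<nu> t x)"
    and "\<nu> 0 = \<nu>0" "\<nu> 1 = \<nu>1"
    and "(\<lambda>t. \<eta> t x) \<in> borel_measurable I01" "k \<in> borel_measurable I01"
    and "AE t in I01. \<forall>x. ((\<lambda>s. \<nu> s x) has_real_derivative flow (\<nu> t) (\<eta> t) (k t) x) (at t within {0..1})"
proof -
  show *: "abs_continuous_on_interval 0 1 (\<lambda>t. \<nu> t x)" for x
    using assms by (simp add: admissible_def abs_continuous_curve_def)
  show "continuous_on {0..1} (\<lambda>t. \<nu> t x)"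
    using abs_continuous_on_interval_imp_continuous_on[OF *] .
  have "AE t in I01. \<forall>x. \<exists>\<mu>'. ((\<lambda>s. \<nu> s x) has_real_derivative \<mu>') (at t within {0..1}) \<and>
        \<mu>' + (\<Sum>y\<in>UNIV. (\<eta> t y - \<eta> t x) * edge_mean (\<nu> t) x y * K x y) = k t * p x"
    using assms by (simp add: admissible_def)
  then show "AE t in I01. \<forall>x. ((\<lambda>s. \<nu> s x) has_real_derivative flow (\<nu> t) (\<eta> t) (k t) x) (at t within {0..1})"
  proof eventually_elim
    case (elim t)
    show ?case
    proof
      fix x
      obtain \<mu>' where "((\<lambda>s. \<nu> s x) has_real_derivative \<mu>') (at t within {0..1})"
        "\<mu>' + (\<Sum>y\<in>UNIV. (\<eta> t y - \<eta> t x) * edge_mean (\<nu> t) x y * K x y) = k t * p x"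
        using elim by blast
      moreover then have "\<mu>' = flow (\<nu> t) (\<eta> t) (k t) x" by (simp add: flow_def)
      ultimately show "((\<lambda>s. \<nu> s x) has_real_derivative flow (\<nu> t) (\<eta> t) (k t) x) (at t within {0..1})"
        by simp
    qed
  qed
qed (use assms in \<open>auto simp: admissible_def\<close>)

lemma admissibleI:
  assumes "\<And>t. t \<in> {0..1} \<Longrightarrow> \<nu> t \<in> nonneg_densities"
    and "\<And>x. abs_continuous_on_interval 0 1 (\<lambda>t. \<nu> t x)"
    and "\<nu> 0 = \<nu>0" "\<nu> 1 = \<nu>1"
    and "\<And>x. (\<lambda>t. \<eta> t x) \<in> borel_measurable I01" "k \<in> borel_measurable I01"
    and "AE t in I01. \<forall>x. ((\<lambda>s. \<nu> s x) has_real_derivative flow (\<nu> t) (\<eta> t) (k t) x) (at t within {0..1})"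
  shows "admissible K p \<nu>0 \<nu>1 \<nu> \<eta> k"
  unfolding admissible_def abs_continuous_curve_def
proof (intro conjI allI ballI)
  show "AE t in I01. \<forall>x. \<exists>\<mu>'. ((\<lambda>s. \<nu> s x) has_real_derivative \<mu>') (at t within {0..1}) \<and>
        \<mu>' + (\<Sum>y\<in>UNIV. (\<eta> t y - \<eta> t x) * edge_mean (\<nu> t) x y * K x y) = k t * p x"
    using assms(7) by eventually_elim (auto simp: flow_def)
qed (use assms in auto)

lemma action_eq_cost:
  assumes "\<And>t. t \<in> {0..1} \<Longrightarrow> \<nu> t \<in> nonneg_densities" "\<And>x. (\<lambda>t. \<nu> t x) \<in> borel_measurable I01"
    and [measurable]: "\<And>x. (\<lambda>t. \<eta> t x) \<in> borel_measurable I01" "k \<in> borel_measurable I01"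
  shows "action K \<pi> a b \<nu> \<eta> k = (\<integral>\<^sup>+ t. ennreal (cost (\<nu> t) (\<eta> t) (k t)) \<partial>I01)"
proof -
  let ?E = "\<lambda>t. 1 / 2 * (\<Sum>x\<in>UNIV. \<Sum>y\<in>UNIV. (\<eta> t y - \<eta> t x)\<^sup>2 * edge_mean (\<nu> t) x y * K x y * \<pi> x)"
  have [measurable]: "(\<lambda>s. edge_mean (\<nu> s) x y) \<in> borel_measurable I01" for x y
    unfolding edge_mean_def by (rule measurable_log_mean) (use assms in \<open>auto simp: nonneg_densities_def\<close>)
  have [measurable]: "?E \<in> borel_measurable I01" by measurable
  have E: "0 \<le> ?E t" if "t \<in> {0..1}" for t
  proof -
    have "0 \<le> (\<Sum>x\<in>UNIV. \<Sum>y\<in>UNIV. (\<eta> t y - \<eta> t x)\<^sup>2 * weight (\<nu> t) x y)"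
      using weight_nonneg[OF assms(1)[OF that]] by (intro sum_nonneg mult_nonneg_nonneg) auto
    then show ?thesis by (simp add: weight_def mult.assoc)
  qed
  have "action K \<pi> a b \<nu> \<eta> k = (\<integral>\<^sup>+ t. ennreal (a\<^sup>2) * ennreal ((k t)\<^sup>2) + ennreal (b\<^sup>2) * ennreal (?E t) \<partial>I01)"
    unfolding action_def by (subst nn_integral_add) (auto simp: nn_integral_cmult)
  also have "\<dots> = (\<integral>\<^sup>+ t. ennreal (cost (\<nu> t) (\<eta> t) (k t)) \<partial>I01)"
  proof (rule nn_integral_cong)
    fix t assume "t \<in> space I01"
    then have "0 \<le> ?E t" using E by simp
    then show "ennreal (a\<^sup>2) * ennreal ((k t)\<^sup>2) + ennreal (b\<^sup>2) * ennreal (?E t) = ennreal (cost (\<nu> t) (\<eta> t) (k t))"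
      unfolding cost_def by (subst (1 2) ennreal_mult[symmetric], simp_all del: ennreal_plus add: ennreal_plus[symmetric])
  qed
  finally show ?thesis .
qed

lemma dist_sq: "(W \<nu>0 \<nu>1)\<^sup>2 = enn2real (INF (\<nu>, \<eta>, k) \<in> {(\<nu>, \<eta>, k). admissible K p \<nu>0 \<nu>1 \<nu> \<eta> k}. action K \<pi> a b \<nu> \<eta> k)"
  by (simp add: transport_dist_def)

lemma dist_nonneg: "0 \<le> W \<nu>0 \<nu>1"
  by (simp add: transport_dist_def)

lemma dist_le_action:
  assumes "admissible K p \<nu>0 \<nu>1 \<nu> \<eta> k" "action K \<pi> a b \<nu> \<eta> k \<le> ennreal c" "0 \<le> c"
  shows "(W \<nu>0 \<nu>1)\<^sup>2 \<le> c"
proof -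
  have "(INF (\<nu>, \<eta>, k) \<in> {(\<nu>, \<eta>, k). admissible K p \<nu>0 \<nu>1 \<nu> \<eta> k}. action K \<pi> a b \<nu> \<eta> k) \<le> ennreal c"
    by (rule INF_lower2[of "(\<nu>, \<eta>, k)"]) (use assms in auto)
  from enn2real_mono[OF this] show ?thesis using assms(3) by (simp add: dist_sq)
qed

text \<open>A competitor of finite action has to be supplied: \<open>transport_dist\<close> converts an infinite infimum to
  \<open>0\<close>, and then no positive lower bound could hold.\<close>

lemma dist_ge_action:
  assumes "admissible K p \<nu>0 \<nu>1 \<nu> \<eta> k" "action K \<pi> a b \<nu> \<eta> k < \<infinity>"
    and "\<And>\<nu> \<eta> k. admissible K p \<nu>0 \<nu>1 \<nu> \<eta> k \<Longrightarrow> ennreal c \<le> action K \<pi> a b \<nu> \<eta> k"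
  shows "c \<le> (W \<nu>0 \<nu>1)\<^sup>2"
proof (cases "0 \<le> c")
  case True
  let ?I = "INF (\<nu>, \<eta>, k) \<in> {(\<nu>, \<eta>, k). admissible K p \<nu>0 \<nu>1 \<nu> \<eta> k}. action K \<pi> a b \<nu> \<eta> k"
  have "?I \<le> action K \<pi> a b \<nu> \<eta> k"
    by (rule INF_lower2[of "(\<nu>, \<eta>, k)"]) (use assms in auto)
  then have "?I < top" using assms(2) by (simp add: le_less_trans)
  moreover have "ennreal c \<le> ?I"
    by (rule INF_greatest) (use assms(3) in auto)
  ultimately have "enn2real (ennreal c) \<le> enn2real ?I" by (intro enn2real_mono)
  then show ?thesis using True by (simp add: dist_sq)
next
  case False
  then show ?thesis by (meson linear order_trans zero_le_power2)
qed

text \<open>Weak duality. The function \<open>\<langle>\<Phi>, \<nu>\<rangle>\<close> is absolutely continuous, and by \<open>cost_ge_dual\<close> twice its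
  derivative minus \<open>f\<close> stays below the action density; \<open>sub\<close> absorbs the term with the force. The
  densities \<open>m\<close> at which tangent planes are taken are a free choice.\<close>

lemma action_ge_dual:
  assumes adm: "admissible K p \<nu>0 \<nu>1 \<nu> \<eta> k"
    and m: "\<And>t. t \<in> {0..1} \<Longrightarrow> m t \<in> pos_densities"
    and \<Phi>: "\<And>t x. t \<in> {0..1} \<Longrightarrow> ((\<lambda>s. \<Phi> s x) has_real_derivative \<Phi>' t x) (at t within {0..1})"
    and \<Phi>'c: "\<And>x. continuous_on {0..1} (\<lambda>t. \<Phi>' t x)"
    and sub: "\<And>t x. t \<in> {0..1} \<Longrightarrow> \<Phi>' t x \<le> - force (m t) (\<Phi> t) x"
    and f: "\<And>t. t \<in> {0..1} \<Longrightarrow> source (\<Phi> t) \<le> f t" and fi: "(f has_integral Q) {0..1}"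
  shows "ennreal (2 * (pairing (\<Phi> 1) \<nu>1 - pairing (\<Phi> 0) \<nu>0) - Q) \<le> action K \<pi> a b \<nu> \<eta> k"
proof -
  note admD = admissibleD[OF adm]
  let ?c = "\<lambda>t. cost (\<nu> t) (\<eta> t) (k t)"
  have c_nonneg: "0 \<le> ?c t" if "t \<in> {0..1}" for t using cost_nonneg admD(1)[OF that] by blast
  have \<nu>_meas: "(\<lambda>t. \<nu> t x) \<in> borel_measurable I01" for x
    using admD(3) by (rule continuous_imp_measurable_I01)
  have act: "action K \<pi> a b \<nu> \<eta> k = (\<integral>\<^sup>+ t. ennreal (?c t) \<partial>I01)"
    using admD(1) \<nu>_meas admD(6,7) by (rule action_eq_cost)
  have c_meas: "?c \<in> borel_measurable I01"
    by (rule measurable_cost) (use admD(1,6,7) \<nu>_meas in auto)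
  show ?thesis
  proof (cases "action K \<pi> a b \<nu> \<eta> k = \<infinity>")
    case False
    then have fin: "(\<integral>\<^sup>+ t. ennreal (?c t) \<partial>I01) < \<infinity>" using act by (simp add: top.not_eq_extremum)
    have cae: "AE t in I01. 0 \<le> ?c t" using c_nonneg by (intro AE_I2) auto
    have ci: "integrable I01 ?c" using c_meas cae fin by (rule integrableI_nonneg)
    have act': "action K \<pi> a b \<nu> \<eta> k = ennreal (LINT t|I01. ?c t)"
      unfolding act using ci cae by (rule nn_integral_eq_integral)
    have chi: "(?c has_integral (LINT t|I01. ?c t)) {0..1}"
      using ci by (rule has_integral_integral_lebesgue_on) auto
    obtain N where N: "negligible N" and
      der: "\<And>t. t \<in> {0..1} - N \<Longrightarrow> \<forall>x. ((\<lambda>s. \<nu> s x) has_real_derivative flow (\<nu> t) (\<eta> t) (k t) x) (at t within {0..1})"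
      using AE_lebesgue_on_negligible[OF admD(8)] by (metis lebesgue_on_UNIV_eq lmeasurable_cbox cbox_interval fmeasurableD)
    define g where "g t = (\<Sum>x\<in>UNIV. (\<Phi>' t x * \<nu> t x + flow (\<nu> t) (\<eta> t) (k t) x * \<Phi> t x) * \<pi> x)" for t
    have "((\<lambda>t. g t) has_integral pairing (\<Phi> 1) (\<nu> 1) - pairing (\<Phi> 0) (\<nu> 0)) {0..1}"
    proof (rule abs_continuous_has_integral[OF _ _ N])
      show "abs_continuous_on_interval 0 1 (\<lambda>t. pairing (\<Phi> t) (\<nu> t))"
        unfolding pairing_def
      proof (intro abs_continuous_on_interval_sum abs_continuous_on_interval_mult)
        show "abs_continuous_on_interval 0 1 (\<lambda>t. \<Phi> t x)" for x
          using \<Phi> \<Phi>'c by (rule abs_continuous_on_interval_C1)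
        show "abs_continuous_on_interval 0 1 (\<lambda>t. \<pi> x)" for x
          by (rule abs_continuous_on_interval_lipschitz[where L = 0]) auto
      qed (rule admD(2))
      fix t assume t: "t \<in> {0..1} - N"
      show "((\<lambda>t. pairing (\<Phi> t) (\<nu> t)) has_real_derivative g t) (at t within {0..1})"
        unfolding pairing_def g_def using t
        by (intro DERIV_sum DERIV_cmult_right DERIV_mult \<Phi> der[rule_format]) auto
    qed simp
    then have G: "((\<lambda>t. 2 * g t - f t) has_integral 2 * (pairing (\<Phi> 1) (\<nu> 1) - pairing (\<Phi> 0) (\<nu> 0)) - Q) {0..1}"
      by (intro has_integral_diff has_integral_mult_right fi)
    have le: "2 * g t - f t \<le> ?c t" if "t \<in> {0..1} - N" for t
    proof -
      have t: "t \<in> {0..1}" using that by simp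
      have "pairing (\<Phi>' t) (\<nu> t) \<le> pairing (\<lambda>x. - force (m t) (\<Phi> t) x) (\<nu> t)"
        unfolding pairing_def using sub[OF t] admD(1)[OF t] \<pi>_nonneg
        by (intro sum_mono mult_right_mono) (auto simp: nonneg_densities_def)
      also have "\<dots> = - pairing (force (m t) (\<Phi> t)) (\<nu> t)"
        by (simp add: pairing_def sum_negf)
      finally have 1: "pairing (\<Phi>' t) (\<nu> t) \<le> - pairing (force (m t) (\<Phi> t)) (\<nu> t)" .
      have 2: "g t = pairing (\<Phi>' t) (\<nu> t) + pairing (\<Phi> t) (flow (\<nu> t) (\<eta> t) (k t))"
        by (simp add: g_def pairing_def sum.distrib algebra_simps)
      show ?thesis
        using cost_ge_dual[OF m[OF t] admD(1)[OF t], of "\<Phi> t" "\<eta> t" "k t"] f[OF t] 1 2 by linarith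
    qed
    have "2 * (pairing (\<Phi> 1) (\<nu> 1) - pairing (\<Phi> 0) (\<nu> 0)) - Q \<le> (LINT t|I01. ?c t)"
    proof (rule has_integral_le)
      show "((\<lambda>t. if t \<in> N then 0 else 2 * g t - f t) has_integral 2 * (pairing (\<Phi> 1) (\<nu> 1) - pairing (\<Phi> 0) (\<nu> 0)) - Q) {0..1}"
        by (rule has_integral_spike[OF N _ G]) auto
      show "((\<lambda>t. if t \<in> N then 0 else ?c t) has_integral (LINT t|I01. ?c t)) {0..1}"
        by (rule has_integral_spike[OF N _ chi]) auto
    qed (use le in auto)
    then show ?thesis unfolding act' using admD(4,5) by (simp add: ennreal_leI)
  qed simp
qed

lemma potential_curve:
  assumes pos: "\<And>t. t \<in> {0..1} \<Longrightarrow> \<mu> t \<in> pos_densities"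
    and ac: "\<And>x. abs_continuous_on_interval 0 1 (\<lambda>t. \<mu> t x)"
    and meas: "\<And>x. (\<lambda>t. \<phi> t x) \<in> borel_measurable I01"
    and der: "AE t in I01. \<forall>x. ((\<lambda>s. \<mu> s x) has_real_derivative vel (\<mu> t) (\<phi> t) x) (at t within {0..1})"
  shows "admissible K p (\<mu> 0) (\<mu> 1) \<mu> (\<lambda>t x. \<phi> t x / b\<^sup>2) (\<lambda>t. pairing (\<phi> t) p / a\<^sup>2)"
    and "action K \<pi> a b \<mu> (\<lambda>t x. \<phi> t x / b\<^sup>2) (\<lambda>t. pairing (\<phi> t) p / a\<^sup>2) = (\<integral>\<^sup>+ t. ennreal (energy (\<mu> t) (\<phi> t)) \<partial>I01)"
proof -
  have m1: "(\<lambda>t. \<phi> t x / b\<^sup>2) \<in> borel_measurable I01" for x using meas[of x] by simp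
  have m2: "(\<lambda>t. pairing (\<phi> t) p / a\<^sup>2) \<in> borel_measurable I01"
    unfolding pairing_def using meas by simp
  have nn: "\<mu> t \<in> nonneg_densities" if "t \<in> {0..1}" for t using pos[OF that] by (rule pos_densities_nonneg)
  show "admissible K p (\<mu> 0) (\<mu> 1) \<mu> (\<lambda>t x. \<phi> t x / b\<^sup>2) (\<lambda>t. pairing (\<phi> t) p / a\<^sup>2)"
    by (rule admissibleI[OF nn ac refl refl m1 m2]) (use der in \<open>simp_all add: vel_eq_flow\<close>)
  show "action K \<pi> a b \<mu> (\<lambda>t x. \<phi> t x / b\<^sup>2) (\<lambda>t. pairing (\<phi> t) p / a\<^sup>2) = (\<integral>\<^sup>+ t. ennreal (energy (\<mu> t) (\<phi> t)) \<partial>I01)"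
    by (subst action_eq_cost[OF nn _ m1 m2])
      (simp_all add: cost_optimal continuous_imp_measurable_I01 abs_continuous_on_interval_imp_continuous_on[OF ac])
qed

text \<open>Linear interpolation stays positive, so its velocity is generated by a potential that is continuous in
  time and has bounded energy.\<close>

lemma finite_action_between_positive:
  assumes "\<nu>0 \<in> pos_densities" "\<nu>1 \<in> pos_densities"
  obtains \<nu> \<eta> k where "admissible K p \<nu>0 \<nu>1 \<nu> \<eta> k" "action K \<pi> a b \<nu> \<eta> k < \<infinity>"
proof -
  define \<nu> where "\<nu> t x = (1 - t) * \<nu>0 x + t * \<nu>1 x" for t x
  define \<rho> where "\<rho> x = \<nu>1 x - \<nu>0 x" for x
  define \<phi> where "\<phi> t = sol (\<nu> t) \<rho>" for t
  have pos: "\<nu> t \<in> pos_densities" if "t \<in> {0..1}" for t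
  proof -
    have "0 < (1 - t) * \<nu>0 x + t * \<nu>1 x" for x
    proof (cases "t = 0")
      case False
      then show ?thesis using that assms by (intro add_nonneg_pos mult_nonneg_nonneg mult_pos_pos) (auto simp: pos_densities_def less_imp_le)
    qed (use assms in \<open>auto simp: pos_densities_def\<close>)
    then show ?thesis by (simp add: \<nu>_def pos_densities_def)
  qed
  have \<nu>c: "continuous_on {0..1} (\<lambda>t. \<nu> t x)" for x unfolding \<nu>_def by (intro continuous_intros)
  have der: "((\<lambda>s. \<nu> s x) has_real_derivative \<rho> x) (at t within {0..1})" for t x
    unfolding \<nu>_def \<rho>_def by (auto intro!: derivative_eq_intros)
  have ac: "abs_continuous_on_interval 0 1 (\<lambda>t. \<nu> t x)" for x
    using der by (rule abs_continuous_on_interval_C1) (rule continuous_on_const)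
  have \<phi>c: "continuous_on {0..1} (\<lambda>t. \<phi> t x)" for x
    unfolding \<phi>_def by (rule continuous_on_sol[OF pos \<nu>c]) (auto intro: continuous_on_const)
  have vel: "vel (\<nu> t) (\<phi> t) = \<rho>" if "t \<in> {0..1}" for t
    unfolding \<phi>_def by (rule vel_sol[OF pos[OF that]])
  have ae: "AE t in I01. \<forall>x. ((\<lambda>s. \<nu> s x) has_real_derivative vel (\<nu> t) (\<phi> t) x) (at t within {0..1})"
    using vel der by (intro AE_I2) auto
  note pc = potential_curve[OF pos ac continuous_imp_measurable_I01[OF \<phi>c] ae]
  have "continuous_on {0..1} (\<lambda>t. energy (\<nu> t) (\<phi> t))"
    by (rule continuous_on_energy[OF pos \<nu>c \<phi>c])
  then obtain B where B: "0 \<le> B" "\<And>t. t \<in> {0..1} \<Longrightarrow> \<bar>energy (\<nu> t) (\<phi> t)\<bar> \<le> B"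
    using continuous_on_Icc_bounded by blast
  have "(\<integral>\<^sup>+ t. ennreal (energy (\<nu> t) (\<phi> t)) \<partial>I01) \<le> ennreal B"
    by (rule nn_integral_I01_le) (use B in \<open>force intro!: AE_I2\<close>)
  then have "(\<integral>\<^sup>+ t. ennreal (energy (\<nu> t) (\<phi> t)) \<partial>I01) < \<infinity>"
    by (simp add: le_less_trans)
  then have fin: "action K \<pi> a b \<nu> (\<lambda>t x. \<phi> t x / b\<^sup>2) (\<lambda>t. pairing (\<phi> t) p / a\<^sup>2) < \<infinity>"
    by (simp only: pc(2))
  have ends: "\<nu> 0 = \<nu>0" "\<nu> 1 = \<nu>1" by (auto simp: \<nu>_def)
  show thesis by (rule that[OF pc(1)[unfolded ends] fin])
qed

lemma dist_ge_dual:
  assumes "\<nu>0 \<in> pos_densities" "\<nu>1 \<in> pos_densities"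
    and m: "\<And>t. t \<in> {0..1} \<Longrightarrow> m t \<in> pos_densities"
    and \<Phi>: "\<And>t x. t \<in> {0..1} \<Longrightarrow> ((\<lambda>s. \<Phi> s x) has_real_derivative \<Phi>' t x) (at t within {0..1})"
    and \<Phi>'c: "\<And>x. continuous_on {0..1} (\<lambda>t. \<Phi>' t x)"
    and sub: "\<And>t x. t \<in> {0..1} \<Longrightarrow> \<Phi>' t x \<le> - force (m t) (\<Phi> t) x"
    and f: "\<And>t. t \<in> {0..1} \<Longrightarrow> source (\<Phi> t) \<le> f t" and fi: "(f has_integral Q) {0..1}"
  shows "2 * (pairing (\<Phi> 1) \<nu>1 - pairing (\<Phi> 0) \<nu>0) - Q \<le> (W \<nu>0 \<nu>1)\<^sup>2"
proof -
  obtain \<nu> \<eta> k where "admissible K p \<nu>0 \<nu>1 \<nu> \<eta> k" "action K \<pi> a b \<nu> \<eta> k < \<infinity>"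
    using finite_action_between_positive[OF assms(1,2)] .
  then show ?thesis
    by (rule dist_ge_action) (rule action_ge_dual[OF _ m \<Phi> \<Phi>'c sub f fi])
qed

text \<open>On a short piece from \<open>s\<close> to \<open>t\<close>, with \<open>\<epsilon> = t - s\<close>, use the dual bound with the affine function
  \<open>\<Phi> r = \<epsilon> (\<phi> - \<epsilon> r q)\<close> and the constant density \<open>\<mu> s\<close>, where \<open>q\<close> exceeds the force by a small
  \<open>\<delta>\<close> so that \<open>\<Phi>\<close> satisfies the differential inequality.
  Divided by \<open>\<epsilon>\<^sup>2\<close> and in the limits \<open>t \<rightarrow> s\<close> and \<open>\<delta> \<rightarrow> 0\<close>, the bound is
  \<open>2\<langle>\<phi>, vel\<rangle> - 2\<langle>force, \<mu>\<rangle> - source\<close>, which is the energy.\<close>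

lemma energy_le_metric_speed:
  assumes pos: "\<And>t. t \<in> {0..1} \<Longrightarrow> \<mu> t \<in> pos_densities"
    and geo: "\<And>t. t \<in> {0..1} \<Longrightarrow> W (\<mu> s) (\<mu> t) = \<bar>t - s\<bar> * c"
    and s: "s \<in> {0..1}"
    and der: "\<And>x. ((\<lambda>t. \<mu> t x) has_real_derivative vel (\<mu> s) \<phi> x) (at s within {0..1})"
  shows "energy (\<mu> s) \<phi> \<le> c\<^sup>2"
proof (rule field_le_epsilon)
  fix e :: real assume e: "0 < e"
  define P where "P = pairing (\<lambda>x. 1) (\<mu> s)"
  have "0 \<le> P" unfolding P_def pairing_def using pos[OF s] \<pi>_nonneg
    by (intro sum_nonneg mult_nonneg_nonneg) (auto simp: pos_densities_def less_imp_le)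
  \<comment> \<open>The total loss from \<open>\<delta>\<close> is \<open>\<delta>\<close> in the source and \<open>2 \<delta> P\<close> in the force, together \<open>e\<close>.\<close>
  define \<delta> where "\<delta> = e / (2 * P + 1)"
  have \<delta>: "0 < \<delta>" using e \<open>0 \<le> P\<close> by (simp add: \<delta>_def)
  define q where "q x = force (\<mu> s) \<phi> x + \<delta>" for x
  define \<psi> where "\<psi> y x = \<phi> x - y * q x" for y x
  have l\<psi>: "((\<lambda>y. \<psi> y x) \<longlongrightarrow> \<phi> x) (nhds 0)" for x
    unfolding \<psi>_def by (auto intro!: tendsto_eq_intros filterlim_ident)
  have "\<forall>\<^sub>F y in nhds 0. force (\<mu> s) (\<psi> y) x < q x" for x
    by (rule order_tendstoD(2)[OF tendsto_force[OF pos[OF s] tendsto_const l\<psi>]]) (simp add: q_def \<delta>)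
  then have "\<forall>\<^sub>F y in nhds 0. \<forall>x. force (\<mu> s) (\<psi> y) x < q x" by (rule eventually_all_finite)
  moreover have "((\<lambda>y. source (\<psi> y)) \<longlongrightarrow> source \<phi>) (nhds 0)"
    unfolding source_def pairing_def using a_pos by (intro tendsto_intros l\<psi>) auto
  then have "\<forall>\<^sub>F y in nhds 0. source (\<psi> y) < source \<phi> + \<delta>"
    by (rule order_tendstoD(2)) (simp add: \<delta>)
  ultimately have "\<forall>\<^sub>F y in nhds 0. (\<forall>x. force (\<mu> s) (\<psi> y) x < q x) \<and> source (\<psi> y) < source \<phi> + \<delta>"
    by (rule eventually_conj)
  then obtain r0 where r0: "0 < r0" "\<And>y x. \<bar>y\<bar> < r0 \<Longrightarrow> force (\<mu> s) (\<psi> y) x < q x"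
    "\<And>y. \<bar>y\<bar> < r0 \<Longrightarrow> source (\<psi> y) < source \<phi> + \<delta>"
    unfolding eventually_nhds_metric by (auto simp: dist_real_def)
  define R where "R t = 2 * pairing \<phi> (\<lambda>x. (\<mu> t x - \<mu> s x) / (t - s)) - 2 * pairing q (\<mu> t) - (source \<phi> + \<delta>)" for t
  have Rle: "R t \<le> c\<^sup>2" if t: "t \<in> {0..1}" "t \<noteq> s" "\<bar>t - s\<bar> < r0" for t
  proof -
    define \<epsilon> where "\<epsilon> = t - s"
    have \<epsilon>: "\<epsilon> \<noteq> 0" "\<bar>\<epsilon>\<bar> < r0" using t by (auto simp: \<epsilon>_def)
    define \<Phi> where "\<Phi> r x = \<epsilon> * \<psi> (\<epsilon> * r) x" for r x
    have small: "\<bar>\<epsilon> * r\<bar> < r0" if "r \<in> {0..1}" for r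
    proof -
      have "\<bar>\<epsilon> * r\<bar> \<le> \<bar>\<epsilon>\<bar> * 1" unfolding abs_mult using that by (intro mult_left_mono) auto
      then show ?thesis using \<epsilon> by simp
    qed
    have "2 * (pairing (\<Phi> 1) (\<mu> t) - pairing (\<Phi> 0) (\<mu> s)) - \<epsilon>\<^sup>2 * (source \<phi> + \<delta>) \<le> (W (\<mu> s) (\<mu> t))\<^sup>2"
    proof (rule dist_ge_dual[where m = "\<lambda>_. \<mu> s" and \<Phi>' = "\<lambda>_ x. - \<epsilon>\<^sup>2 * q x" and f = "\<lambda>_. \<epsilon>\<^sup>2 * (source \<phi> + \<delta>)"])
      show "((\<lambda>r. \<Phi> r x) has_real_derivative - \<epsilon>\<^sup>2 * q x) (at r within {0..1})" for r x
        unfolding \<Phi>_def \<psi>_def by (auto intro!: derivative_eq_intros simp: power2_eq_square)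
      fix r :: real assume r: "r \<in> {0..1}"
      show "- \<epsilon>\<^sup>2 * q x \<le> - force (\<mu> s) (\<Phi> r) x" for x
      proof -
        have "\<epsilon>\<^sup>2 * force (\<mu> s) (\<psi> (\<epsilon> * r)) x \<le> \<epsilon>\<^sup>2 * q x"
          using r0(2)[OF small[OF r], of x] by (intro mult_left_mono) auto
        then show ?thesis unfolding \<Phi>_def force_scale by simp
      qed
      show "source (\<Phi> r) \<le> \<epsilon>\<^sup>2 * (source \<phi> + \<delta>)"
        unfolding \<Phi>_def source_scale using r0(3)[OF small[OF r]] by (intro mult_left_mono) auto
    next
      show "((\<lambda>_. \<epsilon>\<^sup>2 * (source \<phi> + \<delta>)) has_integral \<epsilon>\<^sup>2 * (source \<phi> + \<delta>)) {0..1::real}"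
        using has_integral_const_real[of "\<epsilon>\<^sup>2 * (source \<phi> + \<delta>)" 0 1] by simp
    qed (use pos s t in \<open>auto intro: continuous_on_const\<close>)
    also have "(W (\<mu> s) (\<mu> t))\<^sup>2 = \<epsilon>\<^sup>2 * c\<^sup>2"
      using geo[OF t(1)] by (simp add: power_mult_distrib \<epsilon>_def)
    also have "2 * (pairing (\<Phi> 1) (\<mu> t) - pairing (\<Phi> 0) (\<mu> s)) - \<epsilon>\<^sup>2 * (source \<phi> + \<delta>) = \<epsilon>\<^sup>2 * R t"
    proof -
      have "pairing (\<Phi> 1) (\<mu> t) - pairing (\<Phi> 0) (\<mu> s) = (\<Sum>x\<in>UNIV. (\<epsilon> * \<phi> x * (\<mu> t x - \<mu> s x) - \<epsilon>\<^sup>2 * (q x * \<mu> t x)) * \<pi> x)"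
        unfolding pairing_def \<Phi>_def \<psi>_def
        by (simp add: sum_subtractf[symmetric] algebra_simps power2_eq_square)
      also have "\<dots> = (\<Sum>x\<in>UNIV. \<epsilon>\<^sup>2 * (\<phi> x * ((\<mu> t x - \<mu> s x) / (t - s)) * \<pi> x - q x * \<mu> t x * \<pi> x))"
      proof (intro sum.cong refl)
        fix x
        define d where "d = (\<mu> t x - \<mu> s x) / (t - s)"
        have A: "\<mu> t x - \<mu> s x = \<epsilon> * d" using \<epsilon> by (simp add: \<epsilon>_def d_def)
        show "(\<epsilon> * \<phi> x * (\<mu> t x - \<mu> s x) - \<epsilon>\<^sup>2 * (q x * \<mu> t x)) * \<pi> x
            = \<epsilon>\<^sup>2 * (\<phi> x * ((\<mu> t x - \<mu> s x) / (t - s)) * \<pi> x - q x * \<mu> t x * \<pi> x)"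
          unfolding d_def[symmetric] unfolding A by (simp add: power2_eq_square algebra_simps)
      qed
      also have "\<dots> = \<epsilon>\<^sup>2 * (pairing \<phi> (\<lambda>x. (\<mu> t x - \<mu> s x) / (t - s)) - pairing q (\<mu> t))"
        by (simp only: pairing_def sum_distrib_left[symmetric] sum_subtractf)
      finally show ?thesis by (simp add: R_def algebra_simps)
    qed
    finally show ?thesis using \<epsilon> by simp
  qed
  have "((\<lambda>t. R t) \<longlongrightarrow> 2 * pairing \<phi> (vel (\<mu> s) \<phi>) - 2 * pairing q (\<mu> s) - (source \<phi> + \<delta>)) (at s within {0..1})"
  proof -
    have "((\<lambda>t. (\<mu> t x - \<mu> s x) / (t - s)) \<longlongrightarrow> vel (\<mu> s) \<phi> x) (at s within {0..1})" for x
      using der[of x] by (simp add: has_field_derivative_iff)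
    moreover have "((\<lambda>t. \<mu> t x) \<longlongrightarrow> \<mu> s x) (at s within {0..1})" for x
      using DERIV_continuous[OF der[of x]] by (simp add: continuous_within)
    ultimately show ?thesis unfolding R_def pairing_def by (intro tendsto_intros)
  qed
  moreover have "\<forall>\<^sub>F t in at s within {0..1}. R t \<le> c\<^sup>2"
    using Rle r0(1) unfolding eventually_at by (auto simp: dist_real_def)
  ultimately have "2 * pairing \<phi> (vel (\<mu> s) \<phi>) - 2 * pairing q (\<mu> s) - (source \<phi> + \<delta>) \<le> c\<^sup>2"
    by (rule tendsto_upperbound) (rule at_within_I01_nontrivial[OF s])
  moreover have "pairing q (\<mu> s) = pairing (force (\<mu> s) \<phi>) (\<mu> s) + \<delta> * P"
    by (simp add: pairing_def q_def P_def sum.distrib sum_distrib_left algebra_simps)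
  moreover have "\<delta> * (2 * P + 1) = e" using \<open>0 \<le> P\<close> by (simp add: \<delta>_def)
  ultimately show "energy (\<mu> s) \<phi> \<le> c\<^sup>2 + e"
    using energy_eq_tangent[OF pos[OF s], of \<phi>] pairing_vel_self[OF pos_densities_nonneg[OF pos[OF s]], of \<phi>]
    by (simp add: algebra_simps)
qed

section \<open>Solutions of the Hamiltonian system are geodesics\<close>

lemma energy_has_derivative:
  assumes pos: "\<mu> t \<in> pos_densities"
    and \<mu>: "\<And>x. ((\<lambda>s. \<mu> s x) has_real_derivative \<mu>' x) (at t within A)"
    and \<phi>: "\<And>x. ((\<lambda>s. \<phi> s x) has_real_derivative \<phi>' x) (at t within A)"
  shows "((\<lambda>s. energy (\<mu> s) (\<phi> s)) has_real_derivative
      2 * pairing \<phi>' (vel (\<mu> t) (\<phi> t)) + 2 * pairing (force (\<mu> t) (\<phi> t)) \<mu>') (at t within A)"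
proof -
  have pos': "0 < \<mu> t x" for x using pos by (simp add: pos_densities_def)
  have 1: "((\<lambda>s. source (\<phi> s)) has_real_derivative 2 * (pairing (\<phi> t) p * pairing \<phi>' p / a\<^sup>2)) (at t within A)"
  proof -
    have "((\<lambda>s. pairing (\<phi> s) p) has_real_derivative pairing \<phi>' p) (at t within A)"
      unfolding pairing_def by (intro DERIV_sum DERIV_cmult_right \<phi>)
    from DERIV_cdivide[OF DERIV_power[OF this, of 2], of "a\<^sup>2"] show ?thesis
      unfolding source_def by (simp add: mult_ac)
  qed
  define \<theta>' where "\<theta>' x y = d1_mean (\<mu> t x) (\<mu> t y) * \<mu>' x + d1_mean (\<mu> t y) (\<mu> t x) * \<mu>' y" for x y
  have 2: "((\<lambda>s. weight (\<mu> s) x y) has_real_derivative \<theta>' x y * K x y * \<pi> x) (at t within A)" for x y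
    unfolding weight_def edge_mean_def \<theta>'_def
    by (intro DERIV_cmult_right log_mean_has_real_derivative \<mu> pos')
  have 3: "((\<lambda>s. (\<phi> s y - \<phi> s x)\<^sup>2) has_real_derivative 2 * ((\<phi>' y - \<phi>' x) * (\<phi> t y - \<phi> t x))) (at t within A)" for x y
    using DERIV_power[OF DERIV_diff[OF \<phi>[of y] \<phi>[of x]], of 2] by (simp add: mult_ac)
  have 4: "((\<lambda>s. (\<phi> s y - \<phi> s x)\<^sup>2 * weight (\<mu> s) x y) has_real_derivative
      2 * ((\<phi>' y - \<phi>' x) * (\<phi> t y - \<phi> t x)) * weight (\<mu> t) x y + \<theta>' x y * K x y * \<pi> x * (\<phi> t y - \<phi> t x)\<^sup>2) (at t within A)" for x y
    using DERIV_mult[OF 3 2] .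
  have "((\<lambda>s. energy (\<mu> s) (\<phi> s)) has_real_derivative
     2 * (pairing (\<phi> t) p * pairing \<phi>' p / a\<^sup>2) + (\<Sum>x\<in>UNIV. \<Sum>y\<in>UNIV. 2 * ((\<phi>' y - \<phi>' x) * (\<phi> t y - \<phi> t x)) * weight (\<mu> t) x y
        + \<theta>' x y * K x y * \<pi> x * (\<phi> t y - \<phi> t x)\<^sup>2) / (2 * b\<^sup>2)) (at t within A)"
    unfolding energy_def by (intro DERIV_add 1 DERIV_cdivide DERIV_sum 4)
  moreover have "(\<Sum>x\<in>UNIV. \<Sum>y\<in>UNIV. 2 * ((\<phi>' y - \<phi>' x) * (\<phi> t y - \<phi> t x)) * weight (\<mu> t) x y
        + \<theta>' x y * K x y * \<pi> x * (\<phi> t y - \<phi> t x)\<^sup>2)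
     = 2 * (\<Sum>x\<in>UNIV. \<Sum>y\<in>UNIV. (\<phi>' y - \<phi>' x) * (\<phi> t y - \<phi> t x) * weight (\<mu> t) x y)
       + (\<Sum>x\<in>UNIV. \<Sum>y\<in>UNIV. (\<phi> t y - \<phi> t x)\<^sup>2 * (\<theta>' x y * K x y * \<pi> x))"
    by (simp add: sum.distrib sum_distrib_left mult_ac)
  ultimately show ?thesis
    unfolding pairing_vel[OF pos_densities_nonneg[OF pos]] pairing_force \<theta>'_def
    by (simp add: add_divide_distrib distrib_left add.assoc)
qed

lemma pairing_has_derivative:
  assumes "\<And>x. ((\<lambda>s. \<mu> s x) has_real_derivative \<mu>' x) (at t within A)"
    and "\<And>x. ((\<lambda>s. \<phi> s x) has_real_derivative \<phi>' x) (at t within A)"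
  shows "((\<lambda>s. pairing (\<phi> s) (\<mu> s)) has_real_derivative pairing \<phi>' (\<mu> t) + pairing (\<phi> t) \<mu>') (at t within A)"
proof -
  have "((\<lambda>s. pairing (\<phi> s) (\<mu> s)) has_real_derivative (\<Sum>x\<in>UNIV. (\<phi>' x * \<mu> t x + \<mu>' x * \<phi> t x) * \<pi> x)) (at t within A)"
    unfolding pairing_def by (intro DERIV_sum DERIV_cmult_right DERIV_mult assms)
  then show ?thesis by (simp add: pairing_def sum.distrib algebra_simps)
qed

text \<open>Conservation of the Hamiltonian: the two terms of its derivative cancel.\<close>

lemma energy_constant:
  assumes pos: "\<And>t. t \<in> {l..r} \<Longrightarrow> \<mu> t \<in> pos_densities"
    and \<mu>: "\<And>t x. t \<in> {l..r} \<Longrightarrow> ((\<lambda>s. \<mu> s x) has_real_derivative vel (\<mu> t) (\<phi> t) x) (at t within {l..r})"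
    and \<phi>: "\<And>t x. t \<in> {l..r} \<Longrightarrow> ((\<lambda>s. \<phi> s x) has_real_derivative - force (\<mu> t) (\<phi> t) x) (at t within {l..r})"
  obtains E where "\<And>t. t \<in> {l..r} \<Longrightarrow> energy (\<mu> t) (\<phi> t) = E"
proof -
  have "((\<lambda>s. energy (\<mu> s) (\<phi> s)) has_real_derivative 0) (at t within {l..r})" if t: "t \<in> {l..r}" for t
  proof -
    have "pairing (\<lambda>x. - force (\<mu> t) (\<phi> t) x) (vel (\<mu> t) (\<phi> t)) = - pairing (force (\<mu> t) (\<phi> t)) (vel (\<mu> t) (\<phi> t))"
      using pairing_scale_left[of "-1" "force (\<mu> t) (\<phi> t)" "vel (\<mu> t) (\<phi> t)"] by simp
    then show ?thesis
      using energy_has_derivative[where \<mu> = \<mu> and \<phi> = \<phi>, OF pos[OF t] \<mu>[OF t] \<phi>[OF t]] by simp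
  qed
  then have "\<exists>E. \<forall>t\<in>{l..r}. energy (\<mu> t) (\<phi> t) = E"
    by (intro has_field_derivative_zero_constant) auto
  then show thesis using that by blast
qed

text \<open>The solution restricted to the time interval between \<open>s\<close> and \<open>t\<close> and run affinely over \<open>[0,1]\<close>, with
  momentum scaled by \<open>c = t - s\<close>, is again a solution, also for \<open>c \<le> 0\<close>. Its action is \<open>c\<^sup>2 E\<close>, and the
  dual bound for its own potential has the same value, so it is minimal.\<close>

lemma geodesic_if_hamiltonian:
  assumes pos: "\<And>t. t \<in> {0..1} \<Longrightarrow> \<mu> t \<in> pos_densities"
    and \<mu>: "\<And>t x. t \<in> {0..1} \<Longrightarrow> ((\<lambda>s. \<mu> s x) has_real_derivative vel (\<mu> t) (\<phi> t) x) (at t within {0..1})"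
    and \<phi>: "\<And>t x. t \<in> {0..1} \<Longrightarrow> ((\<lambda>s. \<phi> s x) has_real_derivative - force (\<mu> t) (\<phi> t) x) (at t within {0..1})"
  shows "constant_speed_geodesic W \<mu>"
proof -
  obtain E where E: "\<And>t. t \<in> {0..1} \<Longrightarrow> energy (\<mu> t) (\<phi> t) = E"
    using energy_constant[OF pos \<mu> \<phi>] by blast
  have E0: "0 \<le> E" using E[of 0] energy_nonneg[OF pos_densities_nonneg[OF pos[of 0]], of "\<phi> 0"] by simp
  have \<mu>c: "continuous_on {0..1} (\<lambda>t. \<mu> t x)" for x
    using DERIV_continuous_on[OF \<mu>] by blast
  have \<phi>c: "continuous_on {0..1} (\<lambda>t. \<phi> t x)" for x
    using DERIV_continuous_on[OF \<phi>] by blast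
  have main: "W (\<mu> s) (\<mu> t) = \<bar>t - s\<bar> * sqrt E" if s: "s \<in> {0..1}" and t: "t \<in> {0..1}" for s t
  proof -
    define c where "c = t - s"
    define \<tau> where "\<tau> r = s + c * r" for r
    define \<nu> where "\<nu> r = \<mu> (\<tau> r)" for r
    define \<Phi> where "\<Phi> r x = c * \<phi> (\<tau> r) x" for r x
    have \<tau>: "\<tau> r \<in> {0..1}" if r: "r \<in> {0..1}" for r
    proof -
      have "\<tau> r = (1 - r) * s + r * t" by (simp add: \<tau>_def c_def algebra_simps)
      moreover have "(1 - r) * s + r * t \<le> (1 - r) * 1 + r * 1"
        using r s t by (intro add_mono mult_left_mono) auto
      moreover have "0 \<le> (1 - r) * s + r * t" using r s t by auto
      ultimately show ?thesis by simp
    qed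
    have \<tau>c: "continuous_on {0..1} \<tau>" unfolding \<tau>_def by (intro continuous_intros)
    have chain: "((\<lambda>r. f (\<tau> r)) has_real_derivative f' * c) (at r within {0..1})"
      if "(f has_real_derivative f') (at (\<tau> r) within {0..1})" for f f' r
    proof -
      have "(f has_real_derivative f') (at (\<tau> r) within \<tau> ` {0..1})"
        by (rule has_field_derivative_subset[OF that]) (use \<tau> in auto)
      moreover have "(\<tau> has_real_derivative c) (at r within {0..1})"
        unfolding \<tau>_def by (auto intro!: derivative_eq_intros)
      ultimately show ?thesis using DERIV_image_chain[of f f' \<tau> r "{0..1}" c] by (simp add: o_def)
    qed
    have pos\<nu>: "\<nu> r \<in> pos_densities" if "r \<in> {0..1}" for r
      unfolding \<nu>_def by (rule pos[OF \<tau>[OF that]])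
    have d\<nu>: "((\<lambda>r. \<nu> r x) has_real_derivative vel (\<nu> r) (\<Phi> r) x) (at r within {0..1})" if "r \<in> {0..1}" for r x
      using chain[OF \<mu>[OF \<tau>[OF that], of x]] unfolding \<nu>_def \<Phi>_def vel_scale by (simp add: mult.commute)
    have d\<Phi>: "((\<lambda>r. \<Phi> r x) has_real_derivative - force (\<nu> r) (\<Phi> r) x) (at r within {0..1})" if "r \<in> {0..1}" for r x
      using DERIV_cmult[OF chain[OF \<phi>[OF \<tau>[OF that], of x]], of c]
      unfolding \<nu>_def \<Phi>_def force_scale by (simp add: power2_eq_square mult_ac)
    have \<nu>c: "continuous_on {0..1} (\<lambda>r. \<nu> r x)" for x using DERIV_continuous_on[OF d\<nu>] by blast
    have \<Phi>c: "continuous_on {0..1} (\<lambda>r. \<Phi> r x)" for x using DERIV_continuous_on[OF d\<Phi>] by blast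
    have en: "energy (\<nu> r) (\<Phi> r) = c\<^sup>2 * E" if "r \<in> {0..1}" for r
      unfolding \<nu>_def \<Phi>_def energy_scale using E[OF \<tau>[OF that]] by simp
    have ends: "\<nu> 0 = \<mu> s" "\<nu> 1 = \<mu> t" by (simp_all add: \<nu>_def \<tau>_def c_def)
    have ac: "abs_continuous_on_interval 0 1 (\<lambda>r. \<nu> r x)" for x
      by (rule abs_continuous_on_interval_C1[OF d\<nu> continuous_on_vel[OF pos\<nu> \<nu>c \<Phi>c]])
    have ae: "AE r in I01. \<forall>x. ((\<lambda>r. \<nu> r x) has_real_derivative vel (\<nu> r) (\<Phi> r) x) (at r within {0..1})"
      using d\<nu> by (intro AE_I2) auto
    note pc = potential_curve[OF pos\<nu> ac continuous_imp_measurable_I01[OF \<Phi>c] ae]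
    have "(W (\<mu> s) (\<mu> t))\<^sup>2 \<le> c\<^sup>2 * E"
      unfolding ends[symmetric]
    proof (rule dist_le_action[OF pc(1)])
      show "action K \<pi> a b \<nu> (\<lambda>t x. \<Phi> t x / b\<^sup>2) (\<lambda>t. pairing (\<Phi> t) p / a\<^sup>2) \<le> ennreal (c\<^sup>2 * E)"
      proof -
        have "(\<integral>\<^sup>+ r. ennreal (energy (\<nu> r) (\<Phi> r)) \<partial>I01) \<le> ennreal (c\<^sup>2 * E)"
          by (rule nn_integral_I01_le) (use en in \<open>auto intro!: AE_I2\<close>)
        then show ?thesis by (simp only: pc(2))
      qed
      show "0 \<le> c\<^sup>2 * E" using E0 by simp
    qed
    moreover have "c\<^sup>2 * E \<le> (W (\<mu> s) (\<mu> t))\<^sup>2"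
    proof -
      let ?Q = "2 * (pairing (\<Phi> 1) (\<mu> t) - pairing (\<Phi> 0) (\<mu> s)) - c\<^sup>2 * E"
      \<comment> \<open>A primitive of the source term, because the energy equals \<open>c\<^sup>2 E\<close> at all times.\<close>
      define G where "G r = 2 * pairing (\<Phi> r) (\<nu> r) - c\<^sup>2 * E * r" for r
      have "((\<lambda>r. source (\<Phi> r)) has_integral G 1 - G 0) {0..1}"
      proof (rule fundamental_theorem_of_calculus)
        fix r :: real assume r: "r \<in> {0..1}"
        have "pairing (\<lambda>x. - force (\<nu> r) (\<Phi> r) x) (\<nu> r) = - pairing (force (\<nu> r) (\<Phi> r)) (\<nu> r)"
          using pairing_scale_left[of "-1" "force (\<nu> r) (\<Phi> r)" "\<nu> r"] by simp
        then have "2 * (pairing (\<lambda>x. - force (\<nu> r) (\<Phi> r) x) (\<nu> r) + pairing (\<Phi> r) (vel (\<nu> r) (\<Phi> r))) - c\<^sup>2 * E = source (\<Phi> r)"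
          using energy_eq_tangent[OF pos\<nu>[OF r], of "\<Phi> r"] en[OF r] pairing_vel_self[OF pos_densities_nonneg[OF pos\<nu>[OF r]], of "\<Phi> r"]
          by simp
        moreover have "(G has_real_derivative 2 * (pairing (\<lambda>x. - force (\<nu> r) (\<Phi> r) x) (\<nu> r) + pairing (\<Phi> r) (vel (\<nu> r) (\<Phi> r))) - c\<^sup>2 * E) (at r within {0..1})"
          unfolding G_def
          by (intro DERIV_diff DERIV_cmult pairing_has_derivative d\<nu> d\<Phi> r DERIV_cmult_Id)
        ultimately show "(G has_vector_derivative source (\<Phi> r)) (at r within {0..1})"
          by (simp add: has_real_derivative_iff_has_vector_derivative)
      qed simp
      moreover have "G 1 - G 0 = ?Q" by (simp add: G_def ends)
      ultimately have Q: "((\<lambda>r. source (\<Phi> r)) has_integral ?Q) {0..1}" by simp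
      have "2 * (pairing (\<Phi> 1) (\<mu> t) - pairing (\<Phi> 0) (\<mu> s)) - ?Q \<le> (W (\<mu> s) (\<mu> t))\<^sup>2"
        by (rule dist_ge_dual[OF pos[OF s] pos[OF t] pos\<nu> d\<Phi> _ _ _ Q])
          (auto intro!: continuous_on_minus continuous_on_force pos\<nu> \<nu>c \<Phi>c)
      then show ?thesis by simp
    qed
    ultimately have "(W (\<mu> s) (\<mu> t))\<^sup>2 = c\<^sup>2 * E" by simp
    then have "W (\<mu> s) (\<mu> t) = sqrt (c\<^sup>2 * E)" using dist_nonneg by (metis real_sqrt_abs abs_of_nonneg)
    then show ?thesis by (simp add: real_sqrt_mult c_def)
  qed
  show ?thesis
    unfolding constant_speed_geodesic_def
    using main pos_densities_nonneg[OF pos] by (simp add: main[of 0 1])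
qed

section \<open>From weak to classical solutions\<close>

text \<open>If \<open>\<phi>\<close> is almost everywhere a primitive of the negative force, then it has a continuous version. The right-hand
  sides of both equations are continuous along that version, so both hold everywhere.\<close>

lemma hamiltonian_of_integral_form:
  assumes lr: "l < r" and pos: "\<And>t. t \<in> {l..r} \<Longrightarrow> \<mu> t \<in> pos_densities"
    and ac: "\<And>x. abs_continuous_on_interval l r (\<lambda>t. \<mu> t x)" and N: "negligible N"
    and der: "\<And>t x. t \<in> {l..r} - N \<Longrightarrow> ((\<lambda>s. \<mu> s x) has_real_derivative vel (\<mu> t) (\<phi> t) x) (at t within {l..r})"
    and fi: "\<And>x. (\<lambda>t. force (\<mu> t) (\<phi> t) x) integrable_on {l..r}"
    and \<phi>: "\<And>t x. t \<in> {l..r} - N \<Longrightarrow> \<phi> t x = C x - integral {l..t} (\<lambda>t. force (\<mu> t) (\<phi> t) x)"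
  obtains \<psi> where "\<And>t. t \<in> {l..r} - N \<Longrightarrow> \<phi> t = \<psi> t"
    and "\<And>t x. t \<in> {l..r} \<Longrightarrow> ((\<lambda>s. \<mu> s x) has_real_derivative vel (\<mu> t) (\<psi> t) x) (at t within {l..r})"
    and "\<And>t x. t \<in> {l..r} \<Longrightarrow> ((\<lambda>s. \<psi> s x) has_real_derivative - force (\<mu> t) (\<psi> t) x) (at t within {l..r})"
proof -
  define \<psi> where "\<psi> t x = C x - integral {l..t} (\<lambda>t. force (\<mu> t) (\<phi> t) x)" for t x
  have eq: "\<phi> t = \<psi> t" if "t \<in> {l..r} - N" for t using \<phi>[OF that] by (auto simp: \<psi>_def)
  have \<mu>c: "continuous_on {l..r} (\<lambda>t. \<mu> t x)" for x
    using ac by (rule abs_continuous_on_interval_imp_continuous_on)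
  have \<psi>c: "continuous_on {l..r} (\<lambda>t. \<psi> t x)" for x
    unfolding \<psi>_def by (intro continuous_intros indefinite_integral_continuous_1 fi)
  have fc: "continuous_on {l..r} (\<lambda>t. force (\<mu> t) (\<psi> t) x)" for x
    by (rule continuous_on_force[OF pos \<mu>c \<psi>c])
  have vc: "continuous_on {l..r} (\<lambda>t. vel (\<mu> t) (\<psi> t) x)" for x
    by (rule continuous_on_vel[OF pos \<mu>c \<psi>c])
  have \<psi>': "\<psi> t x = C x - integral {l..t} (\<lambda>t. force (\<mu> t) (\<psi> t) x)" if "t \<in> {l..r}" for t x
  proof -
    have "integral {l..t} (\<lambda>t. force (\<mu> t) (\<phi> t) x) = integral {l..t} (\<lambda>t. force (\<mu> t) (\<psi> t) x)"
      by (rule integral_spike[OF N]) (use eq that in auto)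
    then show ?thesis by (simp add: \<psi>_def)
  qed
  have \<mu>': "\<mu> t x = \<mu> l x + integral {l..t} (\<lambda>t. vel (\<mu> t) (\<psi> t) x)" if t: "t \<in> {l..r}" for t x
  proof -
    have "((\<lambda>t. vel (\<mu> t) (\<phi> t) x) has_integral \<mu> t x - \<mu> l x) {l..t}"
    proof (rule abs_continuous_has_integral[OF _ _ N])
      show "abs_continuous_on_interval l t (\<lambda>t. \<mu> t x)"
        by (rule abs_continuous_on_interval_subinterval[OF ac]) (use t in auto)
      show "((\<lambda>t. \<mu> t x) has_real_derivative vel (\<mu> s) (\<phi> s) x) (at s within {l..t})" if "s \<in> {l..t} - N" for s
        by (rule has_field_derivative_subset[OF der]) (use that t in auto)
    qed (use t in simp)
    then have "((\<lambda>t. vel (\<mu> t) (\<psi> t) x) has_integral \<mu> t x - \<mu> l x) {l..t}"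
      by (rule has_integral_spike[OF N, rotated]) (use eq t in auto)
    then show ?thesis by (simp add: integral_unique)
  qed
  show thesis
  proof (rule that[OF eq])
    fix t x assume t: "t \<in> {l..r}"
    have "((\<lambda>t. \<mu> l x + integral {l..t} (\<lambda>t. vel (\<mu> t) (\<psi> t) x)) has_real_derivative 0 + vel (\<mu> t) (\<psi> t) x) (at t within {l..r})"
      by (intro DERIV_add DERIV_const integral_has_real_derivative vc t)
    then show "((\<lambda>s. \<mu> s x) has_real_derivative vel (\<mu> t) (\<psi> t) x) (at t within {l..r})"
      unfolding add_0 by (rule has_field_derivative_transform_within[OF _ zero_less_one t]) (erule \<mu>'[symmetric])
    have "((\<lambda>t. C x - integral {l..t} (\<lambda>t. force (\<mu> t) (\<psi> t) x)) has_real_derivative 0 - force (\<mu> t) (\<psi> t) x) (at t within {l..r})"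
      by (intro DERIV_diff DERIV_const integral_has_real_derivative fc t)
    then show "((\<lambda>s. \<psi> s x) has_real_derivative - force (\<mu> t) (\<psi> t) x) (at t within {l..r})"
      unfolding diff_0 by (rule has_field_derivative_transform_within[OF _ zero_less_one t]) (erule \<psi>'[symmetric])
  qed
qed

definition weak_hamiltonian :: "(real \<Rightarrow> 'x \<Rightarrow> real) \<Rightarrow> (real \<Rightarrow> 'x \<Rightarrow> real) \<Rightarrow> bool" where
  "weak_hamiltonian \<mu> \<phi> \<longleftrightarrow> (\<forall>\<zeta>\<in>C1c_unit_interval. \<forall>x. weak_decay \<zeta> (\<lambda>t. \<phi> t x) (\<lambda>t. force (\<mu> t) (\<phi> t) x))"

text \<open>The increasing test function supplies the integrability that du Bois-Reymond's lemma asks for, and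
  primitives of continuous functions of mean zero supply its hypothesis.\<close>

lemma weak_hamiltonian_integral_form:
  assumes weak: "weak_hamiltonian \<mu> \<phi>" and lr: "0 < l" "l < r" "r < 1"
  shows "(\<lambda>t. force (\<mu> t) (\<phi> t) x) absolutely_integrable_on {l..r}"
    and "\<exists>C N. negligible N \<and> (\<forall>t\<in>{l..r} - N. \<phi> t x = C - integral {l..t} (\<lambda>t. force (\<mu> t) (\<phi> t) x))"
proof -
  let ?u = "\<lambda>t. \<phi> t x" and ?v = "\<lambda>t. force (\<mu> t) (\<phi> t) x"
  have sub: "{l..r} \<subseteq> {0..1}" using lr by auto
  obtain \<zeta> where \<zeta>: "\<zeta> \<in> C1c_unit_interval" "\<And>t. t \<in> {l..r} \<Longrightarrow> 0 < \<zeta> t" "\<And>t. t \<in> {l..r} \<Longrightarrow> 0 < deriv \<zeta> t"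
    using increasing_test_function[OF lr] by blast
  have "(\<lambda>t. ?u t * deriv \<zeta> t) absolutely_integrable_on {0..1}" "(\<lambda>t. ?v t * \<zeta> t) absolutely_integrable_on {0..1}"
    using weak \<zeta>(1) unfolding weak_hamiltonian_def weak_decay_def by (simp_all add: integrable_lebesgue_on_iff[symmetric])
  then have uv: "(\<lambda>t. ?u t * deriv \<zeta> t) absolutely_integrable_on {l..r}" "(\<lambda>t. ?v t * \<zeta> t) absolutely_integrable_on {l..r}"
    using absolutely_integrable_on_subinterval[OF _ sub] by blast+
  have u: "?u absolutely_integrable_on {l..r}"
    using uv(1) C1c_unit_intervalD(3)[OF \<zeta>(1)] \<zeta>(3) by (rule absolutely_integrable_div_continuous)
  show v: "?v absolutely_integrable_on {l..r}"
    using uv(2) C1c_unit_intervalD(2)[OF \<zeta>(1)] \<zeta>(2) by (rule absolutely_integrable_div_continuous)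
  show "\<exists>C N. negligible N \<and> (\<forall>t\<in>{l..r} - N. ?u t = C - integral {l..t} ?v)"
  proof (rule du_bois_reymond[OF lr(2) u v])
    fix w :: "real \<Rightarrow> real"
    assume w: "continuous_on UNIV w" "\<And>t. t \<notin> {l<..<r} \<Longrightarrow> w t = 0" "integral {l..r} w = 0"
    from w(2) have "\<forall>t. t \<notin> {l<..<r} \<longrightarrow> w t = 0" by blast
    note prim = primitive_in_C1c[OF w(1) this lr w(3)]
    let ?\<zeta> = "\<lambda>t. integral {0..t} w"
    have wk: "integrable I01 (\<lambda>t. ?u t * w t)" "integrable I01 (\<lambda>t. ?v t * ?\<zeta> t)"
      "(LINT t|I01. ?u t * w t) = (LINT t|I01. ?v t * ?\<zeta> t)"
      using weak[unfolded weak_hamiltonian_def weak_decay_def, rule_format, OF prim(1), of x] unfolding prim(2) by simp_all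
    have "integral {l..r} (\<lambda>t. ?u t * w t) = integral {0..1} (\<lambda>t. ?u t * w t)"
      by (rule integral_superinterval[symmetric, OF _ sub]) (use w(2) in auto)
    also have "\<dots> = integral {0..1} (\<lambda>t. ?v t * ?\<zeta> t)"
      using wk lebesgue_integral_eq_integral[OF wk(1)] lebesgue_integral_eq_integral[OF wk(2)] by simp
    also have "\<dots> = integral {l..r} (\<lambda>t. ?v t * ?\<zeta> t)"
      by (rule integral_superinterval[OF _ sub]) (use prim(4) in auto)
    also have "\<dots> = integral {l..r} (\<lambda>t. ?v t * integral {l..t} w)"
      by (rule integral_cong) (use prim(3) in auto)
    finally show "integral {l..r} (\<lambda>t. ?u t * w t) = integral {l..r} (\<lambda>t. ?v t * integral {l..t} w)" .
  qed blast
qed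

text \<open>Test functions give no control near the times \<open>0\<close> and \<open>1\<close>, so the weak equation is first made classical
  on compact subintervals. There the energy is constant, and the constant is the same on all of them.
  This bounds the potential and the force on the whole of \<open>[0,1]\<close>, so the force is integrable there and
  the argument can be repeated on the closed interval.\<close>

lemma hamiltonian_if_weak:
  assumes pos: "\<And>t. t \<in> {0..1} \<Longrightarrow> \<mu> t \<in> pos_densities"
    and ac: "\<And>x. abs_continuous_on_interval 0 1 (\<lambda>t. \<mu> t x)"
    and meas: "\<And>x. (\<lambda>t. \<phi> t x) \<in> borel_measurable I01" and N0: "negligible N0"
    and der: "\<And>t x. t \<in> {0..1} - N0 \<Longrightarrow> ((\<lambda>s. \<mu> s x) has_real_derivative vel (\<mu> t) (\<phi> t) x) (at t within {0..1})"
    and weak: "weak_hamiltonian \<mu> \<phi>"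
  obtains \<psi> where "\<And>t x. t \<in> {0..1} \<Longrightarrow> ((\<lambda>s. \<mu> s x) has_real_derivative vel (\<mu> t) (\<psi> t) x) (at t within {0..1})"
    and "\<And>t x. t \<in> {0..1} \<Longrightarrow> ((\<lambda>s. \<psi> s x) has_real_derivative - force (\<mu> t) (\<psi> t) x) (at t within {0..1})"
proof -
  let ?f = "\<lambda>x t. force (\<mu> t) (\<phi> t) x"
  have cont: "continuous_on {0..1} (\<lambda>t. \<mu> t x)" for x
    using ac by (rule abs_continuous_on_interval_imp_continuous_on)
  have "\<exists>E N. negligible N \<and> (\<forall>t\<in>{l..r} - N. energy (\<mu> t) (\<phi> t) = E)" if lr: "0 < l" "l < r" "r < 1" for l r
  proof -
    have sub: "{l..r} \<subseteq> {0..1}" using lr by auto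
    obtain C N where CN: "\<And>x. negligible (N x)" "\<And>x t. t \<in> {l..r} - N x \<Longrightarrow> \<phi> t x = C x - integral {l..t} (?f x)"
      using weak_hamiltonian_integral_form(2)[OF weak lr] by metis
    define N1 where "N1 = N0 \<union> \<Union> (range N)"
    have N1: "negligible N1"
      unfolding N1_def using N0 CN(1) by (intro negligible_Un negligible_Union) auto
    obtain \<psi> where \<psi>: "\<And>t. t \<in> {l..r} - N1 \<Longrightarrow> \<phi> t = \<psi> t"
      "\<And>t x. t \<in> {l..r} \<Longrightarrow> ((\<lambda>s. \<mu> s x) has_real_derivative vel (\<mu> t) (\<psi> t) x) (at t within {l..r})"
      "\<And>t x. t \<in> {l..r} \<Longrightarrow> ((\<lambda>s. \<psi> s x) has_real_derivative - force (\<mu> t) (\<psi> t) x) (at t within {l..r})"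
    proof (rule hamiltonian_of_integral_form[OF lr(2) _ _ N1, where \<mu> = \<mu> and \<phi> = \<phi> and C = C])
      show "\<mu> t \<in> pos_densities" if "t \<in> {l..r}" for t using pos sub that by blast
      show "abs_continuous_on_interval l r (\<lambda>t. \<mu> t x)" for x
        by (rule abs_continuous_on_interval_subinterval[OF ac]) (use lr in auto)
      show "((\<lambda>s. \<mu> s x) has_real_derivative vel (\<mu> t) (\<phi> t) x) (at t within {l..r})" if "t \<in> {l..r} - N1" for t x
        by (rule has_field_derivative_subset[OF der sub]) (use that sub in \<open>auto simp: N1_def\<close>)
      show "?f x integrable_on {l..r}" for x
        using weak_hamiltonian_integral_form(1)[OF weak lr] by (rule set_lebesgue_integral_eq_integral(1))
      show "\<phi> t x = C x - integral {l..t} (?f x)" if "t \<in> {l..r} - N1" for t x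
        using CN(2)[of t x] that by (auto simp: N1_def)
    qed blast
    obtain E where "\<And>t. t \<in> {l..r} \<Longrightarrow> energy (\<mu> t) (\<psi> t) = E"
      using energy_constant[of l r \<mu> \<psi>] pos sub \<psi>(2,3) by (metis subsetD)
    then show ?thesis using N1 \<psi>(1) by (intro exI[of _ E] exI[of _ N1]) auto
  qed
  then obtain E NE where E: "negligible NE" "\<And>t. t \<in> {0..1} - NE \<Longrightarrow> energy (\<mu> t) (\<phi> t) = E"
    using constant_on_exhaustion[of "\<lambda>t. energy (\<mu> t) (\<phi> t)"] by metis
  obtain R B where B: "\<And>t \<phi> x. t \<in> {0..1} \<Longrightarrow> energy (\<mu> t) \<phi> \<le> E \<Longrightarrow> \<bar>\<phi> x\<bar> \<le> B"
    using potential_bounded[OF pos cont, of E] by metis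
  obtain lo hi where lo: "0 < lo" and range: "\<And>t x. t \<in> {0..1} \<Longrightarrow> lo \<le> \<mu> t x \<and> \<mu> t x \<le> hi"
    using curve_range[OF pos cont] by blast
  obtain M where M: "\<And>m \<phi> x. (\<And>y. lo \<le> m y \<and> m y \<le> hi) \<Longrightarrow> (\<And>y. \<bar>\<phi> y\<bar> \<le> B) \<Longrightarrow> \<bar>force m \<phi> x\<bar> \<le> M"
    using force_bounded[OF lo, of hi B] by metis
  have fM: "\<bar>?f x t\<bar> \<le> M" if "t \<in> {0..1} - NE" for t x
    by (rule M) (use that range E(2)[OF that] B[of t "\<phi> t"] in auto)
  have fi: "?f x integrable_on {0..1}" for x
  proof -
    have "integrable I01 (?f x)"
    proof (rule finite_measure.integrable_const_bound)
      show "finite_measure I01" by (rule finite_measureI) (simp add: emeasure_restrict_space)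
      show "AE t in I01. norm (?f x t) \<le> M"
        by (rule negligible_AE_lebesgue_on[OF E(1)]) (use fM in auto)
      show "?f x \<in> borel_measurable I01" by (rule measurable_force[OF pos cont meas])
    qed
    then show ?thesis by (simp add: integrable_lebesgue_on_iff set_lebesgue_integral_eq_integral(1))
  qed
  have "\<exists>c N. negligible N \<and> (\<forall>t\<in>{0..1} - N. \<phi> t x + integral {0..t} (?f x) = c)" for x
  proof -
    have "\<exists>c N. negligible N \<and> (\<forall>t\<in>{l..r} - N. \<phi> t x + integral {0..t} (?f x) = c)" if lr: "0 < l" "l < r" "r < 1" for l r
    proof -
      obtain C N where CN: "negligible N" "\<And>t. t \<in> {l..r} - N \<Longrightarrow> \<phi> t x = C - integral {l..t} (?f x)"
        using weak_hamiltonian_integral_form(2)[OF weak lr] by metis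
      have split: "integral {0..t} (?f x) = integral {0..l} (?f x) + integral {l..t} (?f x)" if "t \<in> {l..r}" for t
      proof -
        have "?f x integrable_on {0..t}" by (rule integrable_subinterval_real[OF fi]) (use that lr in auto)
        then show ?thesis using Henstock_Kurzweil_Integration.integral_combine[of 0 l t "?f x"] that lr by simp
      qed
      have "\<phi> t x + integral {0..t} (?f x) = C + integral {0..l} (?f x)" if "t \<in> {l..r} - N" for t
      proof -
        have "t \<in> {l..r}" using that by simp
        from split[OF this] CN(2)[OF that] show ?thesis by linarith
      qed
      then show ?thesis using CN(1) by blast
    qed
    then show ?thesis by (rule constant_on_exhaustion)
  qed
  then obtain C N where CN: "\<And>x. negligible (N x)" "\<And>x t. t \<in> {0..1} - N x \<Longrightarrow> \<phi> t x + integral {0..t} (?f x) = C x"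
    by metis
  define N1 where "N1 = N0 \<union> \<Union> (range N)"
  have N1: "negligible N1"
    unfolding N1_def using N0 CN(1) by (intro negligible_Un negligible_Union) auto
  show thesis
  proof (rule hamiltonian_of_integral_form[OF _ pos ac N1, where \<phi> = \<phi> and C = C])
    show "\<phi> t x = C x - integral {0..t} (?f x)" if "t \<in> {0..1} - N1" for t x
      using CN(2)[of t x] that by (auto simp: N1_def)
    show "((\<lambda>s. \<mu> s x) has_real_derivative vel (\<mu> t) (\<phi> t) x) (at t within {0..1})" if "t \<in> {0..1} - N1" for t x
      by (rule der) (use that in \<open>auto simp: N1_def\<close>)
    fix \<psi>
    assume H: "\<And>t x. t \<in> {0..1} \<Longrightarrow> ((\<lambda>s. \<mu> s x) has_real_derivative vel (\<mu> t) (\<psi> t) x) (at t within {0..1})"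
      "\<And>t x. t \<in> {0..1} \<Longrightarrow> ((\<lambda>s. \<psi> s x) has_real_derivative - force (\<mu> t) (\<psi> t) x) (at t within {0..1})"
    show thesis using H by (rule that)
  qed (use fi in auto)
qed

section \<open>Geodesics solve the weak equations\<close>

lemma pairing_add_bump:
  "pairing f (\<lambda>y. g y + e * (if y = x then z else 0)) = pairing f g + e * (f x * z * \<pi> x)"
proof -
  have "f y * (g y + e * (if y = x then z else 0)) * \<pi> y = f y * g y * \<pi> y + (if y = x then e * (f x * z * \<pi> x) else 0)" for y
    by (simp add: algebra_simps)
  then show ?thesis by (simp add: pairing_def sum.distrib)
qed

text \<open>First variation, one-sided. Only the component \<open>x\<close> of the density is perturbed, by \<open>\<epsilon> \<zeta>\<close>, and the
  perturbed velocity is generated by the potential \<open>f \<epsilon>\<close>. Comparing the energies of both curves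
  through the dual inequality at the perturbed curve gives an upper bound for the increase of the
  action without differentiating it; minimality makes the bound nonnegative for each \<open>\<epsilon>\<close>, and dominated
  convergence passes to \<open>\<epsilon> = 0\<close>.\<close>

lemma weak_inequality_if_geodesic:
  assumes pos: "\<And>t. t \<in> {0..1} \<Longrightarrow> \<mu> t \<in> pos_densities"
    and ac: "\<And>x. abs_continuous_on_interval 0 1 (\<lambda>t. \<mu> t x)"
    and meas: "\<And>x. (\<lambda>t. \<phi> t x) \<in> borel_measurable I01" and N0: "negligible N0"
    and der: "\<And>t x. t \<in> {0..1} - N0 \<Longrightarrow> ((\<lambda>s. \<mu> s x) has_real_derivative vel (\<mu> t) (\<phi> t) x) (at t within {0..1})"
    and geo: "constant_speed_geodesic W \<mu>" and \<zeta>: "\<zeta> \<in> C1c_unit_interval"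
  shows "integrable I01 (\<lambda>t. \<phi> t x * deriv \<zeta> t)" "integrable I01 (\<lambda>t. force (\<mu> t) (\<phi> t) x * \<zeta> t)"
    and "0 \<le> (LINT t|I01. \<phi> t x * deriv \<zeta> t - force (\<mu> t) (\<phi> t) x * \<zeta> t)"
proof -
  have cont: "continuous_on {0..1} (\<lambda>t. \<mu> t x)" for x
    using ac by (rule abs_continuous_on_interval_imp_continuous_on)
  define c where "c = W (\<mu> 0) (\<mu> 1)"
  have speed: "\<forall>s\<in>{0..1}. \<forall>t\<in>{0..1}. W (\<mu> s) (\<mu> t) = \<bar>t - s\<bar> * c"
    using geo unfolding constant_speed_geodesic_def c_def by blast
  have en: "energy (\<mu> t) (\<phi> t) \<le> c\<^sup>2" if "t \<in> {0..1} - N0" for t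
  proof (rule energy_le_metric_speed[OF pos])
    show "W (\<mu> t) (\<mu> s) = \<bar>s - t\<bar> * c" if "s \<in> {0..1}" for s
      using speed \<open>t \<in> {0..1} - N0\<close> that by blast
  qed (use that der in auto)
  have "\<exists>R B. (\<forall>t \<phi> x. t \<in> {0..1} \<longrightarrow> energy (\<mu> t) \<phi> \<le> c\<^sup>2 \<longrightarrow> \<bar>vel (\<mu> t) \<phi> x\<bar> \<le> R \<and> \<bar>\<phi> x\<bar> \<le> B)"
  proof (rule potential_bounded[where \<mu> = \<mu> and E = "c\<^sup>2"])
    fix R B
    assume "\<And>t \<phi> x. t \<in> {0..1} \<Longrightarrow> energy (\<mu> t) \<phi> \<le> c\<^sup>2 \<Longrightarrow> \<bar>vel (\<mu> t) \<phi> x\<bar> \<le> R"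
      and "\<And>t \<phi> x. t \<in> {0..1} \<Longrightarrow> energy (\<mu> t) \<phi> \<le> c\<^sup>2 \<Longrightarrow> \<bar>\<phi> x\<bar> \<le> B"
    then show ?thesis by (intro exI[of _ R] exI[of _ B] allI impI conjI)
  qed (rule pos cont; assumption)+
  then obtain R B where R0: "\<And>t \<phi> x. t \<in> {0..1} \<Longrightarrow> energy (\<mu> t) \<phi> \<le> c\<^sup>2 \<Longrightarrow> \<bar>vel (\<mu> t) \<phi> x\<bar> \<le> R"
    and B0: "\<And>t \<phi> x. t \<in> {0..1} \<Longrightarrow> energy (\<mu> t) \<phi> \<le> c\<^sup>2 \<Longrightarrow> \<bar>\<phi> x\<bar> \<le> B"
    by blast
  define \<rho> where "\<rho> t = vel (\<mu> t) (\<phi> t)" for t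
  have R: "\<bar>\<rho> t y\<bar> \<le> R" and B: "\<bar>\<phi> t y\<bar> \<le> B" if "t \<in> {0..1} - N0" for t y
    using R0[OF _ en[OF that]] B0[OF _ en[OF that]] that by (auto simp: \<rho>_def)
  obtain lo hi where lo: "0 < lo" and range: "\<And>t x. t \<in> {0..1} \<Longrightarrow> lo \<le> \<mu> t x \<and> \<mu> t x \<le> hi"
    using curve_range[OF pos cont] by blast
  have z0: "0 \<in> {0..1::real}" by simp
  have lohi: "lo \<le> hi" using range[OF z0, of x] by linarith
  obtain Z where Z: "0 \<le> Z" "\<And>t. t \<in> {0..1} \<Longrightarrow> \<bar>\<zeta> t\<bar> \<le> Z"
    using continuous_on_Icc_bounded[OF C1c_unit_intervalD(2)[OF \<zeta>]] by metis
  obtain Z' where Z': "0 \<le> Z'" "\<And>t. t \<in> {0..1} \<Longrightarrow> \<bar>deriv \<zeta> t\<bar> \<le> Z'"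
    using continuous_on_Icc_bounded[OF C1c_unit_intervalD(3)[OF \<zeta>]] by metis
  \<comment> \<open>For \<open>\<epsilon> \<le> \<epsilon>0\<close> the perturbed density stays above \<open>lo / 2\<close>, which makes all bounds below uniform.\<close>
  define \<epsilon>0 where "\<epsilon>0 = min 1 (lo / (2 * (Z + 1)))"
  have \<epsilon>0: "0 < \<epsilon>0" "\<epsilon>0 \<le> 1" "\<epsilon>0 * Z \<le> lo / 2"
  proof -
    show "0 < \<epsilon>0" "\<epsilon>0 \<le> 1" using lo Z by (auto simp: \<epsilon>0_def)
    have "\<epsilon>0 * Z \<le> lo / (2 * (Z + 1)) * (Z + 1)"
      using lo Z \<open>0 < \<epsilon>0\<close> by (intro mult_mono) (auto simp: \<epsilon>0_def)
    also have "\<dots> = lo / 2" using Z by (simp add: field_simps)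
    finally show "\<epsilon>0 * Z \<le> lo / 2" .
  qed
  define m where "m \<epsilon> t y = \<mu> t y + \<epsilon> * (if y = x then \<zeta> t else 0)" for \<epsilon> t y
  define r where "r \<epsilon> t y = \<rho> t y + \<epsilon> * (if y = x then deriv \<zeta> t else 0)" for \<epsilon> t y
  define f where "f \<epsilon> t = sol (m \<epsilon> t) (r \<epsilon> t)" for \<epsilon> t
  define g where "g \<epsilon> t = f \<epsilon> t x * deriv \<zeta> t - force (m \<epsilon> t) (f \<epsilon> t) x * \<zeta> t" for \<epsilon> t
  define g0 where "g0 t = \<phi> t x * deriv \<zeta> t - force (\<mu> t) (\<phi> t) x * \<zeta> t" for t
  have mr: "lo / 2 \<le> m \<epsilon> t y \<and> m \<epsilon> t y \<le> hi + lo / 2" if "0 \<le> \<epsilon>" "\<epsilon> \<le> \<epsilon>0" "t \<in> {0..1}" for \<epsilon> t y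
  proof -
    have "\<bar>\<epsilon> * (if y = x then \<zeta> t else 0)\<bar> \<le> \<epsilon>0 * Z"
      unfolding abs_mult using that Z by (intro mult_mono) auto
    then show ?thesis using range[OF that(3), of y] \<epsilon>0(3) unfolding m_def by linarith
  qed
  have rr: "\<bar>r \<epsilon> t y\<bar> \<le> R + Z'" if "0 \<le> \<epsilon>" "\<epsilon> \<le> \<epsilon>0" "t \<in> {0..1} - N0" for \<epsilon> t y
  proof -
    have "\<bar>\<epsilon> * (if y = x then deriv \<zeta> t else 0)\<bar> \<le> 1 * Z'"
      unfolding abs_mult using that Z' \<epsilon>0 by (intro mult_mono) auto
    then show ?thesis using R[OF that(3), of y] unfolding r_def by linarith
  qed
  obtain B1 where B1: "\<And>m \<rho> k. (\<And>x. lo / 2 \<le> m x \<and> m x \<le> hi + lo / 2) \<Longrightarrow> (\<And>x. \<bar>\<rho> x\<bar> \<le> R + Z') \<Longrightarrow> \<bar>sol m \<rho> k\<bar> \<le> B1"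
    using sol_bounded[of "lo / 2" "hi + lo / 2" "R + Z'"] lo by (metis half_gt_zero)
  have fB: "\<bar>f \<epsilon> t y\<bar> \<le> B1" if "0 \<le> \<epsilon>" "\<epsilon> \<le> \<epsilon>0" "t \<in> {0..1} - N0" for \<epsilon> t y
    unfolding f_def by (rule B1) (use mr rr that in auto)
  obtain M where M: "\<And>m \<phi> x. (\<And>y. lo / 2 \<le> m y \<and> m y \<le> hi + lo / 2) \<Longrightarrow> (\<And>y. \<bar>\<phi> y\<bar> \<le> B1) \<Longrightarrow> \<bar>force m \<phi> x\<bar> \<le> M"
    using force_bounded[of "lo / 2" "hi + lo / 2" B1] lo by (metis half_gt_zero)
  have FM: "\<bar>force (m \<epsilon> t) (f \<epsilon> t) y\<bar> \<le> M" if "0 \<le> \<epsilon>" "\<epsilon> \<le> \<epsilon>0" "t \<in> {0..1} - N0" for \<epsilon> t y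
    by (rule M) (use mr fB that in auto)
  have f0: "f 0 t = \<phi> t" "m 0 t = \<mu> t" if "t \<in> {0..1}" for t
  proof -
    show m0: "m 0 t = \<mu> t" by (rule ext) (simp add: m_def)
    have "r 0 t = \<rho> t" by (rule ext) (simp add: r_def)
    then show "f 0 t = \<phi> t" using vel_eq_iff_sol[OF pos[OF that], of "\<phi> t" "\<rho> t"] by (simp add: f_def m0 \<rho>_def)
  qed
  have mpos: "m \<epsilon> t \<in> pos_densities" if "0 \<le> \<epsilon>" "\<epsilon> \<le> \<epsilon>0" "t \<in> {0..1}" for \<epsilon> t
    using mr[OF that] lo unfolding pos_densities_def by (smt (verit) half_gt_zero mem_Collect_eq)
  have mac: "abs_continuous_on_interval 0 1 (\<lambda>t. m \<epsilon> t y)" for \<epsilon> y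
    unfolding m_def
  proof (rule abs_continuous_on_interval_add[OF ac])
    show "abs_continuous_on_interval 0 1 (\<lambda>t. \<epsilon> * (if y = x then \<zeta> t else 0))"
    proof (rule abs_continuous_on_interval_C1)
      show "((\<lambda>t. \<epsilon> * (if y = x then \<zeta> t else 0)) has_real_derivative \<epsilon> * (if y = x then deriv \<zeta> t else 0)) (at t within {0..1})" for t
        using has_field_derivative_at_within[OF C1c_unit_intervalD(1)[OF \<zeta>]]
        by (cases "y = x") (auto intro!: DERIV_cmult)
      show "continuous_on {0..1} (\<lambda>t. \<epsilon> * (if y = x then deriv \<zeta> t else 0))"
        using C1c_unit_intervalD(3)[OF \<zeta>] by (cases "y = x") (auto intro!: continuous_intros)
    qed
  qed
  have mcont: "continuous_on {0..1} (\<lambda>t. m \<epsilon> t y)" for \<epsilon> y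
    using mac by (rule abs_continuous_on_interval_imp_continuous_on)
  have rmeas: "(\<lambda>t. r \<epsilon> t y) \<in> borel_measurable I01" for \<epsilon> y
  proof -
    have "(\<lambda>t. \<rho> t y) \<in> borel_measurable I01"
      unfolding \<rho>_def by (rule measurable_vel[OF pos cont meas])
    moreover have "deriv \<zeta> \<in> borel_measurable I01"
      by (rule continuous_imp_measurable_I01[OF C1c_unit_intervalD(3)[OF \<zeta>]])
    ultimately show ?thesis unfolding r_def by (cases "y = x") auto
  qed
  have fmeas: "(\<lambda>t. f \<epsilon> t y) \<in> borel_measurable I01" if "0 \<le> \<epsilon>" "\<epsilon> \<le> \<epsilon>0" for \<epsilon> y
    unfolding f_def
  proof (rule measurable_sol)
    show "m \<epsilon> t \<in> nonneg_densities" if "t \<in> space I01" for t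
      using that by (intro pos_densities_nonneg mpos \<open>0 \<le> \<epsilon>\<close> \<open>\<epsilon> \<le> \<epsilon>0\<close>) simp
  qed (intro continuous_imp_measurable_I01 mcont rmeas)+
  have Fmeas: "(\<lambda>t. force (m \<epsilon> t) (f \<epsilon> t) y) \<in> borel_measurable I01" if "0 \<le> \<epsilon>" "\<epsilon> \<le> \<epsilon>0" for \<epsilon> y
    by (rule measurable_force[OF mpos[OF that] mcont fmeas[OF that]])
  have zmeas [measurable]: "\<zeta> \<in> borel_measurable I01" "deriv \<zeta> \<in> borel_measurable I01"
    using C1c_unit_intervalD(2,3)[OF \<zeta>] by (auto intro: continuous_imp_measurable_I01)
  have gi: "integrable I01 (\<lambda>t. f \<epsilon> t x * deriv \<zeta> t)" "integrable I01 (\<lambda>t. force (m \<epsilon> t) (f \<epsilon> t) x * \<zeta> t)"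
    and gB: "\<And>t. t \<in> {0..1} - N0 \<Longrightarrow> \<bar>g \<epsilon> t\<bar> \<le> B1 * Z' + M * Z"
    if \<epsilon>: "0 \<le> \<epsilon>" "\<epsilon> \<le> \<epsilon>0" for \<epsilon>
  proof -
    have b1: "\<bar>f \<epsilon> t x * deriv \<zeta> t\<bar> \<le> B1 * Z'" if "t \<in> {0..1} - N0" for t
      unfolding abs_mult by (intro mult_mono fB[OF \<epsilon> that] Z') (use that order_trans[OF abs_ge_zero fB[OF \<epsilon> that]] in auto)
    have b2: "\<bar>force (m \<epsilon> t) (f \<epsilon> t) x * \<zeta> t\<bar> \<le> M * Z" if "t \<in> {0..1} - N0" for t
      unfolding abs_mult by (intro mult_mono FM[OF \<epsilon> that] Z) (use that order_trans[OF abs_ge_zero FM[OF \<epsilon> that]] in auto)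
    show "integrable I01 (\<lambda>t. f \<epsilon> t x * deriv \<zeta> t)"
      by (rule integrable_I01_bounded[OF _ N0 b1]) (use fmeas[OF \<epsilon>] in simp_all)
    show "integrable I01 (\<lambda>t. force (m \<epsilon> t) (f \<epsilon> t) x * \<zeta> t)"
      by (rule integrable_I01_bounded[OF _ N0 b2]) (use Fmeas[OF \<epsilon>] in simp_all)
    show "\<bar>g \<epsilon> t\<bar> \<le> B1 * Z' + M * Z" if "t \<in> {0..1} - N0" for t
      using b1[OF that] b2[OF that] unfolding g_def by linarith
  qed
  have gint: "integrable I01 (g \<epsilon>)" if "0 \<le> \<epsilon>" "\<epsilon> \<le> \<epsilon>0" for \<epsilon>
    unfolding g_def by (intro Bochner_Integration.integrable_diff gi that)
  have \<epsilon>00: "0 \<le> \<epsilon>0" using \<epsilon>0 by simp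
  have f0': "(\<phi> t, \<mu> t) = (f 0 t, m 0 t)" if "t \<in> space I01" for t using f0[of t] that by simp
  show "integrable I01 (\<lambda>t. \<phi> t x * deriv \<zeta> t)"
    using gi(1)[OF order_refl \<epsilon>00] by (rule Bochner_Integration.integrable_cong[THEN iffD1, OF refl, rotated]) (use f0 in simp)
  show "integrable I01 (\<lambda>t. force (\<mu> t) (\<phi> t) x * \<zeta> t)"
    using gi(2)[OF order_refl \<epsilon>00] by (rule Bochner_Integration.integrable_cong[THEN iffD1, OF refl, rotated]) (use f0 in simp)
  have variation: "0 \<le> (LINT t|I01. g \<epsilon> t)" if \<epsilon>: "0 < \<epsilon>" "\<epsilon> \<le> \<epsilon>0" for \<epsilon>
  proof -
    have \<epsilon>': "0 \<le> \<epsilon>" using \<epsilon> by simp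
    have vel: "vel (m \<epsilon> t) (f \<epsilon> t) = r \<epsilon> t" if "t \<in> {0..1}" for t
      unfolding f_def by (rule vel_sol[OF mpos[OF \<epsilon>' \<epsilon>(2) that]])
    have "((\<lambda>t. m \<epsilon> t y) has_real_derivative vel (m \<epsilon> t) (f \<epsilon> t) y) (at t within {0..1})"
      if t: "t \<in> {0..1} - N0" for t y
    proof -
      have "((\<lambda>t. \<epsilon> * (if y = x then \<zeta> t else 0)) has_real_derivative \<epsilon> * (if y = x then deriv \<zeta> t else 0)) (at t within {0..1})"
        using has_field_derivative_at_within[OF C1c_unit_intervalD(1)[OF \<zeta>]]
        by (cases "y = x") (auto intro!: DERIV_cmult)
      from DERIV_add[OF der[OF t, of y] this]
      have d: "((\<lambda>t. m \<epsilon> t y) has_real_derivative vel (\<mu> t) (\<phi> t) y + \<epsilon> * (if y = x then deriv \<zeta> t else 0)) (at t within {0..1})"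
        by (simp only: m_def)
      have v: "vel (m \<epsilon> t) (f \<epsilon> t) y = vel (\<mu> t) (\<phi> t) y + \<epsilon> * (if y = x then deriv \<zeta> t else 0)"
        using vel[of t] t by (simp add: r_def \<rho>_def)
      show ?thesis unfolding v by (rule d)
    qed
    then have ae: "AE t in I01. \<forall>y. ((\<lambda>t. m \<epsilon> t y) has_real_derivative vel (m \<epsilon> t) (f \<epsilon> t) y) (at t within {0..1})"
      by (intro negligible_AE_lebesgue_on[OF N0]) auto
    note pc = potential_curve[OF mpos[OF \<epsilon>' \<epsilon>(2)] mac fmeas[OF \<epsilon>' \<epsilon>(2)] ae]
    have ends: "m \<epsilon> 0 = \<mu> 0" "m \<epsilon> 1 = \<mu> 1"
      using C1c_unit_intervalD(4)[OF \<zeta>, of 0] C1c_unit_intervalD(4)[OF \<zeta>, of 1] by (auto simp: m_def intro!: ext)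
    define G where "G t = c\<^sup>2 + 2 * \<epsilon> * \<pi> x * g \<epsilon> t" for t
    have le: "energy (m \<epsilon> t) (f \<epsilon> t) \<le> G t" if t: "t \<in> {0..1} - N0" for t
    proof -
      have t': "t \<in> {0..1}" using t by simp
      have mp: "m \<epsilon> t \<in> pos_densities" by (rule mpos[OF \<epsilon>' \<epsilon>(2) t'])
      have "2 * pairing (f \<epsilon> t) (\<rho> t) \<le> energy (\<mu> t) (f \<epsilon> t) + energy (\<mu> t) (\<phi> t)"
        unfolding \<rho>_def by (rule pairing_vel_le_energy[OF pos_densities_nonneg[OF pos[OF t']]])
      moreover have "energy (\<mu> t) (f \<epsilon> t) \<le> source (f \<epsilon> t) + 2 * pairing (force (m \<epsilon> t) (f \<epsilon> t)) (\<mu> t)"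
        by (rule energy_le_tangent[OF mp pos_densities_nonneg[OF pos[OF t']]])
      moreover have "energy (m \<epsilon> t) (f \<epsilon> t) = source (f \<epsilon> t) + 2 * pairing (force (m \<epsilon> t) (f \<epsilon> t)) (m \<epsilon> t)"
        by (rule energy_eq_tangent[OF mp])
      moreover have "energy (m \<epsilon> t) (f \<epsilon> t) = pairing (f \<epsilon> t) (r \<epsilon> t)"
        using pairing_vel_self[OF pos_densities_nonneg[OF mp], of "f \<epsilon> t"] vel[OF t'] by simp
      moreover have "pairing (f \<epsilon> t) (r \<epsilon> t) = pairing (f \<epsilon> t) (\<rho> t) + \<epsilon> * (f \<epsilon> t x * deriv \<zeta> t * \<pi> x)"
        unfolding pairing_add_bump[symmetric]
        by (rule arg_cong[where f = "pairing _"]) (simp add: r_def fun_eq_iff)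
      moreover have "pairing (force (m \<epsilon> t) (f \<epsilon> t)) (m \<epsilon> t)
          = pairing (force (m \<epsilon> t) (f \<epsilon> t)) (\<mu> t) + \<epsilon> * (force (m \<epsilon> t) (f \<epsilon> t) x * \<zeta> t * \<pi> x)"
        unfolding pairing_add_bump[symmetric]
        by (rule arg_cong[where f = "pairing _"]) (simp add: m_def fun_eq_iff)
      moreover have "2 * \<epsilon> * \<pi> x * g \<epsilon> t = 2 * (\<epsilon> * (f \<epsilon> t x * deriv \<zeta> t * \<pi> x)) - 2 * (\<epsilon> * (force (m \<epsilon> t) (f \<epsilon> t) x * \<zeta> t * \<pi> x))"
        by (simp add: g_def algebra_simps)
      ultimately show ?thesis using en[OF t] unfolding G_def by linarith
    qed
    have Gi: "integrable I01 G"
      unfolding G_def by (intro Bochner_Integration.integrable_add integrable_mult_right gint \<epsilon>' \<epsilon>)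
        (auto simp: integrable_lebesgue_on_iff intro!: absolutely_integrable_continuous_real)
    have aele: "AE t in I01. energy (m \<epsilon> t) (f \<epsilon> t) \<le> G t"
      by (rule negligible_AE_lebesgue_on[OF N0]) (use le in auto)
    have aen: "AE t in I01. 0 \<le> G t"
    proof (rule negligible_AE_lebesgue_on[OF N0])
      show "0 \<le> G t" if "t \<in> {0..1} - N0" for t
        using le[OF that] energy_nonneg[OF pos_densities_nonneg[OF mpos[OF \<epsilon>' \<epsilon>(2)]], of t "f \<epsilon> t"] that by simp
    qed simp
    have "(W (\<mu> 0) (\<mu> 1))\<^sup>2 \<le> (LINT t|I01. G t)"
      unfolding ends[symmetric]
    proof (rule dist_le_action[OF pc(1)])
      have "(\<integral>\<^sup>+ t. ennreal (energy (m \<epsilon> t) (f \<epsilon> t)) \<partial>I01) \<le> (\<integral>\<^sup>+ t. ennreal (G t) \<partial>I01)"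
        using aele by (intro nn_integral_mono_AE) (auto elim!: eventually_mono intro: ennreal_leI)
      also have "\<dots> = ennreal (LINT t|I01. G t)" by (rule nn_integral_eq_integral[OF Gi aen])
      finally show "action K \<pi> a b (m \<epsilon>) (\<lambda>t x. f \<epsilon> t x / b\<^sup>2) (\<lambda>t. pairing (f \<epsilon> t) p / a\<^sup>2) \<le> ennreal (LINT t|I01. G t)"
        by (simp only: pc(2))
      show "0 \<le> (LINT t|I01. G t)" using aen by (rule integral_nonneg_AE)
    qed
    also have "(LINT t|I01. G t) = c\<^sup>2 + 2 * \<epsilon> * \<pi> x * (LINT t|I01. g \<epsilon> t)"
    proof -
      have "integrable I01 (\<lambda>t. c\<^sup>2)"
        by (auto simp: integrable_lebesgue_on_iff intro!: absolutely_integrable_continuous_real)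
      then have "(LINT t|I01. G t) = (LINT t|I01. c\<^sup>2) + (LINT t|I01. 2 * \<epsilon> * \<pi> x * g \<epsilon> t)"
        unfolding G_def by (intro Bochner_Integration.integral_add integrable_mult_right gint \<epsilon>' \<epsilon>)
      then show ?thesis by (simp add: measure_restrict_space)
    qed
    finally have "0 \<le> 2 * \<epsilon> * \<pi> x * (LINT t|I01. g \<epsilon> t)" by (simp add: c_def)
    moreover have "0 < 2 * \<epsilon> * \<pi> x" using \<epsilon> \<pi>_pos[of x] by simp
    ultimately show ?thesis by (metis mult_le_cancel_left_pos mult_zero_right)
  qed
  define e where "e n = \<epsilon>0 / real (Suc n)" for n
  have e: "0 < e n" "e n \<le> \<epsilon>0" for n
    using \<epsilon>0 by (auto simp: e_def divide_le_eq mult_left_le[of _ \<epsilon>0] intro!: mult_le_cancel_left1[THEN iffD2])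
  have e0: "e \<longlonglongrightarrow> 0" unfolding e_def[abs_def]
    using tendsto_mult_right_zero[OF LIMSEQ_inverse_real_of_nat, of \<epsilon>0] by (simp add: divide_inverse)
  have "(\<lambda>n. LINT t|I01. g (e n) t) \<longlonglongrightarrow> (LINT t|I01. g0 t)"
  proof (rule integral_dominated_convergence[where w = "\<lambda>_. B1 * Z' + M * Z"])
    show "g0 \<in> borel_measurable I01"
      unfolding g0_def using meas measurable_force[OF pos cont meas] by simp
    show "g (e n) \<in> borel_measurable I01" for n
      using gint[of "e n"] e[of n] by (simp add: borel_measurable_integrable)
    show "integrable I01 (\<lambda>_. B1 * Z' + M * Z)"
      by (auto simp: integrable_lebesgue_on_iff intro!: absolutely_integrable_continuous_real)
    show "AE t in I01. norm (g (e n) t) \<le> B1 * Z' + M * Z" for n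
      by (rule negligible_AE_lebesgue_on[OF N0]) (use gB[of "e n"] e[of n] in auto)
    show "AE t in I01. (\<lambda>n. g (e n) t) \<longlonglongrightarrow> g0 t"
    proof (rule negligible_AE_lebesgue_on[OF N0])
      fix t assume t: "t \<in> {0..1} - N0"
      then have t': "t \<in> {0..1}" by simp
      have ml: "(\<lambda>n. m (e n) t y) \<longlonglongrightarrow> \<mu> t y" for y
        unfolding m_def by (rule tendsto_eq_intros | rule e0 | simp)+
      have rl: "(\<lambda>n. r (e n) t y) \<longlonglongrightarrow> \<rho> t y" for y
        unfolding r_def by (rule tendsto_eq_intros | rule e0 | simp)+
      have sl: "sol (\<mu> t) (\<rho> t) = \<phi> t"
        using vel_eq_iff_sol[OF pos[OF t'], of "\<phi> t" "\<rho> t"] by (simp add: \<rho>_def)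
      have fl: "(\<lambda>n. f (e n) t y) \<longlonglongrightarrow> \<phi> t y" for y
      proof -
        have "(\<lambda>n. sol (m (e n) t) (r (e n) t) y) \<longlonglongrightarrow> sol (\<mu> t) (\<rho> t) y"
          by (rule tendsto_sol[OF pos[OF t'] ml rl])
        then show ?thesis unfolding sl f_def .
      qed
      have "(\<lambda>n. force (m (e n) t) (f (e n) t) x) \<longlonglongrightarrow> force (\<mu> t) (\<phi> t) x"
        by (rule tendsto_force[OF pos[OF t'] ml fl])
      then show "(\<lambda>n. g (e n) t) \<longlonglongrightarrow> g0 t"
        unfolding g_def g0_def by (intro tendsto_intros fl)
    qed simp
  qed
  then show "0 \<le> (LINT t|I01. \<phi> t x * deriv \<zeta> t - force (\<mu> t) (\<phi> t) x * \<zeta> t)"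
    unfolding g0_def by (rule LIMSEQ_le_const) (use variation e in auto)
qed

text \<open>The inequality for \<open>\<zeta>\<close> and for \<open>- \<zeta>\<close>.\<close>

lemma weak_if_geodesic:
  assumes pos: "\<And>t. t \<in> {0..1} \<Longrightarrow> \<mu> t \<in> pos_densities"
    and ac: "\<And>x. abs_continuous_on_interval 0 1 (\<lambda>t. \<mu> t x)"
    and meas: "\<And>x. (\<lambda>t. \<phi> t x) \<in> borel_measurable I01" and N0: "negligible N0"
    and der: "\<And>t x. t \<in> {0..1} - N0 \<Longrightarrow> ((\<lambda>s. \<mu> s x) has_real_derivative vel (\<mu> t) (\<phi> t) x) (at t within {0..1})"
    and geo: "constant_speed_geodesic W \<mu>"
  shows "weak_hamiltonian \<mu> \<phi>"
  unfolding weak_hamiltonian_def weak_decay_def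
proof (intro ballI allI)
  fix \<zeta> x assume \<zeta>: "\<zeta> \<in> C1c_unit_interval"
  note 1 = weak_inequality_if_geodesic[OF pos ac meas N0 der geo \<zeta>, of x]
  note 2 = weak_inequality_if_geodesic[OF pos ac meas N0 der geo uminus_C1c(1)[OF \<zeta>], of x]
  have "0 \<le> (LINT t|I01. \<phi> t x * deriv \<zeta> t) - (LINT t|I01. force (\<mu> t) (\<phi> t) x * \<zeta> t)"
    using 1 by simp
  moreover have "0 \<le> (LINT t|I01. \<phi> t x * - deriv \<zeta> t) - (LINT t|I01. force (\<mu> t) (\<phi> t) x * - \<zeta> t)"
    using 2 unfolding uminus_C1c(2)[OF \<zeta>] by simp
  ultimately show "integrable I01 (\<lambda>t. \<phi> t x * deriv \<zeta> t) \<and> integrable I01 (\<lambda>t. force (\<mu> t) (\<phi> t) x * \<zeta> t) \<and>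
     (LINT t|I01. \<phi> t x * deriv \<zeta> t) = (LINT t|I01. force (\<mu> t) (\<phi> t) x * \<zeta> t)"
    using 1(1,2) by simp
qed

section \<open>The geodesic equations\<close>

text \<open>The constant in \<open>b\<^sup>2 \<psi> + const\<close> is fixed by \<open>\<langle>\<phi>, p\<rangle> = a\<^sup>2 h\<close>, using that \<open>p\<close> has mass one. Only
  differences of \<open>\<psi>\<close> enter, as \<open>\<psi>\<close> itself is not determined by the curve.\<close>

definition potential :: "('x \<Rightarrow> real) \<Rightarrow> real \<Rightarrow> 'x \<Rightarrow> real" where
  "potential \<psi> h x = a\<^sup>2 * h - b\<^sup>2 * (\<Sum>y\<in>UNIV. (\<psi> y - \<psi> x) * \<pi> y * p y)"

lemma potential_eq: "potential \<psi> h x = a\<^sup>2 * h - b\<^sup>2 * (\<Sum>y\<in>UNIV. \<psi> y * \<pi> y * p y) + b\<^sup>2 * \<psi> x"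
proof -
  have "(\<Sum>y\<in>UNIV. (\<psi> y - \<psi> x) * \<pi> y * p y) = (\<Sum>y\<in>UNIV. \<psi> y * \<pi> y * p y) - \<psi> x * (\<Sum>y\<in>UNIV. \<pi> y * p y)"
    by (simp add: sum_distrib_left left_diff_distrib sum_subtractf mult.assoc)
  then show ?thesis by (simp add: potential_def p\<pi>_mass right_diff_distrib)
qed

lemma potential_diff: "potential \<psi> h y - potential \<psi> h x = b\<^sup>2 * (\<psi> y - \<psi> x)"
  by (simp add: potential_eq right_diff_distrib)

lemma pairing_potential: "pairing (potential \<psi> h) p = a\<^sup>2 * h"
proof -
  have "pairing (potential \<psi> h) p = (\<Sum>x\<in>UNIV. (a\<^sup>2 * h - b\<^sup>2 * (\<Sum>y\<in>UNIV. \<psi> y * \<pi> y * p y)) * (\<pi> x * p x) + b\<^sup>2 * (\<psi> x * \<pi> x * p x))"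
    by (simp add: pairing_def potential_eq algebra_simps)
  also have "\<dots> = (a\<^sup>2 * h - b\<^sup>2 * (\<Sum>y\<in>UNIV. \<psi> y * \<pi> y * p y)) + b\<^sup>2 * (\<Sum>y\<in>UNIV. \<psi> y * \<pi> y * p y)"
    by (simp only: sum.distrib sum_distrib_left[symmetric] p\<pi>_mass mult_1_right)
  finally show ?thesis by simp
qed

lemma vel_potential: "vel m (potential \<psi> h) x = flow m \<psi> h x"
  using a_pos b_pos
  by (simp add: vel_def flow_def pairing_potential potential_diff sum_distrib_left[symmetric] mult.assoc)

lemma force_potential:
  "force m (potential \<psi> h) x = b\<^sup>2 / 2 * (\<Sum>y\<in>UNIV. (grad \<psi> x y)\<^sup>2 * d1_mean (m x) (m y) * K x y)"
proof -
  have eq: "(b\<^sup>2 * (\<psi> y - \<psi> x))\<^sup>2 * d1_mean (m x) (m y) * K x y = b\<^sup>2 * b\<^sup>2 * ((grad \<psi> x y)\<^sup>2 * d1_mean (m x) (m y) * K x y)" for y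
    by (simp add: grad_def power_mult_distrib power2_eq_square mult_ac)
  show ?thesis
    unfolding force_def potential_diff eq sum_distrib_left[symmetric]
    using b_pos by (simp add: power4_eq_xxxx power2_eq_square)
qed

text \<open>Measurability comes from the curve: its derivative is a limit of difference quotients, and almost
  everywhere the potential is the image of that derivative under \<open>sol\<close>.\<close>

lemma measurable_potential:
  assumes pos: "\<And>t. t \<in> {0..1} \<Longrightarrow> \<mu> t \<in> pos_densities"
    and cont: "\<And>x. continuous_on {0..1} (\<lambda>t. \<mu> t x)" and N: "negligible N"
    and der: "\<And>t x. t \<in> {0..1} - N \<Longrightarrow> ((\<lambda>s. \<mu> s x) has_real_derivative vel (\<mu> t) (\<phi> t) x) (at t within {0..1})"
  shows "(\<lambda>t. \<phi> t x) \<in> borel_measurable I01"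
proof -
  \<comment> \<open>The minimum keeps the quotients defined on all of \<open>[0,1]\<close>; it is inactive for large \<open>n\<close> if \<open>t < 1\<close>.\<close>
  define s where "s n t = min 1 (t + inverse (real (Suc n)))" for n t
  define q where "q n t x = (\<mu> (s n t) x - \<mu> t x) / inverse (real (Suc n))" for n t x
  define \<rho> where "\<rho> t x = lim (\<lambda>n. q n t x)" for t x
  have s01: "s n t \<in> {0..1}" if "t \<in> {0..1}" for n t using that by (simp add: s_def)
  have "continuous_on {0..1} (\<lambda>t. q n t x)" for n x
  proof -
    have "continuous_on {0..1} (s n)" unfolding s_def by (intro continuous_intros)
    then have "continuous_on {0..1} (\<lambda>t. \<mu> (s n t) x)"
      by (rule continuous_on_compose2[OF cont]) (use s01 in auto)
    then show ?thesis unfolding q_def by (intro continuous_intros cont) auto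
  qed
  then have [measurable]: "(\<lambda>t. q n t x) \<in> borel_measurable I01" for n x
    by (rule continuous_imp_measurable_I01)
  have \<rho>m: "(\<lambda>t. \<rho> t x) \<in> borel_measurable I01" for x
    unfolding \<rho>_def by measurable
  have \<rho>: "\<rho> t x = vel (\<mu> t) (\<phi> t) x" if t: "t \<in> {0..1} - insert 1 N" for t x
  proof -
    have t1: "t < 1" "0 \<le> t" "t \<in> {0..1} - N" using t by auto
    have slope: "((\<lambda>r. (\<mu> r x - \<mu> t x) / (r - t)) \<longlongrightarrow> vel (\<mu> t) (\<phi> t) x) (at t within {0..1})"
      using der[OF t1(3)] by (simp add: has_field_derivative_iff)
    have "filterlim (\<lambda>n. t + inverse (real (Suc n))) (at t within {0..1}) sequentially"
      unfolding filterlim_at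
    proof
      have lim: "(\<lambda>n. t + inverse (real (Suc n))) \<longlonglongrightarrow> t"
        using tendsto_add[OF tendsto_const[of t] LIMSEQ_inverse_real_of_nat] by simp
      then show "(\<lambda>n. t + inverse (real (Suc n))) \<longlonglongrightarrow> t" .
      have "\<forall>\<^sub>F n in sequentially. t + inverse (real (Suc n)) < 1"
        using order_tendstoD(2)[OF lim t1(1)] .
      then show "\<forall>\<^sub>F n in sequentially. t + inverse (real (Suc n)) \<in> {0..1} \<and> t + inverse (real (Suc n)) \<noteq> t"
        by eventually_elim (use t1 in \<open>auto intro: add_nonneg_nonneg\<close>)
    qed
    from filterlim_compose[OF slope this]
    have "(\<lambda>n. (\<mu> (t + inverse (real (Suc n))) x - \<mu> t x) / inverse (real (Suc n))) \<longlonglongrightarrow> vel (\<mu> t) (\<phi> t) x"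
      by simp
    moreover have "\<forall>\<^sub>F n in sequentially. (\<mu> (t + inverse (real (Suc n))) x - \<mu> t x) / inverse (real (Suc n)) = q n t x"
    proof -
      have "(\<lambda>n. t + inverse (real (Suc n))) \<longlonglongrightarrow> t"
        using tendsto_add[OF tendsto_const[of t] LIMSEQ_inverse_real_of_nat] by simp
      from order_tendstoD(2)[OF this t1(1)] show ?thesis
        by eventually_elim (simp add: q_def s_def min_def)
    qed
    ultimately have "(\<lambda>n. q n t x) \<longlonglongrightarrow> vel (\<mu> t) (\<phi> t) x"
      by (rule Lim_transform_eventually)
    then show ?thesis unfolding \<rho>_def by (rule limI)
  qed
  have "(\<lambda>t. sol (\<mu> t) (\<rho> t) x) \<in> borel_measurable I01"
  proof (rule measurable_sol)
    show "\<mu> t \<in> nonneg_densities" if "t \<in> space I01" for t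
      using pos_densities_nonneg[OF pos] that by simp
  qed (intro continuous_imp_measurable_I01 cont \<rho>m)+
  then show ?thesis
  proof (rule measurable_I01_cong_negligible[where N = "insert 1 N"])
    show "negligible (insert 1 N)" using N by simp
    fix t assume t: "t \<in> {0..1} - insert 1 N"
    then have "\<rho> t = vel (\<mu> t) (\<phi> t)" using \<rho> by auto
    then show "sol (\<mu> t) (\<rho> t) x = \<phi> t x"
      using vel_eq_iff_sol[OF pos, of t "\<phi> t" "\<rho> t"] t by simp
  qed
qed

lemma geodesic_iff_weak_hamiltonian:
  assumes pos: "\<And>t. t \<in> {0..1} \<Longrightarrow> \<mu> t \<in> pos_densities"
    and ac: "\<And>x. abs_continuous_on_interval 0 1 (\<lambda>t. \<mu> t x)" and N: "negligible N"
    and der: "\<And>t x. t \<in> {0..1} - N \<Longrightarrow> ((\<lambda>s. \<mu> s x) has_real_derivative vel (\<mu> t) (\<phi> t) x) (at t within {0..1})"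
  shows "constant_speed_geodesic W \<mu> \<longleftrightarrow> weak_hamiltonian \<mu> \<phi>"
proof -
  have cont: "continuous_on {0..1} (\<lambda>t. \<mu> t x)" for x
    using ac by (rule abs_continuous_on_interval_imp_continuous_on)
  have meas: "(\<lambda>t. \<phi> t x) \<in> borel_measurable I01" for x
    by (rule measurable_potential[OF pos cont N der])
  show ?thesis
  proof
    assume "constant_speed_geodesic W \<mu>"
    then show "weak_hamiltonian \<mu> \<phi>" by (intro weak_if_geodesic[OF pos ac meas N der])
  next
    assume "weak_hamiltonian \<mu> \<phi>"
    then obtain \<psi> where \<psi>:
      "\<And>t x. t \<in> {0..1} \<Longrightarrow> ((\<lambda>s. \<mu> s x) has_real_derivative vel (\<mu> t) (\<psi> t) x) (at t within {0..1})"
      "\<And>t x. t \<in> {0..1} \<Longrightarrow> ((\<lambda>s. \<psi> s x) has_real_derivative - force (\<mu> t) (\<psi> t) x) (at t within {0..1})"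
      using hamiltonian_if_weak[OF pos ac meas N der] by blast
    show "constant_speed_geodesic W \<mu>" by (rule geodesic_if_hamiltonian[OF pos \<psi>])
  qed
qed

text \<open>The growth equation is the mean of the equations for \<open>\<phi>\<close> with weights \<open>\<pi> p\<close>, and the edge equations
  are their differences. Conversely, differences along edges give all differences by irreducibility,
  and together with the mean they determine \<open>\<phi>\<close>.\<close>

lemma weak_hamiltonian_iff:
  fixes \<mu> \<psi> :: "real \<Rightarrow> 'x \<Rightarrow> real" and h :: "real \<Rightarrow> real"
  assumes pos: "\<And>t. t \<in> {0..1} \<Longrightarrow> \<mu> t \<in> pos_densities"
  defines "\<phi> \<equiv> \<lambda>t. potential (\<psi> t) (h t)"
  shows "weak_hamiltonian \<mu> \<phi> \<longleftrightarrow>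
    (\<forall>\<zeta>\<in>C1c_unit_interval. weak_decay \<zeta> h
       (\<lambda>t. b\<^sup>2 / (2 * a\<^sup>2) * (\<Sum>x\<in>UNIV. \<Sum>y\<in>UNIV. (grad (\<psi> t) x y)\<^sup>2 * d1_log_mean (\<mu> t x) (\<mu> t y) * K x y * \<pi> x * p x))) \<and>
    (\<forall>\<zeta>\<in>C1c_unit_interval. \<forall>x y. K x y \<noteq> 0 \<longrightarrow> weak_decay \<zeta> (\<lambda>t. grad (\<psi> t) x y)
       (\<lambda>t. 1 / 2 * ((\<Sum>z\<in>UNIV. (grad (\<psi> t) z y)\<^sup>2 * K y z * d1_log_mean (\<mu> t y) (\<mu> t z)) -
                 (\<Sum>z\<in>UNIV. (grad (\<psi> t) z x)\<^sup>2 * K x z * d1_log_mean (\<mu> t x) (\<mu> t z)))))"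
    (is "_ \<longleftrightarrow> (\<forall>\<zeta>\<in>_. weak_decay \<zeta> h ?gh) \<and> (\<forall>\<zeta>\<in>_. \<forall>x y. _ \<longrightarrow> weak_decay \<zeta> _ (?gp x y))")
proof -
  define f where "f t x = force (\<mu> t) (\<phi> t) x" for t x
  have d1: "d1_log_mean (\<mu> t x) (\<mu> t y) = d1_mean (\<mu> t x) (\<mu> t y)" if "t \<in> {0..1}" for t x y
    using pos[OF that] by (intro d1_log_mean_eq) (auto simp: pos_densities_def)
  have sum_f: "(\<Sum>y\<in>UNIV. (grad (\<psi> t) x y)\<^sup>2 * d1_log_mean (\<mu> t x) (\<mu> t y) * K x y) = 2 / b\<^sup>2 * f t x" if "t \<in> {0..1}" for t x
    unfolding f_def \<phi>_def force_potential d1[OF that] using b_pos by simp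
  have gh: "?gh t = (\<Sum>x\<in>UNIV. \<pi> x * p x / a\<^sup>2 * f t x)" if t: "t \<in> {0..1}" for t
  proof -
    have "(\<Sum>x\<in>UNIV. \<Sum>y\<in>UNIV. (grad (\<psi> t) x y)\<^sup>2 * d1_log_mean (\<mu> t x) (\<mu> t y) * K x y * \<pi> x * p x)
        = (\<Sum>x\<in>UNIV. 2 / b\<^sup>2 * f t x * \<pi> x * p x)"
      by (simp only: sum_distrib_right[symmetric] sum_f[OF t])
    then show ?thesis using b_pos by (simp add: sum_distrib_left sum_divide_distrib mult_ac)
  qed
  have gp: "?gp x y t = 1 / b\<^sup>2 * (f t y - f t x)" if t: "t \<in> {0..1}" for t x y
  proof -
    have "(\<Sum>z\<in>UNIV. (grad (\<psi> t) z y)\<^sup>2 * K y z * d1_log_mean (\<mu> t y) (\<mu> t z)) = 2 / b\<^sup>2 * f t y" for y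
      using sum_f[OF t, of y] by (simp add: grad_def power2_commute[of "\<psi> t y"] mult_ac)
    then show ?thesis by (simp add: right_diff_distrib)
  qed
  have h: "h t = (\<Sum>x\<in>UNIV. \<pi> x * p x / a\<^sup>2 * \<phi> t x)" for t
    using pairing_potential[of "\<psi> t" "h t"] a_pos
    by (simp add: \<phi>_def pairing_def sum_divide_distrib[symmetric] mult_ac field_simps)
  have gr: "grad (\<psi> t) x y = 1 / b\<^sup>2 * (\<phi> t y - \<phi> t x)" for t x y
    using b_pos by (simp add: \<phi>_def potential_diff grad_def)
  have conv_h: "weak_decay \<zeta> h ?gh \<longleftrightarrow> weak_decay \<zeta> (\<lambda>t. \<Sum>x\<in>UNIV. \<pi> x * p x / a\<^sup>2 * \<phi> t x) (\<lambda>t. \<Sum>x\<in>UNIV. \<pi> x * p x / a\<^sup>2 * f t x)" for \<zeta>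
    by (rule weak_decay_cong[OF h gh])
  have conv_p: "weak_decay \<zeta> (\<lambda>t. grad (\<psi> t) x y) (?gp x y) \<longleftrightarrow>
      weak_decay \<zeta> (\<lambda>t. 1 / b\<^sup>2 * (\<phi> t y - \<phi> t x)) (\<lambda>t. 1 / b\<^sup>2 * (f t y - f t x))" for \<zeta> x y
    by (rule weak_decay_cong[OF gr gp])
  have wh: "weak_hamiltonian \<mu> \<phi> \<longleftrightarrow> (\<forall>\<zeta>\<in>C1c_unit_interval. \<forall>x. weak_decay \<zeta> (\<lambda>t. \<phi> t x) (\<lambda>t. f t x))"
    by (simp add: weak_hamiltonian_def f_def)
  show ?thesis
    unfolding wh conv_h conv_p
  proof (intro iffI conjI ballI allI impI)
    fix \<zeta> x y
    assume "\<forall>\<zeta>\<in>C1c_unit_interval. \<forall>x. weak_decay \<zeta> (\<lambda>t. \<phi> t x) (\<lambda>t. f t x)" and "\<zeta> \<in> C1c_unit_interval"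
    then have w: "weak_decay \<zeta> (\<lambda>t. \<phi> t x) (\<lambda>t. f t x)" for x by blast
    show "weak_decay \<zeta> (\<lambda>t. \<Sum>x\<in>UNIV. \<pi> x * p x / a\<^sup>2 * \<phi> t x) (\<lambda>t. \<Sum>x\<in>UNIV. \<pi> x * p x / a\<^sup>2 * f t x)"
      by (intro weak_decay_sum weak_decay_cmult w)
    have "weak_decay \<zeta> (\<lambda>t. \<phi> t y + (-1) * \<phi> t x) (\<lambda>t. f t y + (-1) * f t x)"
      by (intro weak_decay_add weak_decay_cmult w)
    from weak_decay_cmult[OF this, of "1 / b\<^sup>2"]
    show "weak_decay \<zeta> (\<lambda>t. 1 / b\<^sup>2 * (\<phi> t y - \<phi> t x)) (\<lambda>t. 1 / b\<^sup>2 * (f t y - f t x))" by simp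
  next
    fix \<zeta> x
    assume H: "(\<forall>\<zeta>\<in>C1c_unit_interval. weak_decay \<zeta> (\<lambda>t. \<Sum>x\<in>UNIV. \<pi> x * p x / a\<^sup>2 * \<phi> t x) (\<lambda>t. \<Sum>x\<in>UNIV. \<pi> x * p x / a\<^sup>2 * f t x)) \<and>
      (\<forall>\<zeta>\<in>C1c_unit_interval. \<forall>x y. K x y \<noteq> 0 \<longrightarrow> weak_decay \<zeta> (\<lambda>t. 1 / b\<^sup>2 * (\<phi> t y - \<phi> t x)) (\<lambda>t. 1 / b\<^sup>2 * (f t y - f t x)))"
      and \<zeta>: "\<zeta> \<in> C1c_unit_interval"
    have wh: "weak_decay \<zeta> (\<lambda>t. \<Sum>x\<in>UNIV. \<pi> x * p x / a\<^sup>2 * \<phi> t x) (\<lambda>t. \<Sum>x\<in>UNIV. \<pi> x * p x / a\<^sup>2 * f t x)"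
      using H \<zeta> by blast
    have edge: "weak_decay \<zeta> (\<lambda>t. \<phi> t z - \<phi> t y) (\<lambda>t. f t z - f t y)" if "0 < K y z" for y z
    proof -
      have "weak_decay \<zeta> (\<lambda>t. 1 / b\<^sup>2 * (\<phi> t z - \<phi> t y)) (\<lambda>t. 1 / b\<^sup>2 * (f t z - f t y))"
        using conjunct2[OF H, rule_format, OF \<zeta>, of y z] that by simp
      from weak_decay_cmult[OF this, of "b\<^sup>2"] show ?thesis using b_pos by simp
    qed
    have all: "weak_decay \<zeta> (\<lambda>t. \<phi> t y - \<phi> t x) (\<lambda>t. f t y - f t x)" for y
    proof (rule connected_induct[where P = "\<lambda>y. weak_decay \<zeta> (\<lambda>t. \<phi> t y - \<phi> t x) (\<lambda>t. f t y - f t x)" and x = x])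
      show "weak_decay \<zeta> (\<lambda>t. \<phi> t x - \<phi> t x) (\<lambda>t. f t x - f t x)" by (simp add: weak_decay_def)
      fix y z assume "weak_decay \<zeta> (\<lambda>t. \<phi> t y - \<phi> t x) (\<lambda>t. f t y - f t x)" "0 < K y z"
      from weak_decay_add[OF edge[OF this(2)] this(1)]
      show "weak_decay \<zeta> (\<lambda>t. \<phi> t z - \<phi> t x) (\<lambda>t. f t z - f t x)" by simp
    qed
    have recover: "a\<^sup>2 * (\<Sum>y\<in>UNIV. \<pi> y * p y / a\<^sup>2 * g y) + (-1) * (\<Sum>y\<in>UNIV. \<pi> y * p y * (g y - g x)) = g x" for g :: "'x \<Rightarrow> real"
    proof -
      have "a\<^sup>2 * (\<Sum>y\<in>UNIV. \<pi> y * p y / a\<^sup>2 * g y) = (\<Sum>y\<in>UNIV. \<pi> y * p y * g y)"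
        using a_pos by (simp add: sum_distrib_left)
      moreover have "(\<Sum>y\<in>UNIV. \<pi> y * p y * (g y - g x)) = (\<Sum>y\<in>UNIV. \<pi> y * p y * g y) - (\<Sum>y\<in>UNIV. \<pi> y * p y) * g x"
        by (simp add: right_diff_distrib sum_subtractf sum_distrib_right)
      ultimately show ?thesis by (simp add: p\<pi>_mass)
    qed
    have "weak_decay \<zeta> (\<lambda>t. a\<^sup>2 * (\<Sum>y\<in>UNIV. \<pi> y * p y / a\<^sup>2 * \<phi> t y) + (-1) * (\<Sum>y\<in>UNIV. \<pi> y * p y * (\<phi> t y - \<phi> t x)))
        (\<lambda>t. a\<^sup>2 * (\<Sum>y\<in>UNIV. \<pi> y * p y / a\<^sup>2 * f t y) + (-1) * (\<Sum>y\<in>UNIV. \<pi> y * p y * (f t y - f t x)))"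
      by (intro weak_decay_add weak_decay_cmult weak_decay_sum wh all)
    then show "weak_decay \<zeta> (\<lambda>t. \<phi> t x) (\<lambda>t. f t x)" unfolding recover .
  qed
qed

lemma flow_of_continuity_equation:
  assumes m: "m \<in> pos_densities"
    and ce: "\<mu>' + div_K K (\<lambda>x y. edge_mean m x y * grad \<psi> x y) x = h * p x"
  shows "\<mu>' = flow m \<psi> h x"
proof -
  have sym: "edge_mean m x y = edge_mean m y x" for x y
    using m unfolding edge_mean_def by (intro log_mean_commute) (auto simp: pos_densities_def less_imp_le)
  have eq: "(edge_mean m x y * grad \<psi> x y - edge_mean m y x * grad \<psi> y x) * K x y = 2 * ((\<psi> y - \<psi> x) * edge_mean m x y * K x y)" for y
    unfolding sym[of y x] grad_def by (simp add: algebra_simps)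
  have "div_K K (\<lambda>x y. edge_mean m x y * grad \<psi> x y) x = (\<Sum>y\<in>UNIV. (\<psi> y - \<psi> x) * edge_mean m x y * K x y)"
    unfolding div_K_def eq sum_distrib_left[symmetric] by simp
  then show ?thesis using ce by (simp add: flow_def)
qed

end

theorem theorem3p16:
  fixes K :: "'x::finite \<Rightarrow> 'x \<Rightarrow> real"
    and \<pi> p :: "'x \<Rightarrow> real"
    and a b :: real
    and \<mu> \<psi> :: "real \<Rightarrow> 'x \<Rightarrow> real"
    and h :: "real \<Rightarrow> real"
  assumes "markov_kernel K" and "irreducible_kernel K"
    and "invariant_probability K \<pi>" and "reversible_kernel K \<pi>"
    and "0 < a" and "0 < b"
    and "p \<in> pos_densities" and "(\<Sum>x\<in>UNIV. p x * \<pi> x) = 1"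
    and "\<forall>t\<in>{0..1}. \<mu> t \<in> pos_densities"
    and "abs_continuous_curve \<mu>"
    and "AE t in lebesgue_on {0..1}. \<forall>x. \<exists>\<mu>'.
          ((\<lambda>s. \<mu> s x) has_real_derivative \<mu>') (at t within {0..1}) \<and>
          \<mu>' + div_K K (\<lambda>x y. edge_mean (\<mu> t) x y * grad (\<psi> t) x y) x = h t * p x"
  shows "constant_speed_geodesic (transport_dist K \<pi> p a b) \<mu> \<longleftrightarrow>
    (\<forall>\<zeta>\<in>C1c_unit_interval.
       let g = (\<lambda>t. \<Sum>x\<in>UNIV. \<Sum>y\<in>UNIV.
                 (grad (\<psi> t) x y)\<^sup>2 * d1_log_mean (\<mu> t x) (\<mu> t y) * K x y * \<pi> x * p x)
       in integrable (lebesgue_on {0..1}) (\<lambda>t. h t * deriv \<zeta> t) \<and>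
          integrable (lebesgue_on {0..1}) (\<lambda>t. g t * \<zeta> t) \<and>
          (LINT t|lebesgue_on {0..1}. h t * deriv \<zeta> t) =
            b\<^sup>2 / (2 * a\<^sup>2) * (LINT t|lebesgue_on {0..1}. g t * \<zeta> t)) \<and>
    (\<forall>\<zeta>\<in>C1c_unit_interval. \<forall>x y. K x y \<noteq> 0 \<longrightarrow>
       (let g = (\<lambda>t.
                 (\<Sum>z\<in>UNIV. (grad (\<psi> t) z y)\<^sup>2 * K y z * d1_log_mean (\<mu> t y) (\<mu> t z)) -
                 (\<Sum>z\<in>UNIV. (grad (\<psi> t) z x)\<^sup>2 * K x z * d1_log_mean (\<mu> t x) (\<mu> t z)))
        in integrable (lebesgue_on {0..1}) (\<lambda>t. grad (\<psi> t) x y * deriv \<zeta> t) \<and>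
           integrable (lebesgue_on {0..1}) (\<lambda>t. g t * \<zeta> t) \<and>
           (LINT t|lebesgue_on {0..1}. grad (\<psi> t) x y * deriv \<zeta> t) =
             1 / 2 * (LINT t|lebesgue_on {0..1}. g t * \<zeta> t)))"
proof -
  interpret reversible_chain K \<pi> p a b
    by unfold_locales (use assms in auto)
  have pos: "\<mu> t \<in> pos_densities" if "t \<in> {0..1}" for t using assms(9) that by blast
  have ac: "abs_continuous_on_interval 0 1 (\<lambda>t. \<mu> t x)" for x
    using assms(10) by (simp add: abs_continuous_curve_def)
  obtain N where N: "negligible N" and ce: "\<And>t. t \<in> {0..1} - N \<Longrightarrow> \<forall>x. \<exists>\<mu>'.
          ((\<lambda>s. \<mu> s x) has_real_derivative \<mu>') (at t within {0..1}) \<and>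
          \<mu>' + div_K K (\<lambda>x y. edge_mean (\<mu> t) x y * grad (\<psi> t) x y) x = h t * p x"
    by (rule AE_lebesgue_on_negligible[OF assms(11)]) auto
  have der: "((\<lambda>s. \<mu> s x) has_real_derivative vel (\<mu> t) (potential (\<psi> t) (h t)) x) (at t within {0..1})"
    if t: "t \<in> {0..1} - N" for t x
  proof -
    obtain \<mu>' where d: "((\<lambda>s. \<mu> s x) has_real_derivative \<mu>') (at t within {0..1})"
      and e: "\<mu>' + div_K K (\<lambda>x y. edge_mean (\<mu> t) x y * grad (\<psi> t) x y) x = h t * p x"
      using ce[OF t] by blast
    have "t \<in> {0..1}" using t by simp
    from flow_of_continuity_equation[OF pos[OF this] e] d show ?thesis by (simp only: vel_potential)
  qed
  have half: "(1 / 2 :: real) \<noteq> 0" by simp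
  have ab: "b\<^sup>2 / (2 * a\<^sup>2) \<noteq> 0" using assms(5,6) by simp
  have "constant_speed_geodesic W \<mu> \<longleftrightarrow> weak_hamiltonian \<mu> (\<lambda>t. potential (\<psi> t) (h t))"
    by (rule geodesic_iff_weak_hamiltonian[OF pos ac N der])
  also note weak_hamiltonian_iff[OF pos, where \<psi> = \<psi> and h = h]
  finally show ?thesis
    unfolding weak_decay_scaled_iff[OF ab] weak_decay_scaled_iff[OF half] Let_def .
qed

end
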